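(* There is a universal constant $C>0$ such that the following holds. For any weighted hypergraph $H=(V,E,w)$ with $n=|V|$ vertices and any $\varepsilon>0$, there is a weighted hypergraph $\tilde H=(V,\tilde E,\tilde w)$ that is a spectral $\varepsilon$-sparsifier for $H$ and satisfies $$|\tilde E|\le C\,\frac{\log D}{\varepsilon^2}\,n\log n,$$ where $D=\max_{e\in E}|e|$.
   Context: A weighted hypergraph $H=(V,E,w)$ consists of a finite vertex set $V$, a finite nonempty set $E$ of hyperedges (subsets of $V$, each containing at least two vertices), and weights $w=(w_e)_{e\in E}$ with $w_e\ge 0$. Its energy is the function $Q_H:\mathbb{R}^V\to\mathbb{R}$, $$Q_H(x)=\sum_{e\in E}w_e\max_{\{u,v\}\in\binom{e}{2}}(x_u-x_v)^2,$$ where $\binom{e}{2}$ is the set of two-element subsets of $e$. A weighted hypergraph $\tilde H=(V,\tilde E,\tilde w)$ (with $\tilde E$ allowed to be empty, in which case $Q_{\tilde H}=0$) is a spectral $\varepsilon$-sparsifier for $H$ if $\tilde E\subseteq E$ and $|Q_H(x)-Q_{\tilde H}(x)|\le\varepsilon\,Q_H(x)$ for all $x\in\mathbb{R}^V$. *)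

theory Defs
  imports Complex_Main
begin

text \<open>
  Weights and potentials are total functions, but only the values of \<open>w\<close> on \<open>E\<close>
  and of \<open>x\<close> on the vertices are ever used.  Since sparsifiers may have no hyperedges,
  nonemptiness of the hyperedge set is kept separate.
\<close>

definition weighted_hypergraph0 :: "'a set \<Rightarrow> 'a set set \<Rightarrow> ('a set \<Rightarrow> real) \<Rightarrow> bool" where
  "weighted_hypergraph0 V E w \<longleftrightarrow>
     finite V \<and> finite E \<and> (\<forall>e\<in>E. e \<subseteq> V \<and> 2 \<le> card e \<and> 0 \<le> w e)"

definition weighted_hypergraph :: "'a set \<Rightarrow> 'a set set \<Rightarrow> ('a set \<Rightarrow> real) \<Rightarrow> bool" where
  "weighted_hypergraph V E w \<longleftrightarrow> weighted_hypergraph0 V E w \<and> E \<noteq> {}"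

definition edge_energy :: "'a set \<Rightarrow> ('a \<Rightarrow> real) \<Rightarrow> real" where
  "edge_energy e x = Max {(x u - x v)\<^sup>2 | u v. u \<in> e \<and> v \<in> e \<and> u \<noteq> v}"

definition energy :: "'a set set \<Rightarrow> ('a set \<Rightarrow> real) \<Rightarrow> ('a \<Rightarrow> real) \<Rightarrow> real" where
  "energy E w x = (\<Sum>e\<in>E. w e * edge_energy e x)"

definition spectral_sparsifier ::
  "real \<Rightarrow> 'a set \<Rightarrow> 'a set set \<Rightarrow> ('a set \<Rightarrow> real) \<Rightarrow> 'a set set \<Rightarrow> ('a set \<Rightarrow> real) \<Rightarrow> bool" where
  "spectral_sparsifier \<epsilon> V E w E' w' \<longleftrightarrow>
     weighted_hypergraph0 V E' w' \<and> E' \<subseteq> E \<and>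
     (\<forall>x. \<bar>energy E w x - energy E' w' x\<bar> \<le> \<epsilon> * energy E w x)"

definition max_edge_size :: "'a set set \<Rightarrow> nat" where
  "max_edge_size E = Max (card ` E)"

text \<open>
  A statement of the form \<open>\<exists>C. \<forall>V :: 'a set. \<dots>\<close> formally lets the constant depend on the type
  \<open>'a\<close>.  The following relabelling lemma shows that a constant that works for vertex sets of
  natural numbers works for every vertex type, so the type parameter does not
  affect the universality of \<open>C\<close>.
\<close>

lemma sparsifier_constant_type_independent:
  fixes C :: real
  assumes nat_case: "\<And>(V :: nat set) E w \<epsilon>. weighted_hypergraph V E w \<Longrightarrow> 0 < \<epsilon> \<Longrightarrow>
      \<exists>E' w'. spectral_sparsifier \<epsilon> V E w E' w' \<and>
        real (card E') \<le> C * (ln (real (max_edge_size E)) / \<epsilon>\<^sup>2) * real (card V) * ln (real (card V))"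
    and H: "weighted_hypergraph (V :: 'a set) E w" and eps: "0 < \<epsilon>"
  shows "\<exists>E' w'. spectral_sparsifier \<epsilon> V E w E' w' \<and>
      real (card E') \<le> C * (ln (real (max_edge_size E)) / \<epsilon>\<^sup>2) * real (card V) * ln (real (card V))"
proof -
  have fin: "finite V" "finite E" and ne: "E \<noteq> {}"
    and edges: "\<And>e. e \<in> E \<Longrightarrow> e \<subseteq> V \<and> 2 \<le> card e \<and> 0 \<le> w e"
    using H by (auto simp: weighted_hypergraph_def weighted_hypergraph0_def)
  obtain f :: "'a \<Rightarrow> nat" where f: "inj_on f V"
    using finite_imp_inj_to_nat_seg[OF fin(1)] by blast
  define g where "g = inv_into V f"
  have gf: "g (f u) = u" if "u \<in> V" for u
    using f that by (simp add: g_def)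
  have gfe: "g ` f ` e = e" if "e \<subseteq> V" for e
  proof -
    have "g ` f ` e = (\<lambda>u. u) ` e"
      unfolding image_image by (rule image_cong) (use gf that in blast)+
    then show ?thesis by simp
  qed
  have cardf: "card (f ` e) = card e" if "e \<subseteq> V" for e
    using f that by (meson card_image inj_on_subset)
  have injF: "inj_on ((`) f) S" if "S \<subseteq> E" for S
  proof (rule inj_on_inverseI[where g = "(`) g"])
    fix e assume "e \<in> S"
    then have "e \<subseteq> V" using that edges by blast
    then show "g ` f ` e = e" by (rule gfe)
  qed
  have edge_en: "edge_energy (f ` e) (\<lambda>i. x (g i)) = edge_energy e x" if "e \<subseteq> V" for e x
  proof -
    have "{(x (g u) - x (g v))\<^sup>2 | u v. u \<in> f ` e \<and> v \<in> f ` e \<and> u \<noteq> v}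
        = {(x u - x v)\<^sup>2 | u v. u \<in> e \<and> v \<in> e \<and> u \<noteq> v}" (is "?A = ?B")
    proof (intro equalityI subsetI)
      fix t assume "t \<in> ?A"
      then obtain a b where "a \<in> e" "b \<in> e" "f a \<noteq> f b" "t = (x (g (f a)) - x (g (f b)))\<^sup>2"
        by auto
      then have "t = (x a - x b)\<^sup>2" "a \<noteq> b" using that by (auto simp: gf subsetD[OF that])
      with \<open>a \<in> e\<close> \<open>b \<in> e\<close> show "t \<in> ?B" by blast
    next
      fix t assume "t \<in> ?B"
      then obtain a b where ab: "a \<in> e" "b \<in> e" "a \<noteq> b" "t = (x a - x b)\<^sup>2"
        by auto
      then have "f a \<noteq> f b" "t = (x (g (f a)) - x (g (f b)))\<^sup>2"
        using gf that by (metis subsetD, simp add: gf subsetD[OF that])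
      with ab show "t \<in> ?A" by blast
    qed
    then show ?thesis by (simp add: edge_energy_def)
  qed
  define E1 where "E1 = (`) f ` E"
  define w1 where "w1 = (\<lambda>e. w (g ` e))"
  have "weighted_hypergraph (f ` V) E1 w1"
    unfolding weighted_hypergraph_def weighted_hypergraph0_def E1_def w1_def
  proof (intro conjI ballI)
    fix e1 assume "e1 \<in> (`) f ` E"
    then obtain e where e: "e \<in> E" "e1 = f ` e" by blast
    then show "e1 \<subseteq> f ` V" "2 \<le> card e1" "0 \<le> w (g ` e1)"
      using edges[OF e(1)] gfe[of e] cardf[of e] by (simp_all add: image_mono)
  qed (use fin ne in auto)
  from nat_case[OF this eps] obtain E1' w1' where
    S1: "spectral_sparsifier \<epsilon> (f ` V) E1 w1 E1' w1'" and
    B1: "real (card E1') \<le> C * (ln (real (max_edge_size E1)) / \<epsilon>\<^sup>2) * real (card (f ` V)) * ln (real (card (f ` V)))"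
    by blast
  define E' where "E' = {e \<in> E. f ` e \<in> E1'}"
  define w' where "w' = (\<lambda>e. w1' (f ` e))"
  have sub: "E' \<subseteq> E" by (auto simp: E'_def)
  have E1': "E1' = (`) f ` E'"
    using S1 by (auto simp: spectral_sparsifier_def E1_def E'_def)
  have en: "energy ((`) f ` S) v (\<lambda>i. x (g i)) = energy S u x"
    if "S \<subseteq> E" and uv: "\<And>e. e \<in> S \<Longrightarrow> v (f ` e) = u e" for S v u x
  proof -
    have "energy ((`) f ` S) v (\<lambda>i. x (g i))
        = (\<Sum>e\<in>S. v (f ` e) * edge_energy (f ` e) (\<lambda>i. x (g i)))"
      unfolding energy_def by (subst sum.reindex[OF injF[OF \<open>S \<subseteq> E\<close>]]) (simp only: o_def)
    also have "\<dots> = energy S u x"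
      unfolding energy_def
    proof (rule sum.cong[OF refl])
      fix e assume "e \<in> S"
      then have "e \<subseteq> V" using \<open>S \<subseteq> E\<close> edges by blast
      then show "v (f ` e) * edge_energy (f ` e) (\<lambda>i. x (g i)) = u e * edge_energy e x"
        by (simp only: edge_en uv[OF \<open>e \<in> S\<close>])
    qed
    finally show ?thesis .
  qed
  have en1: "energy E1 w1 (\<lambda>i. x (g i)) = energy E w x" for x
    unfolding E1_def by (rule en) (use edges gfe w1_def in auto)
  have en2: "energy E1' w1' (\<lambda>i. x (g i)) = energy E' w' x" for x
    unfolding E1' by (rule en[OF sub]) (simp add: w'_def)
  have S1': "\<bar>energy E1 w1 y - energy E1' w1' y\<bar> \<le> \<epsilon> * energy E1 w1 y" for y
    using S1 by (simp add: spectral_sparsifier_def)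
  have "\<bar>energy E w x - energy E' w' x\<bar> \<le> \<epsilon> * energy E w x" for x
    using S1'[of "\<lambda>i. x (g i)"] by (simp only: en1 en2)
  moreover have "weighted_hypergraph0 V E' w'"
    unfolding weighted_hypergraph0_def
  proof (intro conjI ballI)
    fix e assume "e \<in> E'"
    then have e: "e \<in> E" "f ` e \<in> E1'" by (simp_all add: E'_def)
    then show "e \<subseteq> V" "2 \<le> card e" using edges by blast+
    show "0 \<le> w' e"
      using S1 e(2) by (simp add: spectral_sparsifier_def weighted_hypergraph0_def w'_def)
  qed (use fin finite_subset[OF sub] in auto)
  ultimately have "spectral_sparsifier \<epsilon> V E w E' w'"
    using sub by (simp add: spectral_sparsifier_def)
  moreover have "card E1' = card E'"
    unfolding E1' by (rule card_image[OF injF[OF sub]])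
  moreover have "max_edge_size E1 = max_edge_size E"
    proof -
    have "card ` (`) f ` E = card ` E"
      unfolding image_image by (rule image_cong) (use edges cardf in blast)+
    then show ?thesis by (simp add: max_edge_size_def E1_def)
  qed
  ultimately show ?thesis
    using B1 cardf[of V] by auto
qed

end

theory Submission
  imports Defs "HOL-Analysis.Function_Topology" "HOL-Analysis.L2_Norm" "HOL-Analysis.Convex"
    "Jordan_Normal_Form.Determinant"
begin

text \<open>
  Maximising a determinant gives vectors \<open>b\<^sub>u \<in> \<real>\<^sup>n\<close> such that the potentials are
  \<open>x\<^sub>u = \<langle>b\<^sub>u, y\<rangle>\<close>, the energy is at least \<open>\<bar>y\<bar>\<^sup>2\<close>, and
  \<open>\<Sum>\<^sub>e w\<^sub>e max \<bar>b\<^sub>u - b\<^sub>v\<bar>\<^sup>2 \<le> n\<close>.  All but a quarter of the \<open>m\<close> hyperedges then have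
  \<open>w\<^sub>e max \<bar>b\<^sub>u - b\<^sub>v\<bar>\<^sup>2 \<le> \<tau> = 4 n / m\<close>.  For these, random signs \<open>\<epsilon>\<^sub>e\<close> satisfy
  \<open>\<bar>\<Sum>\<^sub>e \<epsilon>\<^sub>e N\<^sub>e(y)\<^sup>2\<bar> = O(sqrt (\<tau> ln n ln D))\<close> uniformly over all \<open>y\<close> of energy at most \<open>1\<close>,
  where \<open>N\<^sub>e(y)\<^sup>2\<close> is the energy of \<open>e\<close>.  Keeping the hyperedges of the rarer sign with doubled
  weight removes a constant fraction of the hyperedges; iterating this gives the sparsifier.

  The uniform bound is a chaining over \<open>O(ln n)\<close> scales.  At each scale a point \<open>x\<close> is
  approximated by the projection of the previous approximation to a convex neighbourhood of \<open>x\<close>;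
  hence the squared lengths of the steps add up to at most \<open>1\<close>; this saves a factor
  \<open>sqrt (ln n)\<close> over Dudley's bound.  The neighbourhoods are measured in a norm that is weighted
  by the current approximation; subgaussian noise is of size \<open>O(sqrt (\<tau> ln D))\<close> in it.  Only
  hyperedges whose energy is above the noise level of the scale are taken into account.
\<close>

section \<open>Tilted random signs\<close>

text \<open>An increment \<open>(N e z')^2 - (N e z)^2\<close> is of order
  \<open>N e z * N e (z' - z)\<close>, so its variance is a weighted square norm of
  \<open>z' - z\<close> whose weights \<open>(N e z)^2\<close> sum to at most \<open>1\<close>. In
  such a norm the noise meets only one maximum at a time, over the at most \<open>D^2\<close> pairs
  of a single hyperedge; this gives \<open>ln D\<close>. Closeness for all hyperedges simultaneously
  does cost \<open>ln n\<close>, but it only serves to keep the weights comparable from one scale to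
  the next, and the number \<open>J\<close> of scales absorbs it. The chain trades two quantities: a
  step at scale \<open>j\<close> multiplies the number of centres by \<open>exp (O(l 64^j))\<close>,
  while the variance of its increment decays like \<open>64^-j\<close>. By Cauchy-Schwarz the error
  is the square root of the sum of the radii \<open>l\<close> times the total rescaled variance,
  that is, of \<open>J * (\<tau> ln D)\<close>. Noise is built from finitely many signs instead of
  Gaussians, so that every probability is a finite sum; tilting the signs replaces the
  Cameron-Martin shift.\<close>

definition signs :: "'i set \<Rightarrow> ('i \<Rightarrow> real) set" where
  "signs I = (\<Pi>\<^sub>E i\<in>I. {-1, 1})"

text \<open>The density of independent signs with means \<open>\<theta> i\<close>; it is nonnegative
  as soon as all \<open>\<bar>\<theta> i\<bar> \<le> 1\<close>.\<close>

definition tilt :: "('i \<Rightarrow> real) \<Rightarrow> 'i set \<Rightarrow> ('i \<Rightarrow> real) \<Rightarrow> real" where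
  "tilt \<theta> I \<eta> = (\<Prod>i\<in>I. (1 + \<theta> i * \<eta> i) / 2)"

lemma finite_signs [simp]: "finite I \<Longrightarrow> finite (signs I)"
  unfolding signs_def by (intro finite_PiE) auto

lemma signs_cases: "\<eta> \<in> signs I \<Longrightarrow> i \<in> I \<Longrightarrow> \<eta> i = 1 \<or> \<eta> i = -1"
  unfolding signs_def by (auto simp: PiE_iff)

lemma card_signs: "finite I \<Longrightarrow> card (signs I) = 2 ^ card I"
  unfolding signs_def by (subst card_PiE) (auto simp: numeral_eq_Suc)

lemma sum_signs_prod:
  fixes F :: "'i \<Rightarrow> real \<Rightarrow> real"
  assumes "finite I"
  shows "(\<Sum>\<eta>\<in>signs I. \<Prod>i\<in>I. F i (\<eta> i)) = (\<Prod>i\<in>I. F i (-1) + F i 1)"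
proof -
  have "(\<Prod>i\<in>I. F i (-1) + F i 1) = (\<Prod>i\<in>I. \<Sum>s\<in>{-1,1}. F i s)"
    by (intro prod.cong) auto
  also have "\<dots> = (\<Sum>\<eta>\<in>signs I. \<Prod>i\<in>I. F i (\<eta> i))"
    unfolding signs_def using assms by (subst prod_sum_PiE) auto
  finally show ?thesis by simp
qed

lemma tilt_nonneg:
  assumes "\<And>i. i \<in> I \<Longrightarrow> \<bar>\<theta> i\<bar> \<le> 1" "\<eta> \<in> signs I"
  shows "0 \<le> tilt \<theta> I \<eta>"
  unfolding tilt_def
proof (intro prod_nonneg ballI)
  fix i assume "i \<in> I"
  then show "0 \<le> (1 + \<theta> i * \<eta> i) / 2"
    using assms(1)[of i] signs_cases[OF assms(2), of i] by auto
qed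

lemma sum_tilt: "finite I \<Longrightarrow> (\<Sum>\<eta>\<in>signs I. tilt \<theta> I \<eta>) = 1"
  unfolding tilt_def by (subst sum_signs_prod) (auto simp: field_simps)

lemma tilt_zero: "tilt (\<lambda>_. 0) I \<eta> = 1 / 2 ^ card I"
  by (simp add: tilt_def power_one_over)

text \<open>For a variable of mean zero the term \<open>x\<close> averages out, and what remains is
  a subgaussian bound without any restriction on the size of \<open>x\<close>.\<close>

lemma exp_le_add_exp_sq: "exp x \<le> x + exp (x\<^sup>2)" for x :: real
proof -
  have sq: "1 + x\<^sup>2 \<le> exp (x\<^sup>2)" by (rule exp_ge_add_one_self)
  consider "x \<le> 0" | "0 \<le> x" "x \<le> 1" | "1 \<le> x" by linarith
  then show ?thesis
  proof cases
    case 1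
    have "1 \<le> (1 - x) * (1 + x + x\<^sup>2)"
    proof -
      have "(1 - x) * (1 + x + x\<^sup>2) = 1 + x\<^sup>2 * (- x)"
        by (simp add: algebra_simps power2_eq_square)
      then show ?thesis using 1 by (simp add: mult_nonneg_nonpos)
    qed
    also have "\<dots> \<le> exp (- x) * (1 + x + x\<^sup>2)"
    proof (rule mult_right_mono)
      show "1 - x \<le> exp (- x)" using exp_ge_add_one_self[of "- x"] by simp
      have "0 \<le> (x + 1/2)\<^sup>2" by simp
      then show "0 \<le> 1 + x + x\<^sup>2" by (simp add: power2_eq_square algebra_simps)
    qed
    finally have "exp x \<le> 1 + x + x\<^sup>2"
      by (simp add: exp_minus field_simps)
    then show ?thesis using sq by linarith
  next
    case 2
    then show ?thesis using exp_bound[of x] sq by linarith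
  next
    case 3
    then have "x \<le> x\<^sup>2" by (simp add: power2_eq_square)
    then show ?thesis using 3 by (smt (verit) exp_le_cancel_iff)
  qed
qed

lemma tilt_mgf:
  assumes fin: "finite I" and \<theta>: "\<And>i. i \<in> I \<Longrightarrow> \<bar>\<theta> i\<bar> \<le> 1"
  shows "(\<Sum>\<eta>\<in>signs I. tilt \<theta> I \<eta> * exp (\<Sum>i\<in>I. c i * (\<eta> i - \<theta> i))) \<le> exp (4 * (\<Sum>i\<in>I. (c i)\<^sup>2))"
proof -
  define F where "F = (\<lambda>i s. (1 + \<theta> i * s) / 2 * exp (c i * (s - \<theta> i)))"
  have "(\<Sum>\<eta>\<in>signs I. tilt \<theta> I \<eta> * exp (\<Sum>i\<in>I. c i * (\<eta> i - \<theta> i)))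
      = (\<Sum>\<eta>\<in>signs I. \<Prod>i\<in>I. F i (\<eta> i))"
    by (simp add: tilt_def F_def exp_sum fin flip: prod.distrib)
  also have "\<dots> = (\<Prod>i\<in>I. F i (-1) + F i 1)"
    by (rule sum_signs_prod[OF fin])
  also have "\<dots> \<le> (\<Prod>i\<in>I. exp (4 * (c i)\<^sup>2))"
  proof (rule prod_mono, intro conjI)
    fix i assume i: "i \<in> I"
    have t: "-1 \<le> \<theta> i" "\<theta> i \<le> 1" using \<theta>[OF i] by auto
    show "0 \<le> F i (-1) + F i 1" using t by (auto simp: F_def)
    \<comment> \<open>The linear term has mean zero under the tilted sign; the factor
      \<open>4\<close> is the square of the largest deviation
      \<open>\<bar>s - \<theta> i\<bar> \<le> 2\<close>.\<close>
    have bd: "exp (c i * (s - \<theta> i)) \<le> c i * (s - \<theta> i) + exp (4 * (c i)\<^sup>2)" if "s = 1 \<or> s = -1" for s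
    proof -
      have "(s - \<theta> i)\<^sup>2 \<le> 2\<^sup>2"
        by (rule power2_le_iff_abs_le[THEN iffD2]) (use that t in auto)
      then have "(c i * (s - \<theta> i))\<^sup>2 \<le> 4 * (c i)\<^sup>2"
        by (simp add: power_mult_distrib mult_left_mono mult.commute[of 4])
      then have "exp ((c i * (s - \<theta> i))\<^sup>2) \<le> exp (4 * (c i)\<^sup>2)" by simp
      then show ?thesis using exp_le_add_exp_sq[of "c i * (s - \<theta> i)"] by linarith
    qed
    have "F i (-1) + F i 1 \<le> (1 + \<theta> i * (-1)) / 2 * (c i * (-1 - \<theta> i) + exp (4 * (c i)\<^sup>2))
        + (1 + \<theta> i * 1) / 2 * (c i * (1 - \<theta> i) + exp (4 * (c i)\<^sup>2))"
      unfolding F_def by (intro add_mono mult_left_mono bd) (use t in auto)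
    also have "\<dots> = exp (4 * (c i)\<^sup>2)" by (simp add: field_simps)
    finally show "F i (-1) + F i 1 \<le> exp (4 * (c i)\<^sup>2)" .
  qed
  also have "\<dots> = exp (4 * (\<Sum>i\<in>I. (c i)\<^sup>2))"
    by (simp add: exp_sum fin sum_distrib_left)
  finally show ?thesis .
qed

lemma tilt_tail:
  assumes fin: "finite I" and \<theta>: "\<And>i. i \<in> I \<Longrightarrow> \<bar>\<theta> i\<bar> \<le> 1"
    and v: "(\<Sum>i\<in>I. (c i)\<^sup>2) \<le> v" "0 < v" and t: "0 \<le> t"
  shows "(\<Sum>\<eta>\<in>{\<eta>\<in>signs I. t < \<bar>\<Sum>i\<in>I. c i * (\<eta> i - \<theta> i)\<bar>}. tilt \<theta> I \<eta>) \<le> 2 * exp (- (t\<^sup>2 / (16 * v)))"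
proof -
  define X where "X = (\<lambda>\<eta>. \<Sum>i\<in>I. c i * (\<eta> i - \<theta> i))"
  \<comment> \<open>The minimiser of the Chernoff exponent \<open>4 l^2 v - l t\<close>.\<close>
  define l where "l = t / (8 * v)"
  have l: "0 \<le> l" using v t by (simp add: l_def)
  have nn: "\<And>\<eta>. \<eta> \<in> signs I \<Longrightarrow> 0 \<le> tilt \<theta> I \<eta>" by (rule tilt_nonneg) (use \<theta> in auto)
  have mgf: "(\<Sum>\<eta>\<in>signs I. tilt \<theta> I \<eta> * exp (s * X \<eta>)) \<le> exp (4 * l\<^sup>2 * v)" if "s = l \<or> s = - l" for s
  proof -
    have "(\<Sum>\<eta>\<in>signs I. tilt \<theta> I \<eta> * exp (s * X \<eta>))
      = (\<Sum>\<eta>\<in>signs I. tilt \<theta> I \<eta> * exp (\<Sum>i\<in>I. (s * c i) * (\<eta> i - \<theta> i)))"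
      by (simp add: X_def sum_distrib_left mult.assoc)
    also have "\<dots> \<le> exp (4 * (\<Sum>i\<in>I. (s * c i)\<^sup>2))" by (rule tilt_mgf[OF fin \<theta>])
    also have "(\<Sum>i\<in>I. (s * c i)\<^sup>2) = l\<^sup>2 * (\<Sum>i\<in>I. (c i)\<^sup>2)"
      using that by (auto simp: power_mult_distrib sum_distrib_left)
    also have "exp (4 * (l\<^sup>2 * (\<Sum>i\<in>I. (c i)\<^sup>2))) \<le> exp (4 * l\<^sup>2 * v)"
      using v(1) by (simp add: mult_left_mono mult.assoc)
    finally show ?thesis .
  qed
  have "(\<Sum>\<eta>\<in>{\<eta>\<in>signs I. t < \<bar>X \<eta>\<bar>}. tilt \<theta> I \<eta>)
      \<le> (\<Sum>\<eta>\<in>{\<eta>\<in>signs I. t < \<bar>X \<eta>\<bar>}. tilt \<theta> I \<eta> * (exp (- (l * t)) * (exp (l * X \<eta>) + exp (- l * X \<eta>))))"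
  proof (rule sum_mono)
    fix \<eta> assume "\<eta> \<in> {\<eta>\<in>signs I. t < \<bar>X \<eta>\<bar>}"
    then have \<eta>: "\<eta> \<in> signs I" "t \<le> \<bar>X \<eta>\<bar>" by auto
    have "exp (l * t) \<le> exp (l * \<bar>X \<eta>\<bar>)" using \<eta>(2) l by (simp add: mult_left_mono)
    also have "\<dots> \<le> exp (l * X \<eta>) + exp (- l * X \<eta>)" by (cases "0 \<le> X \<eta>") auto
    finally have "1 \<le> exp (- (l * t)) * (exp (l * X \<eta>) + exp (- l * X \<eta>))"
      by (simp add: exp_minus field_simps)
    from mult_left_mono[OF this nn[OF \<eta>(1)]]
    show "tilt \<theta> I \<eta> \<le> tilt \<theta> I \<eta> * (exp (- (l * t)) * (exp (l * X \<eta>) + exp (- l * X \<eta>)))" by simp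
  qed
  also have "\<dots> \<le> (\<Sum>\<eta>\<in>signs I. tilt \<theta> I \<eta> * (exp (- (l * t)) * (exp (l * X \<eta>) + exp (- l * X \<eta>))))"
    by (rule sum_mono2) (auto simp: fin nn intro!: mult_nonneg_nonneg add_nonneg_nonneg)
  also have "\<dots> = exp (- (l * t)) * ((\<Sum>\<eta>\<in>signs I. tilt \<theta> I \<eta> * exp (l * X \<eta>)) + (\<Sum>\<eta>\<in>signs I. tilt \<theta> I \<eta> * exp (- l * X \<eta>)))"
    unfolding sum.distrib[symmetric] sum_distrib_left by (intro sum.cong) (auto simp: algebra_simps)
  also have "\<dots> \<le> exp (- (l * t)) * (exp (4 * l\<^sup>2 * v) + exp (4 * l\<^sup>2 * v))"
    by (intro mult_left_mono add_mono mgf) auto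
  also have "\<dots> = 2 * exp (4 * l\<^sup>2 * v - l * t)" by (simp add: exp_diff exp_minus field_simps)
  also have "4 * l\<^sup>2 * v - l * t = - (t\<^sup>2 / (16 * v))"
    using v(2) by (simp add: l_def field_simps power2_eq_square)
  finally show ?thesis by (simp add: X_def)
qed

lemma half_le_ln2: "1 / 2 \<le> ln (2 :: real)"
proof -
  have "exp (1 / 2 :: real) ^ 2 \<le> 2 ^ 2"
    using exp_le exp_of_nat_mult[of 2 "1 / 2 :: real"] by simp
  then have "exp (1 / 2 :: real) \<le> 2" by (rule power2_le_imp_le) simp
  then show ?thesis by (metis exp_le_cancel_iff exp_ln zero_less_numeral)
qed

text \<open>The constant is \<open>98 + 16\<close>, from \<open>2 (7 ln D)\<^sup>2\<close> and \<open>8 / D \<le> 4 \<le> 16 (ln D)\<^sup>2\<close>.\<close>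

lemma tilt_max_second_moment:
  fixes D :: real
  assumes fin: "finite I" and \<theta>: "\<And>i. i \<in> I \<Longrightarrow> \<bar>\<theta> i\<bar> \<le> 1"
    and S: "finite S" "S \<noteq> {}" "real (card S) \<le> D\<^sup>2" and D: "2 \<le> D"
    and v: "\<And>p. p \<in> S \<Longrightarrow> (\<Sum>i\<in>I. (c p i)\<^sup>2) \<le> s\<^sup>2" "0 < s"
  shows "(\<Sum>\<eta>\<in>signs I. tilt \<theta> I \<eta> * (Max ((\<lambda>p. \<bar>\<Sum>i\<in>I. c p i * (\<eta> i - \<theta> i)\<bar>) ` S))\<^sup>2) \<le> 114 * s\<^sup>2 * ln D"
proof -
  define X where "X = (\<lambda>\<eta> p. \<Sum>i\<in>I. c p i * (\<eta> i - \<theta> i))"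
  define Y where "Y = (\<lambda>\<eta>. Max ((\<lambda>p. \<bar>X \<eta> p\<bar>) ` S))"
  define L where "L = ln D"
  have L: "ln 2 \<le> L" "0 < L" using D by (auto simp: L_def)
  define \<mu> where "\<mu> = sqrt L / s"
  have \<mu>: "0 < \<mu>" "\<mu>\<^sup>2 * s\<^sup>2 = L" using L v(2) by (auto simp: \<mu>_def power_divide)
  have nn: "\<And>\<eta>. \<eta> \<in> signs I \<Longrightarrow> 0 \<le> tilt \<theta> I \<eta>" by (rule tilt_nonneg) (use \<theta> in auto)
  have mgf: "(\<Sum>\<eta>\<in>signs I. tilt \<theta> I \<eta> * exp (a * X \<eta> p)) \<le> exp (4 * L)" if "a = \<mu> \<or> a = - \<mu>" "p \<in> S" for a p
  proof -
    have "(\<Sum>\<eta>\<in>signs I. tilt \<theta> I \<eta> * exp (a * X \<eta> p))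
      = (\<Sum>\<eta>\<in>signs I. tilt \<theta> I \<eta> * exp (\<Sum>i\<in>I. (a * c p i) * (\<eta> i - \<theta> i)))"
      by (simp add: X_def sum_distrib_left mult.assoc)
    also have "\<dots> \<le> exp (4 * (\<Sum>i\<in>I. (a * c p i)\<^sup>2))" by (rule tilt_mgf[OF fin \<theta>])
    also have "(\<Sum>i\<in>I. (a * c p i)\<^sup>2) = \<mu>\<^sup>2 * (\<Sum>i\<in>I. (c p i)\<^sup>2)"
      using that by (auto simp: power_mult_distrib sum_distrib_left)
    also have "exp (4 * (\<mu>\<^sup>2 * (\<Sum>i\<in>I. (c p i)\<^sup>2))) \<le> exp (4 * (\<mu>\<^sup>2 * s\<^sup>2))"
      using v(1)[OF that(2)] by (simp add: mult_left_mono)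
    finally show ?thesis using \<mu> by simp
  qed
  \<comment> \<open>Each exponential moment is at most \<open>exp (4 * L)\<close> and there are at
    most \<open>exp (2 * L)\<close> points. The threshold \<open>7 * L\<close> exceeds
    \<open>6 * L\<close>, so the tail is of order \<open>exp (- L)\<close>.\<close>
  have ptw: "(\<mu> * Y \<eta>)\<^sup>2 \<le> 98 * L\<^sup>2 + 4 * exp (- 7 * L) * (\<Sum>p\<in>S. exp (\<mu> * X \<eta> p) + exp (- \<mu> * X \<eta> p))" for \<eta>
  proof -
    define u where "u = \<mu> * Y \<eta>"
    have "Y \<eta> \<in> (\<lambda>p. \<bar>X \<eta> p\<bar>) ` S" unfolding Y_def using S by (intro Max_in) auto
    then obtain p where p: "p \<in> S" "Y \<eta> = \<bar>X \<eta> p\<bar>" by auto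
    have u0: "0 \<le> u" using p \<mu> by (simp add: u_def)
    have "exp u \<le> exp (\<mu> * X \<eta> p) + exp (- \<mu> * X \<eta> p)"
      unfolding u_def p(2) by (cases "0 \<le> X \<eta> p") auto
    also have "\<dots> \<le> (\<Sum>p\<in>S. exp (\<mu> * X \<eta> p) + exp (- \<mu> * X \<eta> p))"
      by (rule member_le_sum[OF p(1)]) (use S in \<open>auto intro: add_nonneg_nonneg\<close>)
    finally have e: "exp u \<le> (\<Sum>p\<in>S. exp (\<mu> * X \<eta> p) + exp (- \<mu> * X \<eta> p))" .
    have "u\<^sup>2 \<le> 98 * L\<^sup>2 + 4 * exp (u - 7 * L)"
    proof (cases "u \<le> 7 * L")
      case True
      then have "u\<^sup>2 \<le> (7 * L)\<^sup>2" using u0 by (intro power_mono) auto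
      then have "u\<^sup>2 \<le> 49 * L\<^sup>2" by (simp add: power_mult_distrib)
      moreover have "0 \<le> L\<^sup>2" "0 \<le> exp (u - 7 * L)" by auto
      ultimately show ?thesis by linarith
    next
      case False
      define d where "d = u - 7 * L"
      have d: "0 \<le> d" "u = 7 * L + d" using False by (auto simp: d_def)
      have "1 + d + d\<^sup>2 / 2 \<le> exp d" by (rule exp_lower_Taylor_quadratic[OF d(1)])
      then have "2 * d\<^sup>2 \<le> 4 * exp d" using d by linarith
      moreover have "u\<^sup>2 \<le> 98 * L\<^sup>2 + 2 * d\<^sup>2"
      proof -
        have "0 \<le> (7 * L - d)\<^sup>2" by simp
        then show ?thesis unfolding d(2) by (simp add: power2_eq_square algebra_simps)
      qed
      ultimately show ?thesis by (simp add: d_def)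
    qed
    also have "exp (u - 7 * L) = exp (- 7 * L) * exp u" by (simp add: exp_diff exp_minus field_simps)
    also have "98 * L\<^sup>2 + 4 * (exp (- 7 * L) * exp u) \<le> 98 * L\<^sup>2 + 4 * (exp (- 7 * L) * (\<Sum>p\<in>S. exp (\<mu> * X \<eta> p) + exp (- \<mu> * X \<eta> p)))"
      using e by simp
    finally show ?thesis by (simp add: u_def mult.assoc)
  qed
  have "\<mu>\<^sup>2 * (\<Sum>\<eta>\<in>signs I. tilt \<theta> I \<eta> * (Y \<eta>)\<^sup>2) = (\<Sum>\<eta>\<in>signs I. tilt \<theta> I \<eta> * (\<mu> * Y \<eta>)\<^sup>2)"
    by (simp add: sum_distrib_left power_mult_distrib algebra_simps)
  also have "\<dots> \<le> (\<Sum>\<eta>\<in>signs I. tilt \<theta> I \<eta> * (98 * L\<^sup>2 + 4 * exp (- 7 * L) * (\<Sum>p\<in>S. exp (\<mu> * X \<eta> p) + exp (- \<mu> * X \<eta> p))))"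
    by (intro sum_mono mult_left_mono ptw nn) auto
  also have "\<dots> = 98 * L\<^sup>2 * (\<Sum>\<eta>\<in>signs I. tilt \<theta> I \<eta>) + 4 * exp (- 7 * L) * (\<Sum>\<eta>\<in>signs I. \<Sum>p\<in>S. tilt \<theta> I \<eta> * exp (\<mu> * X \<eta> p) + tilt \<theta> I \<eta> * exp (- \<mu> * X \<eta> p))"
    unfolding sum_distrib_left sum.distrib[symmetric] distrib_left
    by (intro sum.cong refl) (simp add: algebra_simps sum_distrib_left)
  also have "(\<Sum>\<eta>\<in>signs I. \<Sum>p\<in>S. tilt \<theta> I \<eta> * exp (\<mu> * X \<eta> p) + tilt \<theta> I \<eta> * exp (- \<mu> * X \<eta> p))
     = (\<Sum>p\<in>S. (\<Sum>\<eta>\<in>signs I. tilt \<theta> I \<eta> * exp (\<mu> * X \<eta> p)) + (\<Sum>\<eta>\<in>signs I. tilt \<theta> I \<eta> * exp (- \<mu> * X \<eta> p)))"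
    by (subst sum.swap) (simp add: sum.distrib)
  also have "98 * L\<^sup>2 * (\<Sum>\<eta>\<in>signs I. tilt \<theta> I \<eta>) + 4 * exp (- 7 * L) * \<dots>
     \<le> 98 * L\<^sup>2 * 1 + 4 * exp (- 7 * L) * (\<Sum>p\<in>S. exp (4 * L) + exp (4 * L))"
    unfolding sum_tilt[OF fin]
    by (intro add_left_mono mult_left_mono sum_mono add_mono mgf) auto
  also have "\<dots> = 98 * L\<^sup>2 + 8 * exp (- 3 * L) * real (card S)"
    by (simp add: mult.assoc flip: exp_add)
  also have "\<dots> \<le> 98 * L\<^sup>2 + 8 * exp (- 3 * L) * D\<^sup>2"
    using S(3) by (intro add_left_mono mult_left_mono) auto
  also have "8 * exp (- 3 * L) * D\<^sup>2 = 8 / D"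
  proof -
    have "exp (- 3 * L) = 1 / D ^ 3"
      using D exp_of_nat_mult[of 3 L] by (simp add: L_def exp_minus field_simps)
    then show ?thesis using D by (simp add: power2_eq_square power3_eq_cube)
  qed
  also have "98 * L\<^sup>2 + 8 / D \<le> 114 * L\<^sup>2"
  proof -
    have "8 / D \<le> 4" using D by (simp add: field_simps)
    moreover have "1 / 2 \<le> L" using half_le_ln2 L(1) by linarith
    then have "(1/2)\<^sup>2 \<le> L\<^sup>2" by (intro power_mono) auto
    ultimately show ?thesis by (simp add: power2_eq_square)
  qed
  finally have "\<mu>\<^sup>2 * (\<Sum>\<eta>\<in>signs I. tilt \<theta> I \<eta> * (Y \<eta>)\<^sup>2) \<le> 114 * L\<^sup>2" .
  then have "s\<^sup>2 * (\<mu>\<^sup>2 * (\<Sum>\<eta>\<in>signs I. tilt \<theta> I \<eta> * (Y \<eta>)\<^sup>2)) \<le> s\<^sup>2 * (114 * L\<^sup>2)"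
    by (rule mult_left_mono) auto
  moreover have sZ: "s\<^sup>2 * (\<mu>\<^sup>2 * Z) = L * Z" for Z
    by (simp only: \<mu>(2)[symmetric] ac_simps)
  ultimately have "L * (\<Sum>\<eta>\<in>signs I. tilt \<theta> I \<eta> * (Y \<eta>)\<^sup>2) \<le> s\<^sup>2 * (114 * L\<^sup>2)"
    by (simp only: sZ)
  then have "L * (\<Sum>\<eta>\<in>signs I. tilt \<theta> I \<eta> * (Y \<eta>)\<^sup>2) \<le> L * (114 * s\<^sup>2 * L)"
    by (simp add: power2_eq_square ac_simps)
  then have "(\<Sum>\<eta>\<in>signs I. tilt \<theta> I \<eta> * (Y \<eta>)\<^sup>2) \<le> 114 * s\<^sup>2 * L" using L(2) by simp
  then show ?thesis by (simp add: Y_def X_def L_def)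
qed

text \<open>Change of measure: by Cauchy--Schwarz, an event that is likely under the tilted
  signs is not too rare under the uniform ones.\<close>

lemma card_ge_of_tilt:
  assumes fin: "finite I" and S: "S \<subseteq> signs I" and half: "1 / 2 \<le> (\<Sum>\<eta>\<in>S. tilt \<theta> I \<eta>)"
  shows "2 ^ card I * exp (- (\<Sum>i\<in>I. (\<theta> i)\<^sup>2)) / 4 \<le> real (card S)"
proof -
  have finS: "finite S" using finite_subset[OF S] fin by simp
  have "1 / 4 \<le> (\<Sum>\<eta>\<in>S. tilt \<theta> I \<eta> * 1)\<^sup>2"
    using power_mono[OF half, of 2] by (simp add: power2_eq_square)
  also have "\<dots> \<le> (\<Sum>\<eta>\<in>S. (tilt \<theta> I \<eta>)\<^sup>2) * (\<Sum>\<eta>\<in>S. 1\<^sup>2)"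
    by (rule Cauchy_Schwarz_ineq_sum)
  also have "(\<Sum>\<eta>\<in>S. (1::real)\<^sup>2) = real (card S)" by simp
  also have "(\<Sum>\<eta>\<in>S. (tilt \<theta> I \<eta>)\<^sup>2) \<le> (\<Sum>\<eta>\<in>signs I. (tilt \<theta> I \<eta>)\<^sup>2)"
    using S fin by (intro sum_mono2) auto
  also have "\<dots> = (\<Sum>\<eta>\<in>signs I. \<Prod>i\<in>I. ((1 + \<theta> i * \<eta> i) / 2)\<^sup>2)"
    by (simp add: tilt_def prod_power_distrib)
  also have "\<dots> = (\<Prod>i\<in>I. (1 + (\<theta> i)\<^sup>2) / 2)"
    by (subst sum_signs_prod[OF fin]) (auto intro!: prod.cong simp: field_simps power2_eq_square)
  also have "\<dots> \<le> (\<Prod>i\<in>I. exp ((\<theta> i)\<^sup>2) / 2)"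
    by (intro prod_mono conjI divide_right_mono exp_ge_add_one_self) auto
  also have "\<dots> = exp (\<Sum>i\<in>I. (\<theta> i)\<^sup>2) / 2 ^ card I"
    by (simp add: exp_sum fin prod_dividef)
  finally have "1 / 4 \<le> exp (\<Sum>i\<in>I. (\<theta> i)\<^sup>2) / 2 ^ card I * real (card S)"
    by (simp add: mult_right_mono)
  then show ?thesis by (simp add: exp_minus field_simps)
qed

section \<open>Nets for balls\<close>

definition ip :: "nat \<Rightarrow> (nat \<Rightarrow> real) \<Rightarrow> (nat \<Rightarrow> real) \<Rightarrow> real" where
  "ip n x y = (\<Sum>i<n. x i * y i)"

definition sq :: "nat \<Rightarrow> (nat \<Rightarrow> real) \<Rightarrow> real" where
  "sq n x = (\<Sum>i<n. (x i)\<^sup>2)"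

lemma sq_nonneg [simp]: "0 \<le> sq n x"
  by (simp add: sq_def sum_nonneg)

lemma sum_UN_le:
  fixes f :: "'a \<Rightarrow> real"
  assumes "finite P" "\<And>p. p \<in> P \<Longrightarrow> finite (A p)" "\<And>p x. p \<in> P \<Longrightarrow> x \<in> A p \<Longrightarrow> 0 \<le> f x"
  shows "sum f (\<Union>p\<in>P. A p) \<le> (\<Sum>p\<in>P. sum f (A p))"
  using assms
proof (induction P)
  case (insert p P)
  have "sum f (A p \<union> (\<Union>p\<in>P. A p)) + sum f (A p \<inter> (\<Union>p\<in>P. A p)) = sum f (A p) + sum f (\<Union>p\<in>P. A p)"
    using insert.hyps insert.prems by (intro sum.union_inter) auto
  moreover have "0 \<le> sum f (A p \<inter> (\<Union>p\<in>P. A p))"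
    using insert.prems by (intro sum_nonneg) auto
  moreover have "sum f (\<Union>p\<in>P. A p) \<le> (\<Sum>p\<in>P. sum f (A p))"
    using insert.prems by (intro insert.IH) auto
  ultimately show ?case using insert.hyps by simp
qed simp

text \<open>A dual Sudakov inequality.  A maximal family of points whose sets of noise vectors are
  pairwise disjoint is a net; centring the noise at a point \<open>v\<close> of the ball costs at most a
  factor \<open>exp (\<bar>v\<bar>\<^sup>2 / \<sigma>\<^sup>2)\<close> in probability, so such a family is small.  The noise in a
  coordinate is a sum of \<open>N\<close> signs, so that it can be centred at \<open>v\<close> by tilting each sign by
  at most \<open>1\<close>.\<close>

lemma net_exists:
  fixes K K2 :: "(nat \<Rightarrow> real) \<Rightarrow> bool" and w :: "nat \<Rightarrow> real"
  assumes \<sigma>: "0 < \<sigma>"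
    and noise: "\<And>v N. \<lbrakk>sq n v \<le> r; 0 < N; r / \<sigma>\<^sup>2 \<le> real N\<rbrakk> \<Longrightarrow>
      1 / 2 \<le> (\<Sum>\<eta>\<in>{\<eta>\<in>signs ({..<n} \<times> {..<N}). K (\<lambda>k. (\<Sum>j<N. \<sigma> / sqrt N * \<eta> (k, j)) - v k)}.
        tilt (\<lambda>(k, j). v k / (\<sigma> * sqrt N)) ({..<n} \<times> {..<N}) \<eta>)"
    and K2: "\<And>u u'. K u \<Longrightarrow> K u' \<Longrightarrow> K2 (\<lambda>k. u k - u' k)"
    and K20: "K2 (\<lambda>_. 0)"
  shows "\<exists>A. finite A \<and> real (card A) \<le> 4 * exp (r / \<sigma>\<^sup>2) \<and>
    (\<forall>y. sq n (\<lambda>k. y k - w k) \<le> r \<longrightarrow> (\<exists>\<xi>\<in>A. K2 (\<lambda>k. y k - \<xi> k)))"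
proof -
  define N where "N = nat \<lceil>r / \<sigma>\<^sup>2\<rceil> + 1"
  have N: "0 < N" "r / \<sigma>\<^sup>2 \<le> real N" unfolding N_def by linarith+
  define I where "I = {..<n} \<times> {..<N}"
  have fin: "finite I" by (simp add: I_def)
  define \<omega> :: "(nat \<times> nat \<Rightarrow> real) \<Rightarrow> nat \<Rightarrow> real" where "\<omega> = (\<lambda>\<eta> k. \<Sum>j<N. \<sigma> / sqrt N * \<eta> (k, j))"
  define S where "S = (\<lambda>y. {\<eta>\<in>signs I. K (\<lambda>k. \<omega> \<eta> k - (y k - w k))})"
  define B where "B = {y. sq n (\<lambda>k. y k - w k) \<le> r}"
  have SK: "K2 (\<lambda>k. y k - y' k)" if "\<eta> \<in> S y" "\<eta> \<in> S y'" for \<eta> y y'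
  proof -
    have "K2 (\<lambda>k. (\<omega> \<eta> k - (y' k - w k)) - (\<omega> \<eta> k - (y k - w k)))"
      by (rule K2) (use that in \<open>auto simp: S_def\<close>)
    then show ?thesis by simp
  qed
  have big: "2 ^ card I * exp (- (r / \<sigma>\<^sup>2)) / 4 \<le> real (card (S y))" if "y \<in> B" for y
  proof -
    define v where "v = (\<lambda>k. y k - w k)"
    have v: "sq n v \<le> r" using that by (simp add: B_def v_def)
    have "2 ^ card I * exp (- (\<Sum>i\<in>I. ((\<lambda>(k, j). v k / (\<sigma> * sqrt N)) i)\<^sup>2)) / 4 \<le> real (card (S y))"
      by (rule card_ge_of_tilt[OF fin])
        (use noise[OF v N] in \<open>auto simp: S_def I_def \<omega>_def v_def\<close>)
    \<comment> \<open>Spreading a coordinate over \<open>N\<close> signs leaves the total squared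
      tilt, hence the price of the shift, independent of \<open>N\<close>.\<close>
    moreover have "(\<Sum>i\<in>I. ((\<lambda>(k, j). v k / (\<sigma> * sqrt N)) i)\<^sup>2) = sq n v / \<sigma>\<^sup>2"
    proof -
      have "(\<Sum>i\<in>I. ((\<lambda>(k, j). v k / (\<sigma> * sqrt N)) i)\<^sup>2) = (\<Sum>k<n. \<Sum>j<N. (v k / (\<sigma> * sqrt N))\<^sup>2)"
        unfolding I_def by (subst sum.cartesian_product) (auto intro: sum.cong)
      also have "\<dots> = (\<Sum>k<n. (v k)\<^sup>2 / \<sigma>\<^sup>2)"
        using N(1) by (intro sum.cong) (auto simp: power_divide power_mult_distrib)
      finally show ?thesis by (simp add: sq_def sum_divide_distrib)
    qed
    moreover have "sq n v / \<sigma>\<^sup>2 \<le> r / \<sigma>\<^sup>2" using v by (simp add: divide_right_mono)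
    ultimately show ?thesis
      by (smt (verit) divide_right_mono exp_le_cancel_iff mult_left_mono zero_le_power)
  qed
  define pk where "pk = (\<lambda>A. finite A \<and> A \<subseteq> B \<and> (\<forall>y\<in>A. \<forall>y'\<in>A. y \<noteq> y' \<longrightarrow> S y \<inter> S y' = {}))"
  have pk_card: "real (card A) \<le> 4 * exp (r / \<sigma>\<^sup>2)" if "pk A" for A
  proof -
    have "real (card A) * (2 ^ card I * exp (- (r / \<sigma>\<^sup>2)) / 4) \<le> (\<Sum>y\<in>A. real (card (S y)))"
      using that big by (intro sum_bounded_below) (auto simp: pk_def)
    also have "\<dots> = real (card (\<Union>y\<in>A. S y))"
      unfolding of_nat_sum[symmetric] using that fin
      by (subst card_UN_disjoint) (auto simp: pk_def S_def)
    also have "\<dots> \<le> real (card (signs I))"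
      using fin by (intro of_nat_mono card_mono) (auto simp: S_def)
    also have "\<dots> = 2 ^ card I" by (simp add: card_signs fin)
    finally have "real (card A) * exp (- (r / \<sigma>\<^sup>2)) / 4 \<le> 1"
      by (simp add: field_simps)
    then show ?thesis by (simp add: exp_minus field_simps)
  qed
  have "pk {}" by (simp add: pk_def)
  have "\<forall>A. pk A \<longrightarrow> card A \<le> nat \<lfloor>4 * exp (r / \<sigma>\<^sup>2)\<rfloor>"
    using pk_card by (simp add: le_nat_floor)
  then obtain A where A: "pk A" "\<And>A'. pk A' \<Longrightarrow> card A' \<le> card A"
    using ex_has_greatest_nat[of pk "{}" card "Suc (nat \<lfloor>4 * exp (r / \<sigma>\<^sup>2)\<rfloor>)"] \<open>pk {}\<close>
    by (metis less_Suc_eq_le le_imp_less_Suc)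
  have "\<exists>\<xi>\<in>A. K2 (\<lambda>k. y k - \<xi> k)" if y: "y \<in> B" for y
  proof (cases "y \<in> A")
    case True
    then show ?thesis using K20 by (intro bexI[of _ y]) auto
  next
    case False
    have "\<not> pk (insert y A)"
    proof
      assume "pk (insert y A)"
      from A(2)[OF this] show False using False A(1) by (simp add: pk_def)
    qed
    then obtain a \<eta> where "a \<in> A" "\<eta> \<in> S y" "\<eta> \<in> S a"
      using A(1) y unfolding pk_def by blast
    then show ?thesis using SK by blast
  qed
  then show ?thesis using A(1) pk_card[OF A(1)] by (auto simp: pk_def B_def)
qed

section \<open>Maxima of linear functionals, and a norm in which noise is small\<close>

locale max_functionals =
  fixes n :: nat and P :: "'p set" and g :: "'p \<Rightarrow> nat \<Rightarrow> real"
    and E :: "'e set" and S :: "'e \<Rightarrow> 'p set" and c :: "'e \<Rightarrow> 'p \<Rightarrow> real" and \<tau> D :: real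
  assumes n2: "2 \<le> n" and finP: "finite P" and cardP: "card P \<le> n\<^sup>2"
    and g: "\<And>p. p \<in> P \<Longrightarrow> sq n (g p) \<le> 1"
    and finE: "finite E"
    and S: "\<And>e. e \<in> E \<Longrightarrow> S e \<subseteq> P" "\<And>e. e \<in> E \<Longrightarrow> S e \<noteq> {}"
    and cardS: "\<And>e. e \<in> E \<Longrightarrow> real (card (S e)) \<le> D\<^sup>2" and D: "2 \<le> D"
    and c: "\<And>e p. 0 \<le> c e p" "\<And>e p. e \<in> E \<Longrightarrow> p \<in> S e \<Longrightarrow> (c e p)\<^sup>2 \<le> \<tau>" and \<tau>: "0 < \<tau>"
begin

text \<open>In the application \<open>p\<close> is a pair of vertices, \<open>g p\<close> is the
  normalised \<open>b\<^sub>u - b\<^sub>v\<close> and \<open>c e p\<close> is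
  \<open>sqrt (w e)\<close> times the length of \<open>b\<^sub>u - b\<^sub>v\<close>. Thus
  \<open>(N e y)^2\<close> is the energy of \<open>e\<close>, weight included, at the potential with
  coordinates \<open>y\<close>.\<close>

definition N :: "'e \<Rightarrow> (nat \<Rightarrow> real) \<Rightarrow> real" where
  "N e y = Max ((\<lambda>p. c e p * \<bar>ip n (g p) y\<bar>) ` S e)"

text \<open>As \<open>80 = 16 * 5\<close>, the tail bound for one functional becomes
  \<open>2 / n^5\<close>, which survives a union over \<open>n^2\<close> functionals. As
  \<open>456 = 4 * 114\<close>, Markov's inequality applied to \<open>tilt_max_second_moment\<close>
  fails with probability at most \<open>1 / 4\<close>.\<close>

definition \<kappa>1 :: real where "\<kappa>1 = sqrt (80 * \<tau> * ln n)"
definition \<kappa>2 :: real where "\<kappa>2 = sqrt (456 * \<tau> * ln D)"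

text \<open>Both conditions scale with \<open>s\<close>, so this is a ball of radius
  \<open>s\<close> of a seminorm. The first keeps the set of heavy hyperedges stable and carries
  \<open>ln n\<close>; the second controls the variance of increments and carries only
  \<open>ln D\<close>.\<close>

definition close :: "('e \<Rightarrow> real) \<Rightarrow> 'e set \<Rightarrow> real \<Rightarrow> (nat \<Rightarrow> real) \<Rightarrow> bool" where
  "close a H s v \<longleftrightarrow> (\<forall>e\<in>E. N e v \<le> \<kappa>1 * s) \<and> (\<Sum>e\<in>H. (a e)\<^sup>2 * (N e v)\<^sup>2) \<le> (\<kappa>2 * s)\<^sup>2"

lemma finS: "e \<in> E \<Longrightarrow> finite (S e)"
  using S finP finite_subset by blast

lemma c_le: "e \<in> E \<Longrightarrow> p \<in> S e \<Longrightarrow> c e p \<le> sqrt \<tau>"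
  using c(2) by (simp add: real_le_rsqrt)

lemma \<kappa>_sq: "\<kappa>1\<^sup>2 = 80 * \<tau> * ln n" "\<kappa>2\<^sup>2 = 456 * \<tau> * ln D"
  using \<tau> n2 D by (auto simp: \<kappa>1_def \<kappa>2_def)

lemma \<kappa>_pos: "0 < \<kappa>1" "0 < \<kappa>2"
  using \<tau> n2 D by (auto simp: \<kappa>1_def \<kappa>2_def)

lemma N_ge: "e \<in> E \<Longrightarrow> p \<in> S e \<Longrightarrow> c e p * \<bar>ip n (g p) y\<bar> \<le> N e y"
  unfolding N_def using finS by (intro Max_ge) auto

lemma N_le: "e \<in> E \<Longrightarrow> (\<And>p. p \<in> S e \<Longrightarrow> c e p * \<bar>ip n (g p) y\<bar> \<le> b) \<Longrightarrow> N e y \<le> b"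
  unfolding N_def using finS S(2) by (subst Max_le_iff) auto

lemma N_nonneg: "e \<in> E \<Longrightarrow> 0 \<le> N e y"
  using S(2)[of e] N_ge[of e _ y] c(1) by (metis abs_ge_zero ex_in_conv mult_nonneg_nonneg order_trans)

lemma ip_combo: "ip n x (\<lambda>k. a * u k + b * v k) = a * ip n x u + b * ip n x v"
  by (simp add: ip_def sum_distrib_left sum.distrib algebra_simps)

lemma N_combo:
  assumes e: "e \<in> E"
  shows "N e (\<lambda>k. a * u k + b * v k) \<le> \<bar>a\<bar> * N e u + \<bar>b\<bar> * N e v"
proof (rule N_le[OF e])
  fix p assume p: "p \<in> S e"
  have "c e p * \<bar>ip n (g p) (\<lambda>k. a * u k + b * v k)\<bar> \<le> c e p * (\<bar>a\<bar> * \<bar>ip n (g p) u\<bar> + \<bar>b\<bar> * \<bar>ip n (g p) v\<bar>)"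
    unfolding ip_combo using c(1) by (intro mult_left_mono) (auto simp: abs_mult[symmetric])
  also have "\<dots> = \<bar>a\<bar> * (c e p * \<bar>ip n (g p) u\<bar>) + \<bar>b\<bar> * (c e p * \<bar>ip n (g p) v\<bar>)"
    by (simp add: algebra_simps)
  also have "\<dots> \<le> \<bar>a\<bar> * N e u + \<bar>b\<bar> * N e v"
    by (intro add_mono mult_left_mono N_ge e p) auto
  finally show "c e p * \<bar>ip n (g p) (\<lambda>k. a * u k + b * v k)\<bar> \<le> \<bar>a\<bar> * N e u + \<bar>b\<bar> * N e v" .
qed

lemma N_triangle: "e \<in> E \<Longrightarrow> N e u \<le> N e v + N e (\<lambda>k. u k - v k)"
  using N_combo[of e 1 v 1 "\<lambda>k. u k - v k"] by simp

lemma N_zero: "e \<in> E \<Longrightarrow> N e (\<lambda>_. 0) = 0"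
  using N_combo[of e 0 "\<lambda>_. 0" 0 "\<lambda>_. 0"] N_nonneg[of e "\<lambda>_. 0"] by simp

lemma N_minus_commute: "e \<in> E \<Longrightarrow> N e (\<lambda>k. u k - v k) = N e (\<lambda>k. v k - u k)"
  using N_combo[of e "-1" "\<lambda>k. v k - u k" 0 "\<lambda>_. 0"] N_combo[of e "-1" "\<lambda>k. u k - v k" 0 "\<lambda>_. 0"]
  by simp

lemma N_le_norm:
  assumes e: "e \<in> E"
  shows "(N e y)\<^sup>2 \<le> \<tau> * sq n y"
proof -
  have "N e y \<in> (\<lambda>p. c e p * \<bar>ip n (g p) y\<bar>) ` S e"
    unfolding N_def using e S finS by (intro Max_in) auto
  then obtain p where p: "p \<in> S e" "N e y = c e p * \<bar>ip n (g p) y\<bar>" by auto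
  have "(ip n (g p) y)\<^sup>2 \<le> sq n (g p) * sq n y"
    unfolding ip_def sq_def by (rule Cauchy_Schwarz_ineq_sum)
  also have "\<dots> \<le> 1 * sq n y"
    using g p S(1)[OF e] by (intro mult_right_mono) auto
  finally have "(c e p)\<^sup>2 * (ip n (g p) y)\<^sup>2 \<le> \<tau> * sq n y"
    using c(2)[OF e p(1)] \<tau> by (intro mult_mono) auto
  then show ?thesis by (simp add: p(2) power_mult_distrib)
qed

lemma close_zero: "H \<subseteq> E \<Longrightarrow> 0 \<le> s \<Longrightarrow> close a H s (\<lambda>_. 0)"
  using \<kappa>_pos by (auto simp: close_def N_zero subset_iff)

lemma close_L2:
  assumes "0 \<le> s"
  shows "close a H s v \<longleftrightarrow> (\<forall>e\<in>E. N e v \<le> \<kappa>1 * s) \<and> L2_set (\<lambda>e. a e * N e v) H \<le> \<kappa>2 * s"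
proof -
  have "0 \<le> \<kappa>2 * s" using assms \<kappa>_pos by simp
  then have "sqrt X \<le> \<kappa>2 * s \<longleftrightarrow> X \<le> (\<kappa>2 * s)\<^sup>2" for X
    by (metis abs_of_nonneg real_sqrt_abs real_sqrt_le_iff)
  then show ?thesis by (simp add: close_def L2_set_def power_mult_distrib)
qed

lemma close_combo:
  assumes "H \<subseteq> E" "close a H s u" "close a H s' v" "0 \<le> s" "0 \<le> s'" "\<bar>\<alpha>\<bar> * s + \<bar>\<beta>\<bar> * s' \<le> s''"
  shows "close a H s'' (\<lambda>k. \<alpha> * u k + \<beta> * v k)"
proof -
  have s'': "0 \<le> s''" using assms by (smt (verit) mult_nonneg_nonneg)
  have "N e (\<lambda>k. \<alpha> * u k + \<beta> * v k) \<le> \<kappa>1 * s''" if e: "e \<in> E" for e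
  proof -
    have "N e (\<lambda>k. \<alpha> * u k + \<beta> * v k) \<le> \<bar>\<alpha>\<bar> * N e u + \<bar>\<beta>\<bar> * N e v" by (rule N_combo[OF e])
    also have "\<dots> \<le> \<bar>\<alpha>\<bar> * (\<kappa>1 * s) + \<bar>\<beta>\<bar> * (\<kappa>1 * s')"
      using assms(2,3) e by (intro add_mono mult_left_mono) (auto simp: close_def)
    also have "\<dots> = \<kappa>1 * (\<bar>\<alpha>\<bar> * s + \<bar>\<beta>\<bar> * s')" by (simp add: algebra_simps)
    also have "\<dots> \<le> \<kappa>1 * s''" using assms(6) \<kappa>_pos by simp
    finally show ?thesis .
  qed
  moreover have "L2_set (\<lambda>e. a e * N e (\<lambda>k. \<alpha> * u k + \<beta> * v k)) H \<le> \<kappa>2 * s''"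
  proof -
    have "L2_set (\<lambda>e. a e * N e (\<lambda>k. \<alpha> * u k + \<beta> * v k)) H
      = L2_set (\<lambda>e. \<bar>a e\<bar> * N e (\<lambda>k. \<alpha> * u k + \<beta> * v k)) H"
      by (simp add: L2_set_def power_mult_distrib)
    also have "\<dots> \<le> L2_set (\<lambda>e. \<bar>\<alpha>\<bar> * (\<bar>a e\<bar> * N e u) + \<bar>\<beta>\<bar> * (\<bar>a e\<bar> * N e v)) H"
    proof (rule L2_set_mono)
      fix e assume "e \<in> H"
      then have e: "e \<in> E" using assms(1) by auto
      show "0 \<le> \<bar>a e\<bar> * N e (\<lambda>k. \<alpha> * u k + \<beta> * v k)" using N_nonneg[OF e] by simp
      show "\<bar>a e\<bar> * N e (\<lambda>k. \<alpha> * u k + \<beta> * v k) \<le> \<bar>\<alpha>\<bar> * (\<bar>a e\<bar> * N e u) + \<bar>\<beta>\<bar> * (\<bar>a e\<bar> * N e v)"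
        using mult_left_mono[OF N_combo[OF e, of \<alpha> u \<beta> v], of "\<bar>a e\<bar>"] by (simp add: algebra_simps)
    qed
    also have "\<dots> \<le> L2_set (\<lambda>e. \<bar>\<alpha>\<bar> * (\<bar>a e\<bar> * N e u)) H + L2_set (\<lambda>e. \<bar>\<beta>\<bar> * (\<bar>a e\<bar> * N e v)) H"
      by (rule L2_set_triangle_ineq)
    also have "\<dots> = \<bar>\<alpha>\<bar> * L2_set (\<lambda>e. a e * N e u) H + \<bar>\<beta>\<bar> * L2_set (\<lambda>e. a e * N e v) H"
      by (simp add: L2_set_right_distrib[symmetric]) (simp add: L2_set_def power_mult_distrib)
    also have "\<bar>\<alpha>\<bar> * L2_set (\<lambda>e. a e * N e u) H + \<bar>\<beta>\<bar> * L2_set (\<lambda>e. a e * N e v) H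
        \<le> \<bar>\<alpha>\<bar> * (\<kappa>2 * s) + \<bar>\<beta>\<bar> * (\<kappa>2 * s')"
      using assms(2-5) by (intro add_mono mult_left_mono) (auto simp: close_L2)
    also have "\<dots> = \<kappa>2 * (\<bar>\<alpha>\<bar> * s + \<bar>\<beta>\<bar> * s')" by (simp add: algebra_simps)
    also have "\<dots> \<le> \<kappa>2 * s''" using assms(6) \<kappa>_pos by simp
    finally show ?thesis .
  qed
  ultimately show ?thesis by (simp add: close_L2[OF s''])
qed

lemma close_diff:
  assumes "H \<subseteq> E" "close a H s u" "close a H s' v" "0 \<le> s" "0 \<le> s'"
  shows "close a H (s + s') (\<lambda>k. u k - v k)"
  using close_combo[OF assms, of 1 "-1" "s + s'"] by simp

text \<open>Each condition of \<open>close\<close> fails with probability at most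
  \<open>1 / 4\<close>: the first by a union bound over \<open>P\<close>, the second by Markov's
  inequality. The latter needs only the mean of a weighted sum of squared maxima, so each maximum is
  over a single \<open>S e\<close>.\<close>

lemma noise_close:
  assumes \<sigma>: "0 < \<sigma>" and H: "H \<subseteq> E" and a: "(\<Sum>e\<in>H. (a e)\<^sup>2) \<le> 1"
    and v: "sq n v \<le> r" "0 < M" "r / \<sigma>\<^sup>2 \<le> real M"
  shows "1 / 2 \<le> (\<Sum>\<eta>\<in>{\<eta>\<in>signs ({..<n} \<times> {..<M}). close a H \<sigma> (\<lambda>k. (\<Sum>j<M. \<sigma> / sqrt M * \<eta> (k, j)) - v k)}.
        tilt (\<lambda>(k, j). v k / (\<sigma> * sqrt M)) ({..<n} \<times> {..<M}) \<eta>)"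
proof -
  define I where "I = {..<n} \<times> {..<M}"
  define \<theta> :: "nat \<times> nat \<Rightarrow> real" where "\<theta> = (\<lambda>(k, j). v k / (\<sigma> * sqrt M))"
  define C where "C = (\<lambda>p (k, j :: nat). \<sigma> / sqrt M * g p k)"
  define u where "u = (\<lambda>\<eta> k. (\<Sum>j<M. \<sigma> / sqrt M * \<eta> (k, j)) - v k)"
  define X where "X = (\<lambda>p \<eta>. \<Sum>i\<in>I. C p i * (\<eta> i - \<theta> i))"
  define T where "T = signs I"
  define W where "W = (\<lambda>A. sum (tilt \<theta> I) A)"
  have fin: "finite I" "finite T" by (auto simp: I_def T_def)
  have M: "0 < sqrt M" using v by simp
  have \<theta>: "\<bar>\<theta> i\<bar> \<le> 1" if iI: "i \<in> I" for i
  proof -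
    obtain k j where i: "i = (k, j)" "k < n" using iI unfolding I_def by blast
    have "(v k)\<^sup>2 \<le> sq n v" unfolding sq_def using i by (intro member_le_sum) auto
    also have "\<dots> \<le> \<sigma>\<^sup>2 * real M" using v \<sigma> by (simp add: field_simps)
    finally have "(v k)\<^sup>2 \<le> (\<sigma> * sqrt M)\<^sup>2" by (simp add: power_mult_distrib)
    then have "\<bar>v k\<bar> \<le> \<sigma> * sqrt M" using \<sigma> M by (metis abs_le_square_iff abs_of_pos mult_pos_pos)
    then show ?thesis using \<sigma> M by (simp add: \<theta>_def i abs_mult)
  qed
  have nn: "0 \<le> tilt \<theta> I \<eta>" if "\<eta> \<in> T" for \<eta>
    using tilt_nonneg[of I \<theta>] \<theta> that by (auto simp: T_def)
  \<comment> \<open>The tilt gives the noise the mean \<open>v\<close>, so the functionals of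
    \<open>u \<eta>\<close> are sums of centred terms.\<close>
  have X: "ip n (g p) (u \<eta>) = X p \<eta>" for p \<eta>
  proof -
    have "X p \<eta> = (\<Sum>k<n. \<Sum>j<M. \<sigma> / sqrt M * g p k * (\<eta> (k, j) - v k / (\<sigma> * sqrt M)))"
      unfolding X_def I_def C_def \<theta>_def by (subst sum.cartesian_product) (auto intro: sum.cong)
    also have "\<dots> = (\<Sum>k<n. g p k * u \<eta> k)"
    proof (intro sum.cong refl)
      fix k
      have "(\<Sum>j<M. \<sigma> / sqrt M * g p k * (\<eta> (k, j) - v k / (\<sigma> * sqrt M)))
        = (\<Sum>j<M. g p k * (\<sigma> / sqrt M * \<eta> (k, j)) - g p k * v k / M)"
        using \<sigma> v(2) by (intro sum.cong) (auto simp: field_simps)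
      also have "\<dots> = g p k * u \<eta> k"
        using v(2) by (simp add: sum_subtractf u_def sum_distrib_left algebra_simps)
      finally show "(\<Sum>j<M. \<sigma> / sqrt M * g p k * (\<eta> (k, j) - v k / (\<sigma> * sqrt M))) = g p k * u \<eta> k" .
    qed
    finally show ?thesis by (simp add: ip_def)
  qed
  have C: "(\<Sum>i\<in>I. (C p i)\<^sup>2) \<le> \<sigma>\<^sup>2" if "p \<in> P" for p
  proof -
    have "(\<Sum>i\<in>I. (C p i)\<^sup>2) = (\<Sum>k<n. \<Sum>j<M. (\<sigma> / sqrt M * g p k)\<^sup>2)"
      unfolding I_def C_def by (subst sum.cartesian_product) (auto intro: sum.cong)
    also have "\<dots> = \<sigma>\<^sup>2 * sq n (g p)"
      using v(2) by (simp add: sq_def power_mult_distrib power_divide sum_distrib_left)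
    also have "\<dots> \<le> \<sigma>\<^sup>2 * 1" using g[OF that] by (intro mult_left_mono) auto
    finally show ?thesis by simp
  qed
  define t where "t = \<sigma> * sqrt (80 * ln n)"
  have ln0: "0 < ln (real n)" using n2 by simp
  define B1 where "B1 = (\<Union>p\<in>P. {\<eta>\<in>T. t < \<bar>X p \<eta>\<bar>})"
  define B2 where "B2 = {\<eta>\<in>T. (\<kappa>2 * \<sigma>)\<^sup>2 < (\<Sum>e\<in>H. (a e)\<^sup>2 * (N e (u \<eta>))\<^sup>2)}"
  have "W B1 \<le> (\<Sum>p\<in>P. W {\<eta>\<in>T. t < \<bar>X p \<eta>\<bar>})"
    unfolding W_def B1_def using fin nn finP by (intro sum_UN_le) auto
  also have "\<dots> \<le> (\<Sum>p\<in>P. 2 * exp (- (t\<^sup>2 / (16 * \<sigma>\<^sup>2))))"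
    unfolding W_def T_def X_def using \<sigma> ln0
    by (intro sum_mono tilt_tail fin(1) \<theta> C) (auto simp: t_def)
  also have "t\<^sup>2 / (16 * \<sigma>\<^sup>2) = 5 * ln n" using \<sigma> ln0 by (simp add: t_def power_mult_distrib)
  also have "(\<Sum>p\<in>P. 2 * exp (- (5 * ln (real n)))) = real (card P) * (2 / real n ^ 5)"
    using n2 exp_of_nat_mult[of 5 "ln (real n)"] by (simp add: exp_minus divide_inverse)
  also have "\<dots> \<le> real (n\<^sup>2) * (2 / real n ^ 5)"
    using cardP by (intro mult_right_mono of_nat_mono) auto
  also have "\<dots> = 2 / real n ^ 3"
    using n2 by (simp add: power2_eq_square eval_nat_numeral)
  also have "\<dots> \<le> 1 / 4"
    using n2 power_mono[of 2 "real n" 3] by (simp add: field_simps)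
  finally have W1: "W B1 \<le> 1 / 4" .
  have Nsq: "(N e (u \<eta>))\<^sup>2 \<le> \<tau> * (Max ((\<lambda>p. \<bar>X p \<eta>\<bar>) ` S e))\<^sup>2" if e: "e \<in> E" for e \<eta>
  proof -
    have "N e (u \<eta>) \<le> sqrt \<tau> * Max ((\<lambda>p. \<bar>X p \<eta>\<bar>) ` S e)"
    proof (rule N_le[OF e])
      fix p assume p: "p \<in> S e"
      have "\<bar>X p \<eta>\<bar> \<le> Max ((\<lambda>p. \<bar>X p \<eta>\<bar>) ` S e)" using finS[OF e] p by (intro Max_ge) auto
      then show "c e p * \<bar>ip n (g p) (u \<eta>)\<bar> \<le> sqrt \<tau> * Max ((\<lambda>p. \<bar>X p \<eta>\<bar>) ` S e)"
        unfolding X using c_le[OF e p] c(1) \<tau> by (intro mult_mono) auto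
    qed
    from power_mono[OF this N_nonneg[OF e], of 2] show ?thesis
      using \<tau> by (simp add: power_mult_distrib)
  qed
  have "(\<kappa>2 * \<sigma>)\<^sup>2 * W B2 \<le> (\<Sum>\<eta>\<in>B2. tilt \<theta> I \<eta> * (\<Sum>e\<in>H. (a e)\<^sup>2 * (N e (u \<eta>))\<^sup>2))"
    unfolding W_def mult.commute[of "(\<kappa>2 * \<sigma>)\<^sup>2"] sum_distrib_right
    using nn by (intro sum_mono mult_left_mono) (auto simp: B2_def)
  also have "\<dots> \<le> (\<Sum>\<eta>\<in>T. tilt \<theta> I \<eta> * (\<Sum>e\<in>H. (a e)\<^sup>2 * (N e (u \<eta>))\<^sup>2))"
    using fin nn by (intro sum_mono2) (auto simp: B2_def intro!: mult_nonneg_nonneg sum_nonneg)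
  also have "\<dots> = (\<Sum>e\<in>H. (a e)\<^sup>2 * (\<Sum>\<eta>\<in>T. tilt \<theta> I \<eta> * (N e (u \<eta>))\<^sup>2))"
    unfolding sum_distrib_left by (subst sum.swap) (simp add: algebra_simps)
  also have "\<dots> \<le> (\<Sum>e\<in>H. (a e)\<^sup>2 * (\<tau> * (114 * \<sigma>\<^sup>2 * ln D)))"
  proof (intro sum_mono mult_left_mono)
    fix e assume "e \<in> H"
    then have e: "e \<in> E" using H by auto
    have "(\<Sum>\<eta>\<in>T. tilt \<theta> I \<eta> * (N e (u \<eta>))\<^sup>2) \<le> (\<Sum>\<eta>\<in>T. tilt \<theta> I \<eta> * (\<tau> * (Max ((\<lambda>p. \<bar>X p \<eta>\<bar>) ` S e))\<^sup>2))"
      by (intro sum_mono mult_left_mono Nsq e nn)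
    also have "\<dots> = \<tau> * (\<Sum>\<eta>\<in>T. tilt \<theta> I \<eta> * (Max ((\<lambda>p. \<bar>X p \<eta>\<bar>) ` S e))\<^sup>2)"
      by (simp add: sum_distrib_left algebra_simps)
    also have "\<dots> \<le> \<tau> * (114 * \<sigma>\<^sup>2 * ln D)"
      unfolding T_def X_def using \<tau> \<sigma> D S[OF e] finS[OF e] cardS[OF e] C
      by (intro mult_left_mono tilt_max_second_moment fin \<theta>) auto
    finally show "(\<Sum>\<eta>\<in>T. tilt \<theta> I \<eta> * (N e (u \<eta>))\<^sup>2) \<le> \<tau> * (114 * \<sigma>\<^sup>2 * ln D)" .
  qed auto
  also have "\<dots> = (\<Sum>e\<in>H. (a e)\<^sup>2) * (\<tau> * (114 * \<sigma>\<^sup>2 * ln D))" by (simp add: sum_distrib_right)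
  also have "\<dots> \<le> 1 * (\<tau> * (114 * \<sigma>\<^sup>2 * ln D))"
    using a \<tau> D by (intro mult_right_mono) auto
  also have "\<dots> = (\<kappa>2 * \<sigma>)\<^sup>2 * (1 / 4)" by (simp add: power_mult_distrib \<kappa>_sq)
  finally have W2: "W B2 \<le> 1 / 4" using \<kappa>_pos(2) \<sigma> by simp
  define G where "G = {\<eta>\<in>T. close a H \<sigma> (u \<eta>)}"
  have "T - G \<subseteq> B1 \<union> B2"
  proof
    fix \<eta> assume \<eta>: "\<eta> \<in> T - G"
    show "\<eta> \<in> B1 \<union> B2"
    proof (rule ccontr)
      assume "\<eta> \<notin> B1 \<union> B2"
      then have b: "\<And>p. p \<in> P \<Longrightarrow> \<bar>X p \<eta>\<bar> \<le> t" "\<not> (\<kappa>2 * \<sigma>)\<^sup>2 < (\<Sum>e\<in>H. (a e)\<^sup>2 * (N e (u \<eta>))\<^sup>2)"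
        using \<eta> by (auto simp: B1_def B2_def)
      have "N e (u \<eta>) \<le> \<kappa>1 * \<sigma>" if e: "e \<in> E" for e
      proof (rule N_le[OF e])
        fix p assume p: "p \<in> S e"
        have "c e p * \<bar>ip n (g p) (u \<eta>)\<bar> \<le> sqrt \<tau> * t"
          unfolding X using c_le[OF e p] c(1) \<tau> b(1) S(1)[OF e] p by (intro mult_mono) auto
        also have "\<dots> = \<kappa>1 * \<sigma>" by (simp add: t_def \<kappa>1_def real_sqrt_mult)
        finally show "c e p * \<bar>ip n (g p) (u \<eta>)\<bar> \<le> \<kappa>1 * \<sigma>" .
      qed
      then have "close a H \<sigma> (u \<eta>)" using b(2) by (auto simp: close_def)
      then show False using \<eta> by (auto simp: G_def)
    qed
  qed
  then have "W (T - G) \<le> W (B1 \<union> B2)"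
    unfolding W_def using fin nn by (intro sum_mono2) (auto simp: B1_def B2_def finP)
  also have "\<dots> \<le> W B1 + W B2"
  proof -
    have "W (B1 \<union> B2) + W (B1 \<inter> B2) = W B1 + W B2"
      unfolding W_def using fin finP by (intro sum.union_inter) (auto simp: B1_def B2_def)
    moreover have "0 \<le> W (B1 \<inter> B2)"
      unfolding W_def using nn by (intro sum_nonneg) (auto simp: B2_def)
    ultimately show ?thesis by linarith
  qed
  finally have "W (T - G) \<le> 1 / 2" using W1 W2 by linarith
  moreover have "W (T - G) = W T - W G"
    unfolding W_def using fin by (intro sum_diff) (auto simp: G_def)
  moreover have "W T = 1" unfolding W_def T_def by (rule sum_tilt[OF fin(1)])
  ultimately have "1 / 2 \<le> W G" by linarith
  then show ?thesis by (simp add: W_def G_def T_def I_def \<theta>_def u_def)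
qed

lemma close_net:
  assumes "0 < \<sigma>" "H \<subseteq> E" "(\<Sum>e\<in>H. (a e)\<^sup>2) \<le> 1"
  shows "\<exists>A. finite A \<and> real (card A) \<le> 4 * exp (r / \<sigma>\<^sup>2) \<and>
    (\<forall>y. sq n (\<lambda>k. y k - w k) \<le> r \<longrightarrow> (\<exists>\<xi>\<in>A. close a H (2 * \<sigma>) (\<lambda>k. y k - \<xi> k)))"
proof (rule net_exists[where K = "close a H \<sigma>"])
  show "close a H (2 * \<sigma>) (\<lambda>k. u k - u' k)" if "close a H \<sigma> u" "close a H \<sigma> u'" for u u'
    using close_diff[OF assms(2) that] assms(1) by simp
qed (use assms noise_close close_zero in auto)

end

section \<open>A Euclidean norm adapted to the energy\<close>

text \<open>The matrix determinant lemma. The bordered matrix with blocks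
  \<open>1, - Y, Z, 1\<close> factors in two ways, with \<open>C\<close> as the Schur complement of
  one diagonal block and \<open>M\<close> as that of the other.\<close>

lemma det_id_add_rank_one:
  fixes y z :: "nat \<Rightarrow> real"
  shows "det (mat n n (\<lambda>(i, j). (if i = j then 1 else 0) + y i * z j)) = 1 + (\<Sum>i<n. y i * z i)"
proof -
  define Y where "Y = mat n 1 (\<lambda>(i, _). y i)"
  define Z where "Z = mat 1 n (\<lambda>(_, j). z j)"
  define c where "c = 1 + (\<Sum>i<n. y i * z i)"
  define C where "C = mat 1 1 (\<lambda>_. c)"
  define M where "M = mat n n (\<lambda>(i, j). (if i = j then 1 else 0) + y i * z j)"
  have car: "Y \<in> carrier_mat n 1" "Z \<in> carrier_mat 1 n" "C \<in> carrier_mat 1 1" "M \<in> carrier_mat n n"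
    by (auto simp: Y_def Z_def C_def M_def)
  have ZY: "Z * (- Y) + C = 1\<^sub>m 1"
    by (rule eq_matI) (auto simp: Z_def Y_def C_def c_def scalar_prod_def sum_negf lessThan_atLeast0 algebra_simps)
  have YZ: "M + (- Y) * Z = 1\<^sub>m n"
    by (rule eq_matI) (auto simp: Z_def Y_def M_def scalar_prod_def)
  have P1: "four_block_mat (1\<^sub>m n) (0\<^sub>m n 1) Z (1\<^sub>m 1) * four_block_mat (1\<^sub>m n) (- Y) (0\<^sub>m 1 n) C
      = four_block_mat (1\<^sub>m n) (- Y) Z (1\<^sub>m 1)"
    using car ZY by (subst mult_four_block_mat) auto
  have P2: "four_block_mat M (- Y) (0\<^sub>m 1 n) (1\<^sub>m 1) * four_block_mat (1\<^sub>m n) (0\<^sub>m n 1) Z (1\<^sub>m 1)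
      = four_block_mat (1\<^sub>m n) (- Y) Z (1\<^sub>m 1)"
    using car YZ by (subst mult_four_block_mat) auto
  have d1: "det (four_block_mat (1\<^sub>m n) (0\<^sub>m n 1) Z (1\<^sub>m 1)) = 1"
    using car by (subst det_four_block_mat_upper_right_zero) auto
  have d2: "det (four_block_mat (1\<^sub>m n) (- Y) (0\<^sub>m 1 n) C) = c"
    using car det_single[OF car(3)] by (subst det_four_block_mat_lower_left_zero) (auto simp: C_def)
  have d3: "det (four_block_mat M (- Y) (0\<^sub>m 1 n) (1\<^sub>m 1)) = det M"
    using car by (subst det_four_block_mat_lower_left_zero) auto
  have "det M = c"
  proof -
    have blk: "four_block_mat (1\<^sub>m n) (0\<^sub>m n 1) Z (1\<^sub>m 1) \<in> carrier_mat (n + 1) (n + 1)"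
      "four_block_mat (1\<^sub>m n) (- Y) (0\<^sub>m 1 n) C \<in> carrier_mat (n + 1) (n + 1)"
      "four_block_mat M (- Y) (0\<^sub>m 1 n) (1\<^sub>m 1) \<in> carrier_mat (n + 1) (n + 1)"
      using car by (intro four_block_carrier_mat; simp)+
    show ?thesis
      using arg_cong[OF trans[OF P1 P2[symmetric]], of det]
      unfolding det_mult[OF blk(1) blk(2)] det_mult[OF blk(3) blk(1)] d1 d2 d3 by simp
  qed
  then show ?thesis by (simp add: M_def c_def)
qed

lemma continuous_on_Max_image:
  fixes f :: "'p \<Rightarrow> 'a::topological_space \<Rightarrow> real"
  assumes "finite S" "S \<noteq> {}" "\<And>p. p \<in> S \<Longrightarrow> continuous_on T (f p)"
  shows "continuous_on T (\<lambda>x. Max ((\<lambda>p. f p x) ` S))"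
  using assms by (induction S rule: finite_ne_induct) (auto intro!: continuous_on_max)

lemma compact_box:
  fixes A :: "'i \<Rightarrow> real set"
  assumes "\<And>i. compact (A i)"
  shows "compact {x. \<forall>i. x i \<in> A i}"
proof -
  have "{x. \<forall>i. x i \<in> A i} = PiE UNIV A" by (auto simp: PiE_def Pi_def)
  moreover have "compactin (product_topology (\<lambda>_. euclidean) UNIV) (PiE UNIV A)"
    unfolding compactin_PiE using assms by simp
  ultimately show ?thesis by (simp add: euclidean_product_topology)
qed

lemma Max_image_mult:
  fixes f :: "'p \<Rightarrow> real"
  assumes "finite S" "S \<noteq> {}" "0 \<le> c"
  shows "Max ((\<lambda>p. c * f p) ` S) = c * Max (f ` S)"
proof -
  have "mono (\<lambda>x. c * x)" using assms(3) by (auto intro!: monoI mult_left_mono)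
  then have "c * Max (f ` S) = Max ((\<lambda>x. c * x) ` f ` S)" using assms by (intro mono_Max_commute) auto
  then show ?thesis by (simp add: image_image)
qed

locale weighted_functionals =
  fixes n :: nat and E :: "'e set" and S :: "'e \<Rightarrow> 'p set" and w :: "'e \<Rightarrow> real"
    and a :: "'p \<Rightarrow> nat \<Rightarrow> real" and \<delta> :: real
  assumes n1: "1 \<le> n" and finE: "finite E"
    and S: "\<And>e. e \<in> E \<Longrightarrow> finite (S e)" "\<And>e. e \<in> E \<Longrightarrow> S e \<noteq> {}"
    and w: "\<And>e. e \<in> E \<Longrightarrow> 0 \<le> w e" and \<delta>: "0 < \<delta>"
begin

definition lin :: "'p \<Rightarrow> (nat \<Rightarrow> real) \<Rightarrow> real" where
  "lin p x = (\<Sum>k<n. a p k * x k)"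

definition Q :: "(nat \<Rightarrow> real) \<Rightarrow> real" where
  "Q x = (\<Sum>e\<in>E. w e * Max ((\<lambda>p. (lin p x)\<^sup>2) ` S e)) + \<delta> * (\<Sum>k<n. (x k)\<^sup>2)"

text \<open>The squared length of the vector whose coordinates are the values of
  \<open>lin p\<close> on the rows of \<open>B\<close>; by \<open>lin_X\<close>,
  \<open>lin p (X B y)\<close> is its inner product with \<open>y\<close>.\<close>

definition im_sq :: "(nat \<times> nat \<Rightarrow> real) \<Rightarrow> 'p \<Rightarrow> real" where
  "im_sq B p = (\<Sum>i<n. (lin p (\<lambda>k. B (i, k)))\<^sup>2)"

definition \<Phi> :: "(nat \<times> nat \<Rightarrow> real) \<Rightarrow> real" where
  "\<Phi> B = (\<Sum>e\<in>E. w e * Max (im_sq B ` S e)) + \<delta> * (\<Sum>k<n. \<Sum>i<n. (B (i, k))\<^sup>2)"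

text \<open>Matrices are total functions here: fixing the entries outside the square and bounding
  the others through \<open>\<delta>\<close> makes \<open>F\<close> compact in the product topology.
  The level \<open>n\<close> matches the degree of homogeneity of \<open>dt\<close>.\<close>

definition F :: "(nat \<times> nat \<Rightarrow> real) set" where
  "F = {B. (\<forall>i k. \<not> (i < n \<and> k < n) \<longrightarrow> B (i, k) = 0) \<and> \<Phi> B \<le> n}"

definition dt :: "(nat \<times> nat \<Rightarrow> real) \<Rightarrow> real" where
  "dt B = det (mat n n B)"

lemma lin_mult: "lin p (\<lambda>k. s * x k) = s * lin p x"
  by (simp add: lin_def sum_distrib_left algebra_simps)

lemma im_sq_mult: "im_sq (\<lambda>q. s * B q) p = s\<^sup>2 * im_sq B p"
  by (simp add: im_sq_def lin_mult power_mult_distrib sum_distrib_left)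

lemma Q_mult: "Q (\<lambda>k. s * x k) = s\<^sup>2 * Q x"
  using S by (simp add: Q_def lin_mult power_mult_distrib Max_image_mult sum_distrib_left algebra_simps cong: sum.cong)

lemma \<Phi>_mult: "\<Phi> (\<lambda>q. s * B q) = s\<^sup>2 * \<Phi> B"
proof -
  have "Max (im_sq (\<lambda>q. s * B q) ` S e) = s\<^sup>2 * Max (im_sq B ` S e)" if "e \<in> E" for e
    unfolding im_sq_mult using S[OF that] by (simp add: Max_image_mult)
  then show ?thesis
    by (simp add: \<Phi>_def power_mult_distrib sum_distrib_left algebra_simps cong: sum.cong)
qed

lemma im_sq_nonneg: "0 \<le> im_sq B p"
  by (simp add: im_sq_def sum_nonneg)

lemma Max_nonneg_image:
  fixes f :: "'p \<Rightarrow> real"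
  assumes "e \<in> E" "\<And>p. 0 \<le> f p"
  shows "0 \<le> Max (f ` S e)"
  using S[OF assms(1)] assms(2) by (subst Max_ge_iff) auto

lemma Q_nonneg: "0 \<le> Q x"
  unfolding Q_def using w \<delta> Max_nonneg_image by (intro add_nonneg_nonneg sum_nonneg mult_nonneg_nonneg) auto

lemma \<Phi>_ge: "\<delta> * (\<Sum>k<n. \<Sum>i<n. (B (i, k))\<^sup>2) \<le> \<Phi> B"
  unfolding \<Phi>_def using w Max_nonneg_image im_sq_nonneg
  by (simp add: sum_nonneg)

lemma continuous_\<Phi>: "continuous_on UNIV \<Phi>"
  unfolding \<Phi>_def im_sq_def lin_def
  by (intro continuous_intros continuous_on_Max_image S) auto

lemma dt_eq: "dt B = (\<Sum>p\<in>{p. p permutes {0..<n}}. signof p * (\<Prod>i = 0..<n. B (i, p i)))"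
proof -
  have "(\<Prod>i = 0..<n. mat n n B $$ (i, p i)) = (\<Prod>i = 0..<n. B (i, p i))" if "p permutes {0..<n}" for p
    using permutes_in_image[OF that] by (intro prod.cong) auto
  then show ?thesis unfolding dt_def by (subst det_def'[of _ n]) (auto intro!: sum.cong)
qed

lemma continuous_dt: "continuous_on UNIV dt"
  unfolding dt_eq by (intro continuous_intros) auto

lemma dt_mult: "dt (\<lambda>q. s * B q) = s ^ n * dt B"
proof -
  have "mat n n (\<lambda>q. s * B q) = s \<cdot>\<^sub>m mat n n B" by (rule eq_matI) auto
  then show ?thesis by (simp add: dt_def)
qed

lemma compact_F: "compact F"
proof -
  define R where "R = sqrt (n / \<delta>)"
  define A where "A = (\<lambda>q. if fst q < n \<and> snd q < n then {-R..R} else {0})"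
  have "F = {B. \<forall>q. B q \<in> A q} \<inter> {B. \<Phi> B \<le> n}"
  proof (intro equalityI subsetI)
    fix B assume B: "B \<in> F"
    have "B (i, k) \<in> A (i, k)" for i k
    proof (cases "i < n \<and> k < n")
      case True
      have "(B (i, k))\<^sup>2 \<le> (\<Sum>i<n. (B (i, k))\<^sup>2)"
        using True by (intro member_le_sum) auto
      also have "\<dots> \<le> (\<Sum>k<n. \<Sum>i<n. (B (i, k))\<^sup>2)"
        using True by (intro member_le_sum[where f = "\<lambda>k. \<Sum>i<n. (B (i, k))\<^sup>2"]) (auto intro: sum_nonneg)
      also have "\<dots> \<le> n / \<delta>"
        using \<Phi>_ge[of B] B \<delta> by (simp add: F_def field_simps)
      finally have "\<bar>B (i, k)\<bar> \<le> R" unfolding R_def by (metis real_sqrt_abs real_sqrt_le_mono)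
      then show ?thesis using True by (auto simp: A_def)
    qed (use B in \<open>auto simp: F_def A_def\<close>)
    then show "B \<in> {B. \<forall>q. B q \<in> A q} \<inter> {B. \<Phi> B \<le> n}" using B by (auto simp: F_def)
  next
    fix B assume B: "B \<in> {B. \<forall>q. B q \<in> A q} \<inter> {B. \<Phi> B \<le> n}"
    have "B (i, k) = 0" if "\<not> (i < n \<and> k < n)" for i k
    proof -
      have "B (i, k) \<in> A (i, k)" using B by blast
      then show ?thesis using that by (auto simp: A_def)
    qed
    then show "B \<in> F" using B by (auto simp: F_def)
  qed
  moreover have "compact {B. \<forall>q. B q \<in> A q}" by (rule compact_box) (auto simp: A_def)
  moreover have "closed {B. \<Phi> B \<le> n}"
    by (intro closed_Collect_le continuous_\<Phi> continuous_on_const)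
  ultimately show ?thesis by (simp add: compact_Int_closed)
qed

lemma F_nonsingular: "\<exists>B\<in>F. dt B \<noteq> 0"
proof -
  define I where "I = (\<lambda>(i, k). if i < n \<and> i = k then 1 else 0 :: real)"
  have \<Phi>0: "0 \<le> \<Phi> B" for B
    using \<Phi>_ge[of B] \<delta> by (smt (verit) mult_nonneg_nonneg sum_nonneg zero_le_power2)
  define s where "s = 1 / sqrt (1 + \<Phi> I)"
  have s: "0 < s" "s\<^sup>2 * \<Phi> I \<le> 1"
    using \<Phi>0[of I] by (auto simp: s_def power_divide add_pos_nonneg field_simps)
  have "mat n n I = 1\<^sub>m n" by (rule eq_matI) (auto simp: I_def)
  then have "dt I = 1" by (simp add: dt_def)
  then have "dt (\<lambda>q. s * I q) \<noteq> 0" using s(1) by (simp add: dt_mult)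
  moreover have "(\<lambda>q. s * I q) \<in> F"
    using s(2) n1 by (auto simp: F_def \<Phi>_mult I_def)
  ultimately show ?thesis by blast
qed

definition X :: "(nat \<times> nat \<Rightarrow> real) \<Rightarrow> (nat \<Rightarrow> real) \<Rightarrow> nat \<Rightarrow> real" where
  "X B y k = (\<Sum>i<n. y i * B (i, k))"

lemma X_surj:
  assumes "dt B \<noteq> 0"
  shows "\<exists>y. (\<forall>i\<ge>n. y i = 0) \<and> (\<forall>k<n. X B y k = x k)"
proof -
  define A where "A = mat n n (\<lambda>(k, i). B (i, k))"
  have A: "A \<in> carrier_mat n n" by (simp add: A_def)
  have "A = (mat n n B)\<^sup>T" by (rule eq_matI) (auto simp: A_def)
  then have "det A \<noteq> 0" using assms by (simp add: dt_def det_transpose[of _ n])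
  from det_non_zero_imp_unit[OF A this, of "()"]
  obtain Ai where Ai: "Ai \<in> carrier_mat n n" "A * Ai = 1\<^sub>m n"
    by (auto simp: Units_def ring_mat_def)
  define y where "y = (\<lambda>i. if i < n then (Ai *\<^sub>v vec n x) $ i else 0)"
  have "A *\<^sub>v (Ai *\<^sub>v vec n x) = vec n x"
    using A Ai by (simp add: assoc_mult_mat_vec[symmetric])
  then have "(A *\<^sub>v (Ai *\<^sub>v vec n x)) $ k = x k" if "k < n" for k
    using that by simp
  moreover have "(A *\<^sub>v (Ai *\<^sub>v vec n x)) $ k = X B y k" if "k < n" for k
  proof -
    have "(A *\<^sub>v (Ai *\<^sub>v vec n x)) $ k = (\<Sum>i<n. B (i, k) * (Ai *\<^sub>v vec n x) $ i)"
      using that Ai(1) by (simp add: A_def scalar_prod_def lessThan_atLeast0)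
    also have "\<dots> = X B y k" unfolding X_def by (intro sum.cong) (auto simp: y_def)
    finally show ?thesis .
  qed
  ultimately have "X B y k = x k" if "k < n" for k using that by simp
  then show ?thesis by (intro exI[of _ y]) (auto simp: y_def)
qed

lemma lin_X: "lin p (X B y) = (\<Sum>i<n. y i * lin p (\<lambda>k. B (i, k)))"
  unfolding lin_def X_def sum_distrib_left by (subst sum.swap) (simp add: algebra_simps)

text \<open>At a maximiser of the determinant under \<open>\<Phi> \<le> n\<close>, stretching by \<open>1 + t\<close> along \<open>y\<close>
  multiplies the determinant by \<open>1 + t\<close> and increases \<open>\<Phi>\<close> by at most \<open>(2 t + t\<^sup>2) Q (X B y)\<close>.\<close>

lemma one_le_Q_of_max:
  assumes B: "B \<in> F" and d: "dt B \<noteq> 0" and max: "\<And>B'. B' \<in> F \<Longrightarrow> \<bar>dt B'\<bar> \<le> \<bar>dt B\<bar>"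
    and y: "(\<Sum>i<n. (y i)\<^sup>2) = 1"
  shows "1 \<le> Q (X B y)"
proof -
  define x where "x = X B y"
  define q where "q = Q x"
  have q0: "0 \<le> q" using Q_nonneg by (simp add: q_def)
  have key: "(1 + t)\<^sup>2 \<le> exp ((2 * t + t\<^sup>2) * q)" if t: "0 < t" for t
  proof -
    define Bt where "Bt = (\<lambda>(i, k). if i < n \<and> k < n then B (i, k) + t * y i * x k else 0)"
    have det_Bt: "dt Bt = (1 + t) * dt B"
    proof -
      define M where "M = mat n n (\<lambda>(i, j). (if i = j then 1 else 0) + (t * y i) * y j)"
      have "mat n n Bt = M * mat n n B"
      proof (rule eq_matI)
        fix i k assume ik: "i < dim_row (M * mat n n B)" "k < dim_col (M * mat n n B)"
        then have "(M * mat n n B) $$ (i, k) = (\<Sum>j<n. ((if i = j then 1 else 0) + (t * y i) * y j) * B (j, k))"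
          by (simp add: M_def scalar_prod_def lessThan_atLeast0)
        also have "\<dots> = (\<Sum>j<n. if i = j then B (j, k) else 0) + (\<Sum>j<n. t * y i * (y j * B (j, k)))"
          unfolding sum.distrib[symmetric] by (intro sum.cong) (auto simp: algebra_simps)
        also have "\<dots> = B (i, k) + t * y i * x k"
          using ik by (simp add: M_def x_def X_def sum_distrib_left)
        finally show "mat n n Bt $$ (i, k) = (M * mat n n B) $$ (i, k)"
          using ik by (simp add: Bt_def M_def)
      qed (auto simp: M_def)
      then have "dt Bt = det M * dt B"
        by (simp add: dt_def det_mult[of _ n] M_def)
      moreover have "det M = 1 + t"
        unfolding M_def det_id_add_rank_one using y
        by (simp add: power2_eq_square mult.assoc flip: sum_distrib_left)
      ultimately show ?thesis by simp
    qed
    have sq: "(\<Sum>i<n. (u i + t * y i * (\<Sum>i<n. y i * u i))\<^sup>2) = (\<Sum>i<n. (u i)\<^sup>2) + (2 * t + t\<^sup>2) * (\<Sum>i<n. y i * u i)\<^sup>2" for u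
    proof -
      define r where "r = (\<Sum>i<n. y i * u i)"
      have "(\<Sum>i<n. (u i + t * y i * r)\<^sup>2) = (\<Sum>i<n. (u i)\<^sup>2 + 2 * t * r * (y i * u i) + t\<^sup>2 * r\<^sup>2 * (y i)\<^sup>2)"
        by (intro sum.cong) (auto simp: power2_eq_square algebra_simps)
      also have "\<dots> = (\<Sum>i<n. (u i)\<^sup>2) + 2 * t * r * r + t\<^sup>2 * r\<^sup>2 * 1"
        by (simp add: sum.distrib r_def y flip: sum_distrib_left)
      finally show ?thesis by (simp add: r_def power2_eq_square algebra_simps)
    qed
    have im: "im_sq Bt p = im_sq B p + (2 * t + t\<^sup>2) * (lin p x)\<^sup>2" for p
    proof -
      have "lin p (\<lambda>k. Bt (i, k)) = lin p (\<lambda>k. B (i, k)) + t * y i * lin p x" if "i < n" for i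
      proof -
        have "lin p (\<lambda>k. Bt (i, k)) = (\<Sum>k<n. a p k * B (i, k) + t * y i * (a p k * x k))"
          unfolding lin_def using that by (intro sum.cong) (auto simp: Bt_def algebra_simps)
        then show ?thesis by (simp add: lin_def sum.distrib sum_distrib_left)
      qed
      then show ?thesis
        unfolding im_sq_def x_def lin_X sq[symmetric] by (intro sum.cong) auto
    qed
    have col: "(\<Sum>i<n. (Bt (i, k))\<^sup>2) = (\<Sum>i<n. (B (i, k))\<^sup>2) + (2 * t + t\<^sup>2) * (x k)\<^sup>2" if "k < n" for k
    proof -
      have "(\<Sum>i<n. (Bt (i, k))\<^sup>2) = (\<Sum>i<n. (B (i, k) + t * y i * (\<Sum>i<n. y i * B (i, k)))\<^sup>2)"
        using that by (intro sum.cong) (auto simp: Bt_def x_def X_def)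
      then show ?thesis unfolding sq by (simp add: x_def X_def)
    qed
    have tt: "0 \<le> 2 * t + t\<^sup>2" using t by simp
    have "\<Phi> Bt \<le> \<Phi> B + (2 * t + t\<^sup>2) * q"
    proof -
      have "Max (im_sq Bt ` S e) \<le> Max (im_sq B ` S e) + (2 * t + t\<^sup>2) * Max ((\<lambda>p. (lin p x)\<^sup>2) ` S e)" if e: "e \<in> E" for e
      proof (subst Max_le_iff)
        show "\<forall>r\<in>im_sq Bt ` S e. r \<le> Max (im_sq B ` S e) + (2 * t + t\<^sup>2) * Max ((\<lambda>p. (lin p x)\<^sup>2) ` S e)"
          using S(1)[OF e] tt by (auto simp: im intro!: add_mono mult_left_mono Max_ge)
      qed (use S[OF e] in auto)
      then have "(\<Sum>e\<in>E. w e * Max (im_sq Bt ` S e)) \<le> (\<Sum>e\<in>E. w e * (Max (im_sq B ` S e) + (2 * t + t\<^sup>2) * Max ((\<lambda>p. (lin p x)\<^sup>2) ` S e)))"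
        using w by (intro sum_mono mult_left_mono) auto
      moreover have "(\<Sum>k<n. \<Sum>i<n. (Bt (i, k))\<^sup>2) = (\<Sum>k<n. (\<Sum>i<n. (B (i, k))\<^sup>2) + (2 * t + t\<^sup>2) * (x k)\<^sup>2)"
        by (intro sum.cong col) auto
      ultimately show ?thesis
        unfolding \<Phi>_def q_def Q_def by (simp add: sum.distrib sum_distrib_left algebra_simps)
    qed
    then have \<Phi>Bt: "\<Phi> Bt \<le> n + (2 * t + t\<^sup>2) * q" using B by (simp add: F_def)
    \<comment> \<open>Dividing \<open>Bt\<close> by \<open>sqrt \<gamma>\<close> restores the
      constraint and divides the squared determinant by \<open>\<gamma> ^ n\<close>. Since the
      constraint has level \<open>n\<close>, this loss is at most
      \<open>exp ((2 * t + t^2) * q)\<close>, which no longer contains \<open>n\<close>.\<close>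
    define \<gamma> where "\<gamma> = 1 + (2 * t + t\<^sup>2) * q / n"
    have \<gamma>: "1 \<le> \<gamma>" using tt q0 by (simp add: \<gamma>_def)
    define s where "s = 1 / sqrt \<gamma>"
    have s2: "s\<^sup>2 = 1 / \<gamma>" using \<gamma> by (simp add: s_def power_divide)
    have "n * \<gamma> = n + (2 * t + t\<^sup>2) * q" using n1 by (simp add: \<gamma>_def field_simps)
    then have "\<Phi> (\<lambda>q. s * Bt q) \<le> 1 / \<gamma> * (n * \<gamma>)"
      unfolding \<Phi>_mult s2 using \<Phi>Bt \<gamma> by (intro mult_left_mono) auto
    also have "\<dots> = n" using \<gamma> by simp
    finally have "(\<lambda>q. s * Bt q) \<in> F" by (auto simp: F_def Bt_def)
    from max[OF this] have "\<bar>s ^ n * ((1 + t) * dt B)\<bar> \<le> \<bar>dt B\<bar>" by (simp add: dt_mult det_Bt)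
    then have "\<bar>s ^ n * (1 + t)\<bar> \<le> 1" using d by (simp add: abs_mult mult.assoc[symmetric])
    then have "(s ^ n * (1 + t))\<^sup>2 \<le> 1" by (simp add: abs_square_le_1)
    then have "(s\<^sup>2) ^ n * (1 + t)\<^sup>2 \<le> 1" by (simp add: power_mult_distrib power_mult[symmetric] mult.commute)
    then have "(1 + t)\<^sup>2 \<le> \<gamma> ^ n" using \<gamma> by (simp add: s2 power_one_over field_simps)
    also have "\<dots> \<le> exp ((2 * t + t\<^sup>2) * q / n) ^ n"
      using \<gamma> unfolding \<gamma>_def by (intro power_mono exp_ge_add_one_self) auto
    also have "\<dots> = exp ((2 * t + t\<^sup>2) * q)"
      using n1 by (simp flip: exp_of_nat_mult)
    finally show ?thesis .
  qed
  show ?thesis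
  proof (rule ccontr)
    assume "\<not> 1 \<le> Q (X B y)"
    then have q1: "q < 1" by (simp add: q_def x_def)
    \<comment> \<open>To first order \<open>key\<close> says \<open>2 * t \<le> 2 * t * q\<close>.
      With the second-order terms it yields \<open>2 * (1 - q) < 3 * t\<close>, which this choice
      contradicts.\<close>
    define t where "t = (1 - q) / 3"
    have t: "0 < t" "t \<le> 1" using q0 q1 by (auto simp: t_def)
    have "ln ((1 + t)\<^sup>2) \<le> (2 * t + t\<^sup>2) * q"
    proof -
      have "ln ((1 + t)\<^sup>2) \<le> ln (exp ((2 * t + t\<^sup>2) * q))"
        using key[OF t(1)] t by (subst ln_le_cancel_iff) auto
      then show ?thesis by simp
    qed
    then have "2 * ln (1 + t) \<le> (2 * t + t\<^sup>2) * q" using t by (simp add: ln_realpow)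
    moreover have "t - t\<^sup>2 \<le> ln (1 + t)" using t by (intro ln_one_plus_pos_lower_bound) auto
    ultimately have "t * (2 - 2 * t) \<le> t * ((2 + t) * q)" by (simp add: power2_eq_square algebra_simps)
    then have "2 - 2 * t \<le> (2 + t) * q" using t by simp
    moreover have "t * q < t * 1" using q1 t by (intro mult_strict_left_mono) auto
    ultimately have "2 - 2 * t < 2 * q + t" by (simp add: algebra_simps)
    then show False using q1 by (simp add: t_def field_simps)
  qed
qed

text \<open>The bound on unit vectors extends to all \<open>y\<close> by homogeneity, and
  \<open>X B\<close> is onto because the maximiser has nonzero determinant.\<close>

theorem adapted_basis:
  "\<exists>B. (\<Sum>e\<in>E. w e * Max (im_sq B ` S e)) \<le> n \<and>
    (\<forall>x. \<exists>y. (\<forall>i\<ge>n. y i = 0) \<and> (\<forall>k<n. X B y k = x k) \<and> (\<Sum>i<n. (y i)\<^sup>2) \<le> Q x)"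
proof -
  obtain B where B: "B \<in> F" "\<And>B'. B' \<in> F \<Longrightarrow> \<bar>dt B'\<bar> \<le> \<bar>dt B\<bar>"
    using continuous_attains_sup[OF compact_F, of "\<lambda>B. \<bar>dt B\<bar>"] F_nonsingular
      continuous_on_subset[OF continuous_on_rabs[OF continuous_dt], of F] by auto
  have d: "dt B \<noteq> 0" using F_nonsingular B(2) by fastforce
  have "\<Phi> B \<le> n" using B by (simp add: F_def)
  moreover have "0 \<le> \<delta> * (\<Sum>k<n. \<Sum>i<n. (B (i, k))\<^sup>2)" using \<delta> by (simp add: sum_nonneg)
  ultimately have "(\<Sum>e\<in>E. w e * Max (im_sq B ` S e)) \<le> n" by (simp add: \<Phi>_def)
  moreover have "\<exists>y. (\<forall>i\<ge>n. y i = 0) \<and> (\<forall>k<n. X B y k = x k) \<and> (\<Sum>i<n. (y i)\<^sup>2) \<le> Q x" for x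
  proof -
    obtain y where y: "\<forall>i\<ge>n. y i = 0" "\<forall>k<n. X B y k = x k" using X_surj[OF d] by blast
    have "lin p (X B y) = lin p x" for p
      unfolding lin_def using y(2) by (intro sum.cong) auto
    moreover have "(\<Sum>k<n. (X B y k)\<^sup>2) = (\<Sum>k<n. (x k)\<^sup>2)"
      using y(2) by (intro sum.cong) auto
    ultimately have Qx: "Q (X B y) = Q x" by (simp add: Q_def)
    define Y where "Y = (\<Sum>i<n. (y i)\<^sup>2)"
    have "Y \<le> Q x"
    proof (cases "Y = 0")
      case True
      then show ?thesis using Q_nonneg by simp
    next
      case False
      then have Y: "0 < Y" unfolding Y_def by (simp add: order_less_le sum_nonneg)
      define s where "s = 1 / sqrt Y"
      have s: "s\<^sup>2 = 1 / Y" using Y by (simp add: s_def power_divide)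
      have "(\<Sum>i<n. (s * y i)\<^sup>2) = 1"
        using Y by (simp add: power_mult_distrib s flip: sum_divide_distrib Y_def)
      from one_le_Q_of_max[OF B(1) d B(2) this]
      have "1 \<le> Q (X B (\<lambda>i. s * y i))" .
      also have "X B (\<lambda>i. s * y i) = (\<lambda>k. s * X B y k)"
        by (rule ext) (simp add: X_def sum_distrib_left algebra_simps)
      finally show ?thesis using Y by (simp add: Q_mult s Qx field_simps)
    qed
    then show ?thesis using y by (auto simp: Y_def)
  qed
  ultimately show ?thesis by blast
qed

end

section \<open>Chaining\<close>

lemma sum_exp_neg_le: "(\<Sum>l=1..m. exp (- real l)) \<le> 1"
proof -
  have "(\<Sum>l=1..m. exp (- real l)) \<le> (\<Sum>l=1..m. (1/2) ^ l)"
  proof (intro sum_mono)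
    fix l
    have "exp (- real l) = exp (-1) ^ l" by (simp flip: exp_of_nat_mult)
    also have "\<dots> \<le> (1/2) ^ l"
      using exp_ge_add_one_self[of 1] by (intro power_mono) (auto simp: exp_minus field_simps)
    finally show "exp (- real l) \<le> (1/2) ^ l" .
  qed
  also have "\<dots> = 1 - (1/2) ^ m" by (induction m) auto
  also have "\<dots> \<le> 1" by simp
  finally show ?thesis .
qed

text \<open>A union bound with uneven failure probabilities: at the level
  \<open>4 * sqrt (c * v)\<close>, where \<open>v\<close> is the square sum of
  \<open>\<Delta>\<close>, the tail bound is \<open>2 * exp (- c)\<close>, hence the budget
  \<open>1 / 2\<close>.\<close>

lemma signs_exist:
  fixes F :: "(('e \<Rightarrow> real) \<times> real) set"
  assumes fin: "finite E" "finite F" and c: "\<And>p. p \<in> F \<Longrightarrow> 0 \<le> snd p" and sm: "(\<Sum>p\<in>F. exp (- snd p)) < 1 / 2"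
  shows "\<exists>\<epsilon>\<in>signs E. \<forall>(\<Delta>, c)\<in>F. \<bar>\<Sum>e\<in>E. \<Delta> e * \<epsilon> e\<bar> \<le> 4 * sqrt (c * (\<Sum>e\<in>E. (\<Delta> e)\<^sup>2))"
proof -
  define W where "W = (\<lambda>A. sum (tilt (\<lambda>_. 0) E) A)"
  define bad where "bad = (\<lambda>p. {\<epsilon>\<in>signs E. 4 * sqrt (snd p * (\<Sum>e\<in>E. (fst p e)\<^sup>2)) < \<bar>\<Sum>e\<in>E. fst p e * \<epsilon> e\<bar>})"
  have nn: "0 \<le> tilt (\<lambda>_. 0) E \<epsilon>" for \<epsilon> by (simp add: tilt_zero)
  have b: "W (bad p) \<le> 2 * exp (- snd p)" if p: "p \<in> F" for p
  proof (cases "(\<Sum>e\<in>E. (fst p e)\<^sup>2) = 0")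
    case True
    then have "\<And>e. e \<in> E \<Longrightarrow> fst p e = 0" using fin by (simp add: sum_nonneg_eq_0_iff)
    then have "bad p = {}" by (auto simp: bad_def)
    then show ?thesis by (simp add: W_def)
  next
    case False
    define v where "v = (\<Sum>e\<in>E. (fst p e)\<^sup>2)"
    have v: "0 < v" using False by (simp add: v_def order_less_le sum_nonneg)
    define t where "t = 4 * sqrt (snd p * v)"
    have "(\<Sum>\<epsilon>\<in>{\<epsilon>\<in>signs E. t < \<bar>\<Sum>e\<in>E. fst p e * (\<epsilon> e - 0)\<bar>}. tilt (\<lambda>_. 0) E \<epsilon>) \<le> 2 * exp (- (t\<^sup>2 / (16 * v)))"
      using fin v c[OF p] by (intro tilt_tail) (auto simp: v_def t_def)
    moreover have "t\<^sup>2 / (16 * v) = snd p" using v c[OF p] by (simp add: t_def power_mult_distrib)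
    ultimately show ?thesis by (simp add: W_def bad_def t_def v_def)
  qed
  have "W (\<Union>p\<in>F. bad p) \<le> (\<Sum>p\<in>F. W (bad p))"
    unfolding W_def using fin nn by (intro sum_UN_le) (auto simp: bad_def)
  also have "\<dots> \<le> (\<Sum>p\<in>F. 2 * exp (- snd p))" by (intro sum_mono b)
  also have "\<dots> < 1" using sm by (simp flip: sum_distrib_left)
  finally have "W (\<Union>p\<in>F. bad p) < W (signs E)" by (simp add: W_def sum_tilt fin)
  then have "(\<Union>p\<in>F. bad p) \<noteq> signs E" by auto
  then obtain \<epsilon> where "\<epsilon> \<in> signs E" "\<epsilon> \<notin> (\<Union>p\<in>F. bad p)" by (auto simp: bad_def)
  then show ?thesis by (intro bexI[of _ \<epsilon>]) (force simp: bad_def not_less)+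
qed

lemma sq_diff_le: "sq n (\<lambda>k. u k - v k) \<le> 2 * sq n u + 2 * sq n v"
proof -
  have "sq n (\<lambda>k. u k - v k) \<le> (\<Sum>k<n. 2 * (u k)\<^sup>2 + 2 * (v k)\<^sup>2)"
    unfolding sq_def
  proof (rule sum_mono)
    fix k
    have "0 \<le> (u k + v k)\<^sup>2" by simp
    then show "(u k - v k)\<^sup>2 \<le> 2 * (u k)\<^sup>2 + 2 * (v k)\<^sup>2" by (simp add: power2_eq_square algebra_simps)
  qed
  then show ?thesis by (simp add: sq_def sum.distrib sum_distrib_left)
qed

lemma continuous_on_sq [continuous_intros]: "continuous_on A (\<lambda>z. sq n (\<lambda>k. z k - w k))"
  unfolding sq_def by (intro continuous_intros continuous_on_subset[OF continuous_on_product_coordinates subset_UNIV])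

text \<open>Moving the nearest point \<open>z\<close> towards \<open>x\<close> inside the set shows
  that \<open>z - w\<close> and \<open>x - z\<close> have nonnegative inner product. The resulting
  Pythagorean inequality is what lets squared steps telescope.\<close>

lemma projection_exists:
  assumes C: "compact C" "C \<noteq> {}"
    and conv: "\<And>x z t. x \<in> C \<Longrightarrow> z \<in> C \<Longrightarrow> 0 \<le> t \<Longrightarrow> t \<le> 1 \<Longrightarrow> (\<lambda>k. t * x k + (1 - t) * z k) \<in> C"
  shows "\<exists>z\<in>C. \<forall>x\<in>C. sq n (\<lambda>k. x k - z k) + sq n (\<lambda>k. z k - w k) \<le> sq n (\<lambda>k. x k - w k)"
proof -
  obtain z where z: "z \<in> C" "\<And>x. x \<in> C \<Longrightarrow> sq n (\<lambda>k. z k - w k) \<le> sq n (\<lambda>k. x k - w k)"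
    using continuous_attains_inf[OF C continuous_on_sq[of C n w]] by blast
  have "sq n (\<lambda>k. x k - z k) + sq n (\<lambda>k. z k - w k) \<le> sq n (\<lambda>k. x k - w k)" if x: "x \<in> C" for x
  proof -
    define i where "i = (\<Sum>k<n. (z k - w k) * (x k - z k))"
    define X where "X = sq n (\<lambda>k. x k - z k)"
    have ex: "sq n (\<lambda>k. t * x k + (1 - t) * z k - w k) = sq n (\<lambda>k. z k - w k) + 2 * t * i + t\<^sup>2 * X" for t
    proof -
      have "sq n (\<lambda>k. t * x k + (1 - t) * z k - w k)
        = (\<Sum>k<n. (z k - w k)\<^sup>2 + 2 * t * ((z k - w k) * (x k - z k)) + t\<^sup>2 * (x k - z k)\<^sup>2)"
        unfolding sq_def by (intro sum.cong) (auto simp: power2_eq_square algebra_simps)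
      then show ?thesis by (simp add: sq_def i_def X_def sum.distrib sum_distrib_left)
    qed
    have pos: "0 \<le> 2 * i + t * X" if "0 < t" "t \<le> 1" for t
    proof -
      have "0 \<le> t * (2 * i + t * X)"
        using z(2)[OF conv[OF x z(1), of t]] that ex[of t] by (simp add: power2_eq_square algebra_simps)
      then show ?thesis using that by (simp add: zero_le_mult_iff)
    qed
    have "0 \<le> i"
    proof (rule ccontr)
      assume i: "\<not> 0 \<le> i"
      have X: "0 \<le> X" by (simp add: X_def)
      define t where "t = min 1 (- i / (X + 1))"
      have "0 < - i / (X + 1)" using i X by (intro divide_pos_pos) auto
      then have t: "0 < t" "t \<le> 1" by (auto simp: t_def)
      have "t \<le> - i / (X + 1)" by (simp add: t_def)
      then have "t * (X + 1) \<le> - i" using X by (subst (asm) pos_le_divide_eq) auto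
      then have "t * X \<le> - i" using t(1) by (simp add: algebra_simps)
      then show False using pos[OF t(1,2)] i by linarith
    qed
    then show ?thesis using ex[of 1] by (simp add: X_def)
  qed
  then show ?thesis using z(1) by blast
qed

section \<open>Scales, convex neighbourhoods and the tree of centres\<close>

locale chaining = max_functionals +
  assumes \<tau>1: "\<tau> \<le> 1" and cardE: "card E \<le> 2 ^ n"
begin

text \<open>Chosen so that \<open>n \<le> 2 ^ J\<close>: then \<open>64 ^ J\<close> is at least
  \<open>n ^ 6\<close> and outweighs the entropy \<open>10 * n^2\<close> of the final grid.\<close>

definition J :: nat where "J = nat \<lceil>log 2 n\<rceil>"

text \<open>At scale \<open>\<sigma> j\<close>, a step of squared length \<open>l / J\<close> costs \<open>O(l 64\<^sup>j)\<close>.  The noise changes every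
  \<open>N e\<close> by at most \<open>\<rho> j\<close>; since \<open>J\<close> is of order \<open>ln n\<close>, \<open>\<rho> j\<close> is of order \<open>sqrt \<tau> / 8\<^sup>j\<close>
  without a logarithm.\<close>

definition \<sigma> :: "nat \<Rightarrow> real" where "\<sigma> j = 1 / (8 ^ j * sqrt J)"
definition \<rho> :: "nat \<Rightarrow> real" where "\<rho> j = 8 * \<kappa>1 * \<sigma> j"

definition H :: "nat \<Rightarrow> (nat \<Rightarrow> real) \<Rightarrow> 'b set" where
  "H j z = {e\<in>E. 4 * \<rho> j \<le> N e z}"
definition h :: "nat \<Rightarrow> (nat \<Rightarrow> real) \<Rightarrow> 'b \<Rightarrow> real" where
  "h j z e = (if e \<in> H j z then (N e z)\<^sup>2 else 0)"
definition T :: "(nat \<Rightarrow> real) set" where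
  "T = {y. (\<forall>i\<ge>n. y i = 0) \<and> sq n y \<le> 1 \<and> (\<Sum>e\<in>E. (N e y)\<^sup>2) \<le> 1}"
definition cl :: "nat \<Rightarrow> (nat \<Rightarrow> real) \<Rightarrow> real \<Rightarrow> (nat \<Rightarrow> real) \<Rightarrow> bool" where
  "cl j z = close (\<lambda>e. N e z) (H j z)"

lemma H_sub: "H j z \<subseteq> E" by (auto simp: H_def)

lemma J_ge: "log 2 n \<le> J" and J_ge_1: "1 \<le> J" and J_le_log: "J \<le> log 2 n + 1"
proof -
  have l: "1 \<le> log 2 n" using n2 by (subst le_log_iff) auto
  show "log 2 n \<le> J" "1 \<le> J" "J \<le> log 2 n + 1" using l unfolding J_def by linarith+
qed

lemma n_le_J: "real n \<le> 2 ^ J"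
proof -
  have "real n = 2 powr log 2 n" using n2 by simp
  also have "\<dots> \<le> 2 powr J" using J_ge by (intro powr_mono) auto
  finally show ?thesis by (simp add: powr_realpow)
qed

lemma ln_n_le_J: "ln n \<le> J"
proof -
  have "ln n \<le> ln n / ln 2"
    using n2 ln_2_less_1 by (simp add: field_simps)
  then show ?thesis using J_ge by (simp add: log_def)
qed

lemma J_le_ln: "J \<le> 4 * ln n"
proof -
  have l2: "1 / 2 \<le> ln (2::real)" by (rule half_le_ln2)
  have "ln 2 \<le> ln n" using n2 by simp
  then have "J \<le> 2 * (ln n / ln 2)" using J_le_log by (simp add: log_def field_simps)
  also have "\<dots> \<le> 2 * (ln n / (1/2))" using l2 n2 by (intro mult_left_mono divide_left_mono) auto
  finally show ?thesis by simp
qed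

lemma J_le_n: "J \<le> n"
proof -
  have "log 2 n \<le> n"
    using n2 less_exp[of n] by (subst log_le_iff) (auto simp: powr_realpow intro: less_imp_le)
  then show ?thesis unfolding J_def by linarith
qed

lemma J_pos: "0 < real J" using J_ge_1 by simp

lemma \<sigma>_pos: "0 < \<sigma> j" using J_pos by (simp add: \<sigma>_def)
lemma \<sigma>_Suc: "\<sigma> (Suc j) = \<sigma> j / 8" by (simp add: \<sigma>_def)
lemma \<sigma>_sq: "(\<sigma> j)\<^sup>2 = 1 / (64 ^ j * J)"
  by (simp add: \<sigma>_def power_divide power_mult_distrib power_mult[symmetric] mult.commute[of j] flip: power_mult) (simp add: power_mult)
lemma \<rho>_pos: "0 < \<rho> j" using \<sigma>_pos \<kappa>_pos by (simp add: \<rho>_def)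
lemma \<rho>_Suc: "\<rho> (Suc j) = \<rho> j / 8" by (simp add: \<rho>_def \<sigma>_Suc)

definition R :: real where "R = 64 * \<kappa>1\<^sup>2 / J"

lemma \<rho>_sq: "(\<rho> j)\<^sup>2 = R / 64 ^ j"
  by (simp add: \<rho>_def R_def power_mult_distrib \<sigma>_sq)

lemma R_le: "R \<le> 5120 * \<tau>"
proof -
  have "R = 5120 * \<tau> * (ln n / J)" by (simp add: R_def \<kappa>_sq)
  also have "\<dots> \<le> 5120 * \<tau> * 1"
    using ln_n_le_J J_pos \<tau> by (intro mult_left_mono) auto
  finally show ?thesis by simp
qed

text \<open>Needed at scale \<open>0\<close>, where the centre is \<open>0\<close> and the distance
  to \<open>x\<close> is \<open>N e x \<le> sqrt \<tau>\<close>; this has to lie below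
  \<open>\<rho> 0\<close>.\<close>

lemma R_ge: "\<tau> \<le> R"
proof -
  have "1 \<le> 5120 * (ln n / J)" using J_le_ln J_pos by (simp add: field_simps)
  then have "\<tau> * 1 \<le> \<tau> * (5120 * (ln n / J))" using \<tau> by (intro mult_left_mono) auto
  then show ?thesis by (simp add: R_def \<kappa>_sq mult_ac)
qed

lemma N_continuous: "e \<in> E \<Longrightarrow> continuous_on A (\<lambda>z. N e (\<lambda>k. z k - w k))"
  unfolding N_def ip_def using finS S(2)
  by (intro continuous_on_Max_image continuous_intros continuous_on_subset[OF continuous_on_product_coordinates subset_UNIV]) auto

lemma T_zero: "(\<lambda>_. 0) \<in> T"
  by (auto simp: T_def sq_def N_zero)

lemma N_sq_combo:
  assumes e: "e \<in> E" and t: "0 \<le> t" "t \<le> 1"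
  shows "(N e (\<lambda>k. t * x k + (1 - t) * z k))\<^sup>2 \<le> t * (N e x)\<^sup>2 + (1 - t) * (N e z)\<^sup>2"
proof -
  have "N e (\<lambda>k. t * x k + (1 - t) * z k) \<le> t * N e x + (1 - t) * N e z"
    using N_combo[OF e, of t x "1 - t" z] t by simp
  then have "(N e (\<lambda>k. t * x k + (1 - t) * z k))\<^sup>2 \<le> (t * N e x + (1 - t) * N e z)\<^sup>2"
    using N_nonneg[OF e] by (intro power_mono) auto
  also have "\<dots> = t * (N e x)\<^sup>2 + (1 - t) * (N e z)\<^sup>2 - t * (1 - t) * (N e x - N e z)\<^sup>2"
    by (simp add: power2_eq_square algebra_simps)
  also have "\<dots> \<le> t * (N e x)\<^sup>2 + (1 - t) * (N e z)\<^sup>2" using t by simp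
  finally show ?thesis .
qed

lemma sq_combo:
  assumes t: "0 \<le> t" "t \<le> 1"
  shows "sq n (\<lambda>k. t * x k + (1 - t) * z k) \<le> t * sq n x + (1 - t) * sq n z"
  unfolding sq_def sum_distrib_left sum.distrib[symmetric]
proof (rule sum_mono)
  fix k
  have "(t * x k + (1 - t) * z k)\<^sup>2 = t * (x k)\<^sup>2 + (1 - t) * (z k)\<^sup>2 - t * (1 - t) * (x k - z k)\<^sup>2"
    by (simp add: power2_eq_square algebra_simps)
  then show "(t * x k + (1 - t) * z k)\<^sup>2 \<le> t * (x k)\<^sup>2 + (1 - t) * (z k)\<^sup>2" using t by simp
qed

lemma T_convex:
  assumes "x \<in> T" "z \<in> T" and t: "0 \<le> t" "t \<le> 1"
  shows "(\<lambda>k. t * x k + (1 - t) * z k) \<in> T"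
proof -
  have "sq n (\<lambda>k. t * x k + (1 - t) * z k) \<le> t * sq n x + (1 - t) * sq n z" by (rule sq_combo[OF t])
  also have "\<dots> \<le> t * 1 + (1 - t) * 1" using assms by (intro add_mono mult_left_mono) (auto simp: T_def)
  finally have 1: "sq n (\<lambda>k. t * x k + (1 - t) * z k) \<le> 1" by simp
  have "(\<Sum>e\<in>E. (N e (\<lambda>k. t * x k + (1 - t) * z k))\<^sup>2) \<le> (\<Sum>e\<in>E. t * (N e x)\<^sup>2 + (1 - t) * (N e z)\<^sup>2)"
    by (intro sum_mono N_sq_combo t)
  also have "\<dots> = t * (\<Sum>e\<in>E. (N e x)\<^sup>2) + (1 - t) * (\<Sum>e\<in>E. (N e z)\<^sup>2)"
    by (simp add: sum.distrib sum_distrib_left)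
  also have "\<dots> \<le> t * 1 + (1 - t) * 1" using assms by (intro add_mono mult_left_mono) (auto simp: T_def)
  finally show ?thesis using 1 assms by (auto simp: T_def)
qed

text \<open>The set is determined by the centre and the net point alone, so the centres can be
  enumerated before \<open>x\<close> is known. The radius is \<open>2 + 2\<close> times the scale:
  from \<open>\<xi>\<close> to a competitor \<open>y\<close>, and from \<open>y\<close> to
  \<open>x\<close>.\<close>

definition C :: "nat \<Rightarrow> (nat \<Rightarrow> real) \<Rightarrow> (nat \<Rightarrow> real) \<Rightarrow> (nat \<Rightarrow> real) set" where
  "C j z \<xi> = {z'\<in>T. cl j z (4 * \<sigma> (Suc j)) (\<lambda>k. z' k - \<xi> k)}"

lemma C_compact: "compact (C j z \<xi>)"
proof -
  define A where "A = (\<lambda>i. if i < n then {-1..1::real} else {0})"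
  define L where "L = (\<Inter>e\<in>E. {z'. N e (\<lambda>k. z' k - \<xi> k) \<le> \<kappa>1 * (4 * \<sigma> (Suc j))})"
  define M where "M = {z'. (\<Sum>e\<in>H j z. (N e z)\<^sup>2 * (N e (\<lambda>k. z' k - \<xi> k))\<^sup>2) \<le> (\<kappa>2 * (4 * \<sigma> (Suc j)))\<^sup>2}"
  define S1 where "S1 = {z'. sq n (\<lambda>k. z' k - 0) \<le> 1}"
  define S2 where "S2 = {z'. (\<Sum>e\<in>E. (N e (\<lambda>k. z' k - 0))\<^sup>2) \<le> 1}"
  have "C j z \<xi> = {x. \<forall>i. x i \<in> A i} \<inter> (L \<inter> M \<inter> S1 \<inter> S2)"
  proof (intro equalityI subsetI)
    fix y assume y: "y \<in> C j z \<xi>"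
    have "y i \<in> A i" for i
    proof (cases "i < n")
      case True
      then have "(y i)\<^sup>2 \<le> sq n y" unfolding sq_def by (intro member_le_sum) auto
      also have "\<dots> \<le> 1" using y by (simp add: C_def T_def)
      finally show ?thesis using True by (simp add: A_def abs_square_le_1 abs_le_iff)
    qed (use y in \<open>auto simp: C_def T_def A_def\<close>)
    then show "y \<in> {x. \<forall>i. x i \<in> A i} \<inter> (L \<inter> M \<inter> S1 \<inter> S2)"
      using y by (auto simp: C_def T_def L_def M_def S1_def S2_def cl_def close_def)
  next
    fix y assume y: "y \<in> {x. \<forall>i. x i \<in> A i} \<inter> (L \<inter> M \<inter> S1 \<inter> S2)"
    have "y i = 0" if "n \<le> i" for i
    proof -
      have "y i \<in> A i" using y by blast
      then show ?thesis using that by (simp add: A_def)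
    qed
    then show "y \<in> C j z \<xi>"
      using y by (auto simp: C_def T_def L_def M_def S1_def S2_def cl_def close_def)
  qed
  moreover have "compact {x. \<forall>i. x i \<in> A i}" by (rule compact_box) (auto simp: A_def)
  moreover have "closed L" unfolding L_def
    by (intro closed_INT ballI closed_Collect_le N_continuous continuous_on_const) auto
  moreover have "closed M" "closed S1" "closed S2" unfolding M_def S1_def S2_def
    using H_sub by (intro closed_Collect_le continuous_intros N_continuous; blast)+
  ultimately show ?thesis by (simp add: compact_Int_closed closed_Int)
qed

lemma C_convex:
  assumes "x \<in> C j z \<xi>" "z' \<in> C j z \<xi>" "0 \<le> t" "t \<le> 1"
  shows "(\<lambda>k. t * x k + (1 - t) * z' k) \<in> C j z \<xi>"
proof -
  have "cl j z (4 * \<sigma> (Suc j)) (\<lambda>k. t * (x k - \<xi> k) + (1 - t) * (z' k - \<xi> k))"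
    unfolding cl_def
    by (rule close_combo[OF H_sub, of _ _ _ "4 * \<sigma> (Suc j)" _ "4 * \<sigma> (Suc j)"])
      (use assms \<sigma>_pos[of "Suc j"] in \<open>auto simp: C_def cl_def algebra_simps\<close>)
  then show ?thesis using T_convex assms by (simp add: C_def algebra_simps)
qed

text \<open>The projection of \<open>z\<close> to \<open>C j z \<xi>\<close>; the default
  \<open>z\<close> for an empty set keeps every node of the tree in \<open>T\<close>.\<close>

definition step :: "nat \<Rightarrow> (nat \<Rightarrow> real) \<Rightarrow> (nat \<Rightarrow> real) \<Rightarrow> (nat \<Rightarrow> real)" where
  "step j z \<xi> = (if C j z \<xi> = {} then z else SOME z'. z' \<in> C j z \<xi> \<and>
    (\<forall>x\<in>C j z \<xi>. sq n (\<lambda>k. x k - z' k) + sq n (\<lambda>k. z' k - z k) \<le> sq n (\<lambda>k. x k - z k)))"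

lemma step_props:
  assumes "x \<in> C j z \<xi>"
  shows "step j z \<xi> \<in> C j z \<xi>"
    and "sq n (\<lambda>k. x k - step j z \<xi> k) + sq n (\<lambda>k. step j z \<xi> k - z k) \<le> sq n (\<lambda>k. x k - z k)"
proof -
  have ne: "C j z \<xi> \<noteq> {}" using assms by auto
  have "\<exists>z'. z' \<in> C j z \<xi> \<and>
    (\<forall>x\<in>C j z \<xi>. sq n (\<lambda>k. x k - z' k) + sq n (\<lambda>k. z' k - z k) \<le> sq n (\<lambda>k. x k - z k))"
    using projection_exists[OF C_compact ne C_convex, where n = n and w = z] by blast
  from someI_ex[OF this] show "step j z \<xi> \<in> C j z \<xi>"
    "sq n (\<lambda>k. x k - step j z \<xi> k) + sq n (\<lambda>k. step j z \<xi> k - z k) \<le> sq n (\<lambda>k. x k - z k)"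
    using ne assms by (auto simp: step_def)
qed

lemma step_T: "z \<in> T \<Longrightarrow> step j z \<xi> \<in> T"
proof (cases "C j z \<xi> = {}")
  case False
  then obtain x where "x \<in> C j z \<xi>" by blast
  from step_props(1)[OF this] show ?thesis by (simp add: C_def)
qed (simp add: step_def)

definition net :: "nat \<Rightarrow> (nat \<Rightarrow> real) \<Rightarrow> nat \<Rightarrow> (nat \<Rightarrow> real) set" where
  "net j z l = (SOME A. finite A \<and> real (card A) \<le> 4 * exp (real l * 64 ^ Suc j) \<and>
    (\<forall>y. sq n (\<lambda>k. y k - z k) \<le> real l / J \<longrightarrow> (\<exists>\<xi>\<in>A. cl j z (2 * \<sigma> (Suc j)) (\<lambda>k. y k - \<xi> k))))"

text \<open>\<open>close_net\<close> applies because the weights \<open>N e z\<close> of a point of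
  \<open>T\<close> have square sum at most \<open>1\<close>. The exponent is the squared radius
  \<open>l / J\<close> divided by \<open>(\<sigma> (Suc j))^2\<close>.\<close>

lemma net_props:
  assumes z: "z \<in> T"
  shows "finite (net j z l)" "real (card (net j z l)) \<le> 4 * exp (real l * 64 ^ Suc j)"
    "sq n (\<lambda>k. y k - z k) \<le> real l / J \<Longrightarrow> \<exists>\<xi>\<in>net j z l. cl j z (2 * \<sigma> (Suc j)) (\<lambda>k. y k - \<xi> k)"
proof -
  have "(\<Sum>e\<in>H j z. (N e z)\<^sup>2) \<le> (\<Sum>e\<in>E. (N e z)\<^sup>2)"
    using finE H_sub by (intro sum_mono2) auto
  also have "\<dots> \<le> 1" using z by (simp add: T_def)
  finally have a: "(\<Sum>e\<in>H j z. (N e z)\<^sup>2) \<le> 1" .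
  have r: "(real l / J) / (\<sigma> (Suc j))\<^sup>2 = real l * 64 ^ Suc j"
    unfolding \<sigma>_sq using J_pos by (simp add: field_simps)
  have "\<exists>A. finite A \<and> real (card A) \<le> 4 * exp (real l * 64 ^ Suc j) \<and>
    (\<forall>y. sq n (\<lambda>k. y k - z k) \<le> real l / J \<longrightarrow> (\<exists>\<xi>\<in>A. cl j z (2 * \<sigma> (Suc j)) (\<lambda>k. y k - \<xi> k)))"
    using close_net[OF \<sigma>_pos[of "Suc j"] H_sub a, of "real l / J" z] unfolding r cl_def .
  from someI_ex[OF this] show "finite (net j z l)" "real (card (net j z l)) \<le> 4 * exp (real l * 64 ^ Suc j)"
    "sq n (\<lambda>k. y k - z k) \<le> real l / J \<Longrightarrow> \<exists>\<xi>\<in>net j z l. cl j z (2 * \<sigma> (Suc j)) (\<lambda>k. y k - \<xi> k)"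
    unfolding net_def by blast+
qed

lemma T_dist: "x \<in> T \<Longrightarrow> z \<in> T \<Longrightarrow> sq n (\<lambda>k. x k - z k) \<le> 4"
  using sq_diff_le[of n x z] by (simp add: T_def)

text \<open>The radius \<open>l / J\<close> is as small as possible for a neighbour of \<open>x\<close> to lie in the ball
  around \<open>z\<close>; the net then provides \<open>\<xi>\<close> and the new centre is the projection of \<open>z\<close>.\<close>

lemma chain_step:
  assumes x: "x \<in> T" and z: "z \<in> T"
  shows "\<exists>l \<xi>. l \<in> {1..4 * J} \<and> \<xi> \<in> net j z l \<and>
    cl j z (8 * \<sigma> (Suc j)) (\<lambda>k. step j z \<xi> k - x k) \<and>
    sq n (\<lambda>k. x k - step j z \<xi> k) + sq n (\<lambda>k. step j z \<xi> k - z k) \<le> sq n (\<lambda>k. x k - z k) \<and>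
    (\<forall>y. cl j z (2 * \<sigma> (Suc j)) (\<lambda>k. y k - x k) \<longrightarrow> real l \<le> J * sq n (\<lambda>k. y k - z k) + 1)"
proof -
  define s where "s = \<sigma> (Suc j)"
  have s: "0 < s" by (simp add: s_def \<sigma>_pos)
  define P where "P = (\<lambda>l. 1 \<le> l \<and> (\<exists>y. cl j z (2 * s) (\<lambda>k. y k - x k) \<and> sq n (\<lambda>k. y k - z k) \<le> real l / J))"
  define l where "l = (LEAST l. P l)"
  have "cl j z (2 * s) (\<lambda>k. x k - x k)" using close_zero[OF H_sub] s by (simp add: cl_def)
  \<comment> \<open>\<open>x\<close> competes with itself, and points of \<open>T\<close> have
    squared distance at most \<open>4\<close>; hence \<open>l \<le> 4 * J\<close>.\<close>
  then have P0: "P (4 * J)"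
    using T_dist[OF x z] J_ge_1 J_pos unfolding P_def by (auto intro!: exI[of _ x])
  have l: "P l" unfolding l_def by (rule LeastI[of P, OF P0])
  have l_le: "l \<le> l'" if "P l'" for l' unfolding l_def by (rule Least_le[of P, OF that])
  obtain y where y: "cl j z (2 * s) (\<lambda>k. y k - x k)" "sq n (\<lambda>k. y k - z k) \<le> real l / J"
    using l by (auto simp: P_def)
  obtain \<xi> where \<xi>: "\<xi> \<in> net j z l" "cl j z (2 * s) (\<lambda>k. y k - \<xi> k)"
    using net_props(3)[OF z y(2)] by (auto simp: s_def)
  have "cl j z (2 * s + 2 * s) (\<lambda>k. (y k - \<xi> k) - (y k - x k))"
    using \<xi>(2) y(1) s unfolding cl_def by (intro close_diff[OF H_sub]) auto
  then have "cl j z (4 * s) (\<lambda>k. x k - \<xi> k)" by simp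
  then have xC: "x \<in> C j z \<xi>" using x by (simp add: C_def s_def)
  define z' where "z' = step j z \<xi>"
  have "cl j z (4 * s) (\<lambda>k. z' k - \<xi> k)" using step_props(1)[OF xC] by (simp add: C_def s_def z'_def)
  then have "cl j z (4 * s + 4 * s) (\<lambda>k. (z' k - \<xi> k) - (x k - \<xi> k))"
    using \<open>cl j z (4 * s) (\<lambda>k. x k - \<xi> k)\<close> s unfolding cl_def by (intro close_diff[OF H_sub]) auto
  then have c8: "cl j z (8 * s) (\<lambda>k. z' k - x k)" by simp
  have min: "real l \<le> J * sq n (\<lambda>k. y k - z k) + 1" if y: "cl j z (2 * s) (\<lambda>k. y k - x k)" for y
  proof -
    define r where "r = J * sq n (\<lambda>k. y k - z k)"
    have r: "0 \<le> r" by (simp add: r_def)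
    \<comment> \<open>Rounding up to an integer that is at least \<open>1\<close> is the source of
      the \<open>+ 1\<close>.\<close>
    define l' where "l' = (if r \<le> 1 then 1 else nat \<lceil>r\<rceil>)"
    have l': "r \<le> real l'" "real l' \<le> r + 1" "1 \<le> l'" using r unfolding l'_def by (auto; linarith)+
    have "sq n (\<lambda>k. y k - z k) \<le> real l' / J"
      using l'(1) J_pos by (simp add: r_def field_simps)
    then have "P l'" using y l'(3) by (auto simp: P_def)
    from l_le[OF this] show ?thesis using l'(2) by (simp add: r_def)
  qed
  show ?thesis
    using l P0 l_le[OF P0] \<xi>(1) c8 min step_props(2)[OF xC]
    by (intro exI[of _ l] exI[of _ \<xi>]) (auto simp: z'_def s_def P_def)
qed

text \<open>A node is a centre together with the cost of reaching it.  The costs satisfy the Kraft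
  inequality \<open>\<Sum> exp (- cost) \<le> 1\<close>, which pays for the union bound.\<close>

definition nxt :: "nat \<Rightarrow> ((nat \<Rightarrow> real) \<times> real) \<times> nat \<times> (nat \<Rightarrow> real) \<Rightarrow> (nat \<Rightarrow> real) \<times> real" where
  "nxt j = (\<lambda>(p, l, \<xi>). (step j (fst p) \<xi>, snd p + 2 * real l * 64 ^ Suc j + 2))"

fun nodes :: "nat \<Rightarrow> ((nat \<Rightarrow> real) \<times> real) set" where
  "nodes 0 = {(\<lambda>_. 0, 0)}"
| "nodes (Suc j) = nxt j ` (SIGMA p:nodes j. SIGMA l:{1..4 * J}. net j (fst p) l)"

definition edges :: "nat \<Rightarrow> (((nat \<Rightarrow> real) \<times> real) \<times> nat \<times> (nat \<Rightarrow> real)) set" where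
  "edges j = (SIGMA p:nodes j. SIGMA l:{1..4 * J}. net j (fst p) l)"

lemma nodes_T: "p \<in> nodes j \<Longrightarrow> fst p \<in> T \<and> 0 \<le> snd p"
  by (induction j arbitrary: p) (auto simp: T_zero nxt_def step_T)

lemma finite_nodes: "finite (nodes j)" and finite_edges: "finite (edges j)"
proof -
  show *: "finite (nodes j)" for j
    by (induction j) (auto intro!: finite_imageI finite_SigmaI net_props dest: nodes_T)
  show "finite (edges j)"
    unfolding edges_def using * nodes_T by (intro finite_SigmaI net_props) auto
qed

text \<open>Of the additional cost \<open>2 * l * 64 ^ Suc j + 2\<close>, one half of the first term
  pays for the exponential in the size of the net and \<open>2\<close> pays for its factor
  \<open>4\<close>. The other half is at least \<open>l\<close> and makes the sum over the radii
  converge.\<close>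

lemma edges_weight: "(\<Sum>i\<in>edges j. exp (- snd (nxt j i))) \<le> (\<Sum>p\<in>nodes j. exp (- snd p))"
proof -
  have fin: "finite (net j (fst p) l)" if "p \<in> nodes j" for p l
    using that nodes_T net_props(1) by blast
  have "(\<Sum>i\<in>edges j. exp (- snd (nxt j i)))
    = (\<Sum>p\<in>nodes j. \<Sum>i\<in>(SIGMA l:{1..4 * J}. net j (fst p) l). exp (- snd (nxt j (p, i))))"
    unfolding edges_def using finite_nodes fin by (subst sum.Sigma) (auto intro!: finite_SigmaI)
  also have "\<dots> = (\<Sum>p\<in>nodes j. \<Sum>l=1..4 * J. \<Sum>\<xi>\<in>net j (fst p) l. exp (- snd (nxt j (p, l, \<xi>))))"
    using fin by (intro sum.cong refl) (subst sum.Sigma, auto)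
  also have "\<dots> \<le> (\<Sum>p\<in>nodes j. exp (- snd p) * 1)"
  proof (rule sum_mono)
    fix p assume p: "p \<in> nodes j"
    have "(\<Sum>\<xi>\<in>net j (fst p) l. exp (- snd (nxt j (p, l, \<xi>)))) \<le> exp (- snd p) * exp (- real l)" for l
    proof -
      have "(\<Sum>\<xi>\<in>net j (fst p) l. exp (- snd (nxt j (p, l, \<xi>))))
        = real (card (net j (fst p) l)) * exp (- (snd p + 2 * real l * 64 ^ Suc j + 2))"
        by (simp add: nxt_def)
      also have "\<dots> \<le> 4 * exp (real l * 64 ^ Suc j) * exp (- (snd p + 2 * real l * 64 ^ Suc j + 2))"
        using net_props(2) nodes_T[OF p] by (intro mult_right_mono) auto
      also have "\<dots> = (4 * exp (- 2)) * (exp (- snd p) * exp (- (real l * 64 ^ Suc j)))"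
        by (simp add: exp_add[symmetric] algebra_simps)
      also have "\<dots> \<le> 1 * (exp (- snd p) * exp (- real l))"
      proof (intro mult_mono)
        have "2 ^ 2 \<le> exp (1::real) ^ 2" using exp_ge_add_one_self[of 1] by (intro power_mono) auto
        then show "4 * exp (- 2) \<le> (1::real)"
          using exp_of_nat_mult[of 2 "1::real"] by (simp add: exp_minus field_simps)
        have "real l * 1 \<le> real l * 64 ^ Suc j" by (intro mult_left_mono one_le_power) auto
        then show "exp (- (real l * 64 ^ Suc j)) \<le> exp (- real l)" by simp
      qed auto
      finally show ?thesis by simp
    qed
    then have "(\<Sum>l=1..4 * J. \<Sum>\<xi>\<in>net j (fst p) l. exp (- snd (nxt j (p, l, \<xi>)))) \<le> (\<Sum>l=1..4 * J. exp (- snd p) * exp (- real l))"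
      by (intro sum_mono)
    also have "\<dots> = exp (- snd p) * (\<Sum>l=1..4 * J. exp (- real l))" by (simp add: sum_distrib_left)
    also have "\<dots> \<le> exp (- snd p) * 1" by (intro mult_left_mono sum_exp_neg_le) auto
    finally show "(\<Sum>l=1..4 * J. \<Sum>\<xi>\<in>net j (fst p) l. exp (- snd (nxt j (p, l, \<xi>)))) \<le> exp (- snd p) * 1" .
  qed
  finally show ?thesis by simp
qed

lemma nodes_weight: "(\<Sum>p\<in>nodes j. exp (- snd p)) \<le> 1"
proof (induction j)
  case (Suc j)
  have "(\<Sum>p\<in>nodes (Suc j). exp (- snd p)) = (\<Sum>p\<in>nxt j ` edges j. exp (- snd p))"
    by (simp add: edges_def)
  also have "\<dots> \<le> (\<Sum>i\<in>edges j. exp (- snd (nxt j i)))"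
    by (rule sum_image_le[unfolded o_def]) (auto simp: finite_edges)
  also have "\<dots> \<le> 1" using edges_weight[of j] Suc by linarith
  finally show ?case .
qed simp

text \<open>The mesh \<open>1 / 64 ^ n\<close> is so fine that the rounding error can be summed over
  \<open>2 ^ n\<close> hyperedges without cancellation. The entropy, of order \<open>n^2\<close>, is
  affordable at the last scale only.\<close>

lemma grid_exists:
  "\<exists>G. finite G \<and> real (card G) \<le> exp (10 * real n ^ 2) \<and>
    (\<forall>x. sq n x \<le> 1 \<longrightarrow> (\<exists>x'\<in>G. sq n (\<lambda>k. x k - x' k) \<le> n / (64 ^ n)\<^sup>2))"
proof -
  define K :: int where "K = 64 ^ n"
  have K: "real_of_int K = 64 ^ n" "1 \<le> K" by (auto simp: K_def)
  define G where "G = (\<lambda>m k. real_of_int (m k) / 64 ^ n) ` (PiE {..<n} (\<lambda>_. {-K..K}))"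
  have fin: "finite (PiE {..<n} (\<lambda>_. {-K..K}))" by (intro finite_PiE) auto
  have "card G \<le> card (PiE {..<n} (\<lambda>_. {-K..K}))" unfolding G_def by (rule card_image_le[OF fin])
  also have "\<dots> = nat (2 * K + 1) ^ n" by (subst card_PiE) auto
  finally have "real (card G) \<le> real (nat (2 * K + 1) ^ n)" by (rule of_nat_mono)
  also have "\<dots> = (2 * 64 ^ n + 1) ^ n" using K by simp
  also have "\<dots> \<le> exp (6 * real n + 2) ^ n"
  proof (intro power_mono)
    have e2: "2 \<le> exp (1::real)" using exp_ge_add_one_self[of "1::real"] by simp
    have "(64::real) ^ n = 2 ^ (6 * n)" by (simp add: power_mult)
    also have "\<dots> \<le> exp 1 ^ (6 * n)" using e2 by (intro power_mono) auto
    also have "\<dots> = exp (6 * real n)" by (simp flip: exp_of_nat_mult)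
    finally have a: "(64::real) ^ n \<le> exp (6 * real n)" .
    have "2 ^ 2 \<le> exp (1::real) ^ 2" using e2 by (intro power_mono) auto
    also have "\<dots> = exp 2" by (simp flip: exp_of_nat_mult)
    finally have b: "4 \<le> exp (2::real)" by simp
    have "1 \<le> (64::real) ^ n" by simp
    then have "(2::real) * 64 ^ n + 1 \<le> 64 ^ n * 4" by linarith
    also have "\<dots> \<le> exp (6 * real n) * exp 2" using a b by (intro mult_mono) auto
    finally show "(2::real) * 64 ^ n + 1 \<le> exp (6 * real n + 2)" by (simp add: exp_add)
  qed auto
  also have "\<dots> = exp (real n * (6 * real n + 2))" by (simp flip: exp_of_nat_mult)
  also have "\<dots> \<le> exp (10 * real n ^ 2)" using n2 by (simp add: power2_eq_square algebra_simps)
  finally have card: "real (card G) \<le> exp (10 * real n ^ 2)" .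
  have "\<exists>x'\<in>G. sq n (\<lambda>k. x k - x' k) \<le> n / (64 ^ n)\<^sup>2" if x: "sq n x \<le> 1" for x
  proof -
    define m where "m = restrict (\<lambda>k. \<lfloor>x k * 64 ^ n\<rfloor>) {..<n}"
    have "\<lfloor>x k * 64 ^ n\<rfloor> \<in> {-K..K}" if "k < n" for k
    proof -
      have "(x k)\<^sup>2 \<le> sq n x" unfolding sq_def using that by (intro member_le_sum) auto
      then have "\<bar>x k\<bar> \<le> 1" using x by (simp add: abs_square_le_1[symmetric])
      then have "\<bar>x k * 64 ^ n\<bar> \<le> 64 ^ n" by (simp add: abs_mult)
      then have "\<bar>x k * 64 ^ n\<bar> \<le> real_of_int K" using K by simp
      then show ?thesis by (auto simp: le_floor_iff floor_le_iff)
    qed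
    then have "m \<in> PiE {..<n} (\<lambda>_. {-K..K})" by (auto simp: m_def)
    moreover have "sq n (\<lambda>k. x k - real_of_int (m k) / 64 ^ n) \<le> (\<Sum>k<n. 1 / (64 ^ n)\<^sup>2)"
      unfolding sq_def
    proof (rule sum_mono)
      fix k assume "k \<in> {..<n}"
      then have "x k - real_of_int (m k) / 64 ^ n = (x k * 64 ^ n - real_of_int \<lfloor>x k * 64 ^ n\<rfloor>) / 64 ^ n"
        by (simp add: m_def field_simps)
      also have "\<dots>\<^sup>2 \<le> 1 / (64 ^ n)\<^sup>2"
        unfolding power_divide by (intro divide_right_mono) (auto simp: abs_square_le_1 intro!: abs_leI; linarith)+
      finally show "(x k - real_of_int (m k) / 64 ^ n)\<^sup>2 \<le> 1 / (64 ^ n)\<^sup>2" .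
    qed
    ultimately show ?thesis unfolding G_def by (intro bexI[OF _ imageI]) auto
  qed
  then show ?thesis using card fin by (intro exI[of _ G]) (auto simp: G_def)
qed

end

section \<open>A single chain: total cost and total variance\<close>

locale chain = chaining +
  fixes x :: "nat \<Rightarrow> real" and z :: "nat \<Rightarrow> nat \<Rightarrow> real" and l :: "nat \<Rightarrow> nat" and q :: "nat \<Rightarrow> real"
  assumes xT: "x \<in> T" and z0: "z 0 = (\<lambda>_. 0)" and zT: "\<And>j. z j \<in> T"
    and near: "\<And>j. cl j (z j) (8 * \<sigma> (Suc j)) (\<lambda>k. z (Suc j) k - x k)"
    and fejer: "\<And>j. sq n (\<lambda>k. x k - z (Suc j) k) + sq n (\<lambda>k. z (Suc j) k - z j k) \<le> sq n (\<lambda>k. x k - z j k)"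
    and lmin: "\<And>j y. cl j (z j) (2 * \<sigma> (Suc j)) (\<lambda>k. y k - x k) \<Longrightarrow> real (l j) \<le> J * sq n (\<lambda>k. y k - z j k) + 1"
    and q0: "q 0 = 0" and qS: "\<And>j. q (Suc j) = q j + 2 * real (l j) * 64 ^ Suc j + 2"
begin

lemma near_N:
  assumes e: "e \<in> E"
  shows "N e (\<lambda>k. z j k - x k) \<le> \<rho> j"
proof (cases j)
  case 0
  have "(N e x)\<^sup>2 \<le> \<tau> * sq n x" by (rule N_le_norm[OF e])
  also have "\<dots> \<le> \<tau> * 1" using xT \<tau> by (intro mult_left_mono) (auto simp: T_def)
  also have "\<dots> \<le> (\<rho> 0)\<^sup>2" using R_ge by (simp add: \<rho>_sq)
  finally have "N e x \<le> \<rho> 0" using \<rho>_pos[of 0] by (auto intro: power2_le_imp_le)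
  then show ?thesis
    using N_minus_commute[OF e, of "\<lambda>_. 0" x] 0 by (simp add: z0)
next
  case (Suc i)
  then show ?thesis using near[of i] e by (auto simp: cl_def close_def \<rho>_def mult_ac)
qed

lemma N_close: "e \<in> E \<Longrightarrow> \<bar>N e (z j) - N e x\<bar> \<le> N e (\<lambda>k. z j k - x k)"
  using N_triangle[of e "z j" x] N_triangle[of e x "z j"] N_minus_commute[of e x "z j"] by linarith

lemma N_step: "e \<in> E \<Longrightarrow> \<bar>N e (z (Suc j)) - N e (z j)\<bar> \<le> N e (\<lambda>k. z (Suc j) k - x k) + N e (\<lambda>k. z j k - x k)"
  using N_close[of e j] N_close[of e "Suc j"] by linarith

text \<open>Between consecutive centres \<open>N e\<close> changes by at most
  \<open>\<rho> j + \<rho> j / 8\<close>. Above the threshold \<open>4 * \<rho> j\<close> this is a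
  fraction \<open>9 / 32\<close> of \<open>N e (z j)\<close>, so heaviness persists and the weights
  stay comparable.\<close>

lemma H_mono:
  assumes "e \<in> H j (z j)"
  shows "e \<in> H (Suc j) (z (Suc j))" "N e (z j) \<le> 2 * N e (z (Suc j))" "N e (z (Suc j)) \<le> 3 / 2 * N e (z j)"
proof -
  have e: "e \<in> E" and a: "4 * \<rho> j \<le> N e (z j)" using assms by (auto simp: H_def)
  have "\<bar>N e (z (Suc j)) - N e (z j)\<bar> \<le> \<rho> j / 8 + \<rho> j"
    using N_step[OF e, of j] near_N[OF e, of j] near_N[OF e, of "Suc j"] by (simp add: \<rho>_Suc)
  then show "e \<in> H (Suc j) (z (Suc j))" "N e (z j) \<le> 2 * N e (z (Suc j))" "N e (z (Suc j)) \<le> 3 / 2 * N e (z j)"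
    using a \<rho>_pos[of j] e unfolding H_def \<rho>_Suc mem_Collect_eq by ((intro conjI e)?; linarith)+
qed

text \<open>So \<open>z (j + 2)\<close> competes in the choice of \<open>l j\<close>.\<close>

lemma near_two: "cl j (z j) (2 * \<sigma> (Suc j)) (\<lambda>k. z (Suc (Suc j)) k - x k)"
proof -
  define v where "v = (\<lambda>k. z (Suc (Suc j)) k - x k)"
  \<comment> \<open>\<open>z (Suc j)\<close> is only \<open>8 * \<sigma> (Suc j)\<close> close to
    \<open>x\<close>, too far to compete. The next centre is eight times closer, but in the norm of
    \<open>z (Suc j)\<close>; by \<open>H_mono\<close> that norm is at least half the norm of
    \<open>z j\<close>.\<close>
  have "cl (Suc j) (z (Suc j)) (\<sigma> (Suc j)) v"
    using near[of "Suc j"] by (simp add: \<sigma>_Suc[of "Suc j"] v_def)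
  then have c: "\<forall>e\<in>E. N e v \<le> \<kappa>1 * \<sigma> (Suc j)"
    "(\<Sum>e\<in>H (Suc j) (z (Suc j)). (N e (z (Suc j)))\<^sup>2 * (N e v)\<^sup>2) \<le> (\<kappa>2 * \<sigma> (Suc j))\<^sup>2"
    by (auto simp: cl_def close_def)
  have "(\<Sum>e\<in>H j (z j). (N e (z j))\<^sup>2 * (N e v)\<^sup>2) \<le> (\<Sum>e\<in>H j (z j). 4 * ((N e (z (Suc j)))\<^sup>2 * (N e v)\<^sup>2))"
  proof (rule sum_mono)
    fix e assume e: "e \<in> H j (z j)"
    have "(N e (z j))\<^sup>2 \<le> (2 * N e (z (Suc j)))\<^sup>2"
      using H_mono(2)[OF e] N_nonneg[of e] e by (intro power_mono) (auto simp: H_def)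
    then show "(N e (z j))\<^sup>2 * (N e v)\<^sup>2 \<le> 4 * ((N e (z (Suc j)))\<^sup>2 * (N e v)\<^sup>2)"
      by (simp add: power_mult_distrib mult_right_mono flip: mult.assoc)
  qed
  also have "\<dots> \<le> (\<Sum>e\<in>H (Suc j) (z (Suc j)). 4 * ((N e (z (Suc j)))\<^sup>2 * (N e v)\<^sup>2))"
    using H_mono(1) finite_subset[OF H_sub finE] by (intro sum_mono2) auto
  also have "\<dots> \<le> (\<kappa>2 * (2 * \<sigma> (Suc j)))\<^sup>2"
    using c(2) by (simp add: power_mult_distrib flip: sum_distrib_left)
  finally show ?thesis
    using c(1) \<kappa>_pos \<sigma>_pos[of "Suc j"] unfolding cl_def close_def v_def by (smt (verit) mult_left_mono)
qed

definition D2 :: "nat \<Rightarrow> real" where "D2 j = sq n (\<lambda>k. z (Suc j) k - z j k)"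

lemma D2_sum: "(\<Sum>j<m. D2 j) \<le> 1"
proof -
  have "(\<Sum>j<m. D2 j) + sq n (\<lambda>k. x k - z m k) \<le> sq n x"
  proof (induction m)
    case (Suc m)
    then show ?case using fejer[of m] by (simp add: D2_def)
  qed (simp add: z0)
  moreover have "0 \<le> sq n (\<lambda>k. x k - z m k)" "sq n x \<le> 1" using xT by (auto simp: T_def)
  ultimately show ?thesis by linarith
qed

lemma l_le: "real (l j) \<le> 2 * real J * (D2 (Suc j) + D2 j) + 1"
proof -
  have "sq n (\<lambda>k. (z (Suc (Suc j)) k - z (Suc j) k) - (z j k - z (Suc j) k)) \<le> 2 * D2 (Suc j) + 2 * sq n (\<lambda>k. z j k - z (Suc j) k)"
    unfolding D2_def by (rule sq_diff_le)
  also have "sq n (\<lambda>k. z j k - z (Suc j) k) = D2 j"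
    by (simp add: D2_def sq_def power2_commute)
  finally have "J * sq n (\<lambda>k. z (Suc (Suc j)) k - z j k) \<le> J * (2 * D2 (Suc j) + 2 * D2 j)"
    by (intro mult_left_mono) auto
  then show ?thesis using lmin[OF near_two[of j]] by (simp add: algebra_simps)
qed

text \<open>The saving over Dudley's bound: each radius alone can be of order \<open>J\<close>, but
  because the squared steps sum to at most \<open>1\<close>, all \<open>J\<close> radii together are
  still of order \<open>J\<close>.\<close>

lemma l_sum: "(\<Sum>j<J. real (l j)) \<le> 5 * J"
proof -
  have "(\<Sum>j<J. real (l j)) \<le> (\<Sum>j<J. 2 * real J * (D2 (Suc j) + D2 j) + 1)"
    by (intro sum_mono l_le)
  also have "\<dots> = 2 * real J * ((\<Sum>j<J. D2 (Suc j)) + (\<Sum>j<J. D2 j)) + real J"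
    by (simp add: sum.distrib sum_distrib_left algebra_simps)
  also have "\<dots> \<le> 2 * real J * (1 + 1) + real J"
  proof (intro add_right_mono mult_left_mono add_mono D2_sum)
    have "(\<Sum>j<J. D2 (Suc j)) \<le> (\<Sum>j<Suc J. D2 j)"
      by (subst sum.lessThan_Suc_shift) (simp add: D2_def)
    then show "(\<Sum>j<J. D2 (Suc j)) \<le> 1" using D2_sum[of "Suc J"] by linarith
  qed auto
  finally show ?thesis by simp
qed

lemma q_nonneg: "0 \<le> q j"
  by (induction j) (auto simp: q0 qS)

text \<open>\<open>q\<close> accumulates the costs of all earlier scales, but dividing by
  \<open>64 ^ j\<close> damps the old ones geometrically. The extra term is a potential that absorbs
  them in the induction: \<open>(1 + 1 / 63) / 64 = 1 / 63\<close>.\<close>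

lemma q_sum: "(\<Sum>j<J. q (Suc j) / 64 ^ Suc j) + q J / 64 ^ J / 63 \<le> 13 * J"
proof -
  have "(\<Sum>j<m. q (Suc j) / 64 ^ Suc j) + q m / 64 ^ m / 63 \<le> 64 / 63 * (\<Sum>j<m. 2 * real (l j) + 2)" for m
  proof (induction m)
    case (Suc m)
    define A where "A = q m / 64 ^ m"
    have "q (Suc m) / 64 ^ Suc m = A / 64 + 2 * real (l m) + 2 / 64 ^ Suc m"
      by (simp add: A_def qS field_simps)
    moreover have "2 / 64 ^ Suc m \<le> (2 / 1 :: real)" by (intro divide_left_mono one_le_power) auto
    ultimately have "q (Suc m) / 64 ^ Suc m \<le> A / 64 + 2 * real (l m) + 2" by linarith
    then show ?case using Suc by (simp add: A_def algebra_simps)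
  qed (simp add: q0)
  from this[of J] have "(\<Sum>j<J. q (Suc j) / 64 ^ Suc j) + q J / 64 ^ J / 63 \<le> 64 / 63 * (\<Sum>j<J. 2 * real (l j) + 2)" .
  also have "(\<Sum>j<J. 2 * real (l j) + 2) \<le> 12 * J"
    using l_sum by (simp add: sum.distrib flip: sum_distrib_left)
  finally show ?thesis using J_pos by simp
qed

lemma q_end: "q J \<le> 819 * J * 64 ^ J"
proof -
  have "0 \<le> (\<Sum>j<J. q (Suc j) / 64 ^ Suc j)" by (intro sum_nonneg divide_nonneg_nonneg q_nonneg) auto
  then have "q J / 64 ^ J \<le> 819 * J" using q_sum by simp
  then show ?thesis by (simp add: field_simps)
qed

lemma cost_sum: "(\<Sum>j<J. (q (Suc j) + j + 3) / 64 ^ j) \<le> 835 * J"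
proof -
  have "(q (Suc j) + j + 3) / 64 ^ j \<le> 64 * (q (Suc j) / 64 ^ Suc j) + 3" for j
  proof -
    have "real j + 3 \<le> 3 * 64 ^ j" by (induction j) auto
    then have "(real j + 3) / 64 ^ j \<le> 3" by (simp add: divide_le_eq)
    then show ?thesis by (simp add: add_divide_distrib)
  qed
  then have "(\<Sum>j<J. (q (Suc j) + j + 3) / 64 ^ j) \<le> (\<Sum>j<J. 64 * (q (Suc j) / 64 ^ Suc j) + 3)"
    by (intro sum_mono)
  also have "\<dots> = 64 * (\<Sum>j<J. q (Suc j) / 64 ^ Suc j) + 3 * J"
    by (simp add: sum.distrib sum_distrib_left)
  also have "(\<Sum>j<J. q (Suc j) / 64 ^ Suc j) \<le> 13 * J"
    using q_sum divide_nonneg_nonneg[OF divide_nonneg_nonneg[OF q_nonneg[of J], of "64 ^ J"], of 63] by simp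
  finally show ?thesis by simp
qed

text \<open>A hyperedge that becomes heavy at scale \<open>j\<close> has \<open>N e x\<close> of order \<open>\<rho> j\<close>, and this
  happens at no more than two scales.\<close>

definition win :: "nat \<Rightarrow> 'b \<Rightarrow> real" where
  "win j e = (if 3 * \<rho> j \<le> N e x \<and> N e x < 40 * \<rho> j then (N e x)\<^sup>2 else 0)"

lemma win_nonneg: "0 \<le> win j e" by (simp add: win_def)

lemma \<rho>_add: "\<rho> (i + j) = \<rho> i / 8 ^ j"
  by (induction j) (auto simp: \<rho>_Suc)

lemma win_sum: "(\<Sum>j<m. win j e) \<le> 2 * (N e x)\<^sup>2"
proof -
  define K where "K = {j. j < m \<and> 3 * \<rho> j \<le> N e x \<and> N e x < 40 * \<rho> j}"
  have fin: "finite K" by (simp add: K_def)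
  \<comment> \<open>Two scales apart, the upper limit
    \<open>40 * \<rho> j \<le> 40 / 64 * \<rho> i\<close> lies below the lower limit
    \<open>3 * \<rho> i\<close>.\<close>
  have gap: "j \<le> Suc i" if "i \<in> K" "j \<in> K" for i j
  proof (rule ccontr)
    assume "\<not> j \<le> Suc i"
    then obtain d where d: "j = i + (2 + d)" by (metis add_2_eq_Suc le_add_diff_inverse not_less_eq_eq add.assoc add.commute)
    have "\<rho> j \<le> \<rho> i / 64"
      using \<rho>_pos[of i] one_le_power[of "8::real" d] unfolding d \<rho>_add by (simp add: power_add field_simps)
    then show False using that \<rho>_pos[of i] by (auto simp: K_def)
  qed
  have "card K \<le> 2"
  proof (cases "K = {}")
    case False
    then have "Min K \<in> K" using fin by simp
    then have "K \<subseteq> {Min K, Suc (Min K)}"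
      using gap fin by (force simp: le_Suc_eq dest: Min_le)
    then have "card K \<le> card {Min K, Suc (Min K)}" by (intro card_mono) auto
    then show ?thesis by simp
  qed simp
  have "(\<Sum>j<m. win j e) = (\<Sum>j\<in>K. (N e x)\<^sup>2)"
    unfolding K_def win_def by (subst sum.inter_filter[symmetric]) (auto intro: sum.cong)
  also have "\<dots> = card K * (N e x)\<^sup>2" by simp
  also have "\<dots> \<le> 2 * (N e x)\<^sup>2" using \<open>card K \<le> 2\<close> by (intro mult_right_mono) auto
  finally show ?thesis .
qed

definition W :: "nat \<Rightarrow> real" where "W j = (\<Sum>e\<in>E. win j e)"

lemma W_sum: "(\<Sum>j<m. W j) \<le> 2"
proof -
  have "(\<Sum>j<m. W j) = (\<Sum>e\<in>E. \<Sum>j<m. win j e)" unfolding W_def by (rule sum.swap)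
  also have "\<dots> \<le> (\<Sum>e\<in>E. 2 * (N e x)\<^sup>2)" by (intro sum_mono win_sum)
  also have "\<dots> \<le> 2" using xT by (simp add: T_def flip: sum_distrib_left)
  finally show ?thesis .
qed

lemma W_nonneg: "0 \<le> W j" by (simp add: W_def sum_nonneg win_nonneg)

text \<open>\<open>near\<close> measures the distance from \<open>z j\<close> to \<open>x\<close>
  with the weights of the previous centre, here the weights of \<open>z j\<close> itself are needed.
  Hyperedges that were already heavy have weights at most twice as large, whence
  \<open>256 = 4 * 8^2\<close>; the newly heavy ones are charged to \<open>win\<close>.\<close>

lemma heavy_old:
  "(\<Sum>e\<in>H j (z j). (N e (z j))\<^sup>2 * (N e (\<lambda>k. z j k - x k))\<^sup>2) \<le> 256 * (\<kappa>2 * \<sigma> j)\<^sup>2 + 2 * (\<rho> j)\<^sup>2 * W j"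
proof (cases j)
  case 0
  have "H 0 (z 0) = {}" using \<rho>_pos[of 0] by (auto simp: H_def z0 N_zero)
  then show ?thesis using W_nonneg[of j] 0 by simp
next
  case (Suc i)
  define d where "d = (\<lambda>e. N e (\<lambda>k. z j k - x k))"
  define G where "G = H i (z i)"
  have "(N e (z j))\<^sup>2 * (d e)\<^sup>2 \<le> (if e \<in> G then 4 * ((N e (z i))\<^sup>2 * (d e)\<^sup>2) else 0) + 2 * (\<rho> j)\<^sup>2 * win j e" if e: "e \<in> H j (z j)" for e
  proof (cases "e \<in> G")
    case True
    have "(N e (z j))\<^sup>2 \<le> (2 * N e (z i))\<^sup>2"
    proof (intro power_mono N_nonneg)
      show "e \<in> E" using e H_sub by auto
      then show "N e (z j) \<le> 2 * N e (z i)"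
        using H_mono(3)[of e i] True N_nonneg[of e "z i"] unfolding Suc G_def by linarith
    qed
    then have "(N e (z j))\<^sup>2 * (d e)\<^sup>2 \<le> 4 * ((N e (z i))\<^sup>2 * (d e)\<^sup>2)"
      by (simp add: power_mult_distrib mult_right_mono flip: mult.assoc)
    moreover have "0 \<le> 2 * (\<rho> j)\<^sup>2 * win j e" using win_nonneg[of j e] by simp
    ultimately show ?thesis using True by simp
  next
    case False
    have eE: "e \<in> E" using e H_sub by auto
    have 1: "4 * \<rho> j \<le> N e (z j)" using e by (simp add: H_def)
    have 2: "N e (z i) < 4 * \<rho> i" using False eE by (simp add: G_def H_def)
    have r: "\<rho> i = 8 * \<rho> j" by (simp add: Suc \<rho>_Suc)
    have d: "0 \<le> d e" "d e \<le> \<rho> j" using near_N[OF eE, of j] N_nonneg[OF eE] by (auto simp: d_def)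
    have 3: "\<bar>N e (z j) - N e x\<bar> \<le> \<rho> j" "\<bar>N e (z i) - N e x\<bar> \<le> \<rho> i"
      using N_close[OF eE] near_N[OF eE] order_trans by blast+
    have u: "3 * \<rho> j \<le> N e x" "N e x < 40 * \<rho> j" using 1 2 3 unfolding r by linarith+
    have "N e (z j) \<le> 4 / 3 * N e x" using 3 u by linarith
    then have "(N e (z j))\<^sup>2 \<le> (4 / 3 * N e x)\<^sup>2" using N_nonneg[OF eE] by (intro power_mono) auto
    also have "\<dots> \<le> 2 * (N e x)\<^sup>2" by (simp add: power_mult_distrib power_divide)
    finally have "(N e (z j))\<^sup>2 * (d e)\<^sup>2 \<le> 2 * (N e x)\<^sup>2 * (\<rho> j)\<^sup>2"
      using d by (intro mult_mono power_mono) auto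
    then show ?thesis using False u by (simp add: win_def mult_ac)
  qed
  then have "(\<Sum>e\<in>H j (z j). (N e (z j))\<^sup>2 * (d e)\<^sup>2)
    \<le> (\<Sum>e\<in>H j (z j). (if e \<in> G then 4 * ((N e (z i))\<^sup>2 * (d e)\<^sup>2) else 0) + 2 * (\<rho> j)\<^sup>2 * win j e)"
    by (intro sum_mono)
  also have "\<dots> \<le> (\<Sum>e\<in>E. (if e \<in> G then 4 * ((N e (z i))\<^sup>2 * (d e)\<^sup>2) else 0) + 2 * (\<rho> j)\<^sup>2 * win j e)"
    using H_sub finE by (intro sum_mono2) (auto intro!: add_nonneg_nonneg mult_nonneg_nonneg win_nonneg)
  also have "\<dots> = (\<Sum>e\<in>G. 4 * ((N e (z i))\<^sup>2 * (d e)\<^sup>2)) + 2 * (\<rho> j)\<^sup>2 * W j"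
  proof -
    have "E \<inter> G = G" using H_sub by (auto simp: G_def)
    then show ?thesis
      using finE by (simp add: sum.distrib W_def sum_distrib_left flip: sum.inter_restrict)
  qed
  also have "(\<Sum>e\<in>G. 4 * ((N e (z i))\<^sup>2 * (d e)\<^sup>2)) \<le> 4 * (\<kappa>2 * (8 * \<sigma> j))\<^sup>2"
    using near[of i] by (simp add: cl_def close_def G_def d_def Suc flip: sum_distrib_left)
  finally show ?thesis by (simp add: d_def power_mult_distrib)
qed

text \<open>By \<open>H_mono\<close> no heavy hyperedge becomes light again, so three cases remain.
  Heavy twice: a difference of squares with sum at most \<open>5 / 2 * N e (z j)\<close>. Newly
  heavy: the whole energy enters, and \<open>6400 = 4 * 40^2\<close>. Light twice: nothing
  changes.\<close>

lemma incr_sq: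
  assumes e: "e \<in> E"
  defines "d \<equiv> \<lambda>j. N e (\<lambda>k. z j k - x k)"
  shows "(h (Suc j) (z (Suc j)) e - h j (z j) e)\<^sup>2
    \<le> (if e \<in> H j (z j) then 14 * ((N e (z j))\<^sup>2 * (d (Suc j))\<^sup>2 + (N e (z j))\<^sup>2 * (d j)\<^sup>2) else 0) + 6400 * (\<rho> (Suc j))\<^sup>2 * win (Suc j) e"
proof -
  define a where "a = N e (z j)"
  define b where "b = N e (z (Suc j))"
  define u where "u = N e x"
  have nn: "0 \<le> a" "0 \<le> b" "0 \<le> u" "0 \<le> d j" "0 \<le> d (Suc j)" using N_nonneg[OF e] by (auto simp: a_def b_def u_def d_def)
  have w: "0 \<le> 6400 * (\<rho> (Suc j))\<^sup>2 * win (Suc j) e" using win_nonneg[of "Suc j" e] by simp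
  have r: "\<rho> j = 8 * \<rho> (Suc j)" "0 < \<rho> (Suc j)" using \<rho>_pos by (auto simp: \<rho>_Suc)
  have dj: "d j \<le> \<rho> j" "d (Suc j) \<le> \<rho> (Suc j)" using near_N[OF e] by (auto simp: d_def)
  have cl: "\<bar>a - u\<bar> \<le> d j" "\<bar>b - u\<bar> \<le> d (Suc j)" using N_close[OF e] by (auto simp: a_def b_def u_def d_def)
  show ?thesis
  proof (cases "e \<in> H j (z j)")
    case True
    have b32: "b \<le> 3 / 2 * a" using H_mono(3)[OF True] by (simp add: a_def b_def)
    have "b\<^sup>2 - a\<^sup>2 = (b - a) * (b + a)" by (simp add: power2_eq_square algebra_simps)
    then have "\<bar>b\<^sup>2 - a\<^sup>2\<bar> = \<bar>b - a\<bar> * (b + a)" using nn by (simp add: abs_mult)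
    also have "\<dots> \<le> (d (Suc j) + d j) * (5 / 2 * a)"
    proof (rule mult_mono)
      show "\<bar>b - a\<bar> \<le> d (Suc j) + d j" using cl by linarith
    qed (use nn b32 in linarith)+
    finally have "(b\<^sup>2 - a\<^sup>2)\<^sup>2 \<le> ((d (Suc j) + d j) * (5 / 2 * a))\<^sup>2"
      by (metis abs_ge_zero power2_abs power_mono)
    also have "\<dots> = 25 / 4 * a\<^sup>2 * (d (Suc j) + d j)\<^sup>2" by (simp add: power2_eq_square)
    also have "\<dots> \<le> 25 / 4 * a\<^sup>2 * (2 * (d (Suc j))\<^sup>2 + 2 * (d j)\<^sup>2)"
    proof (rule mult_left_mono)
      have "0 \<le> (d (Suc j) - d j)\<^sup>2" by simp
      then show "(d (Suc j) + d j)\<^sup>2 \<le> 2 * (d (Suc j))\<^sup>2 + 2 * (d j)\<^sup>2" by (simp add: power2_eq_square algebra_simps)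
    qed auto
    also have "\<dots> \<le> 14 * (a\<^sup>2 * (d (Suc j))\<^sup>2 + a\<^sup>2 * (d j)\<^sup>2)"
    proof -
      have "25 / 4 * a\<^sup>2 * (2 * (d (Suc j))\<^sup>2 + 2 * (d j)\<^sup>2) = 25 / 2 * (a\<^sup>2 * (d (Suc j))\<^sup>2 + a\<^sup>2 * (d j)\<^sup>2)"
        by (simp add: algebra_simps)
      also have "\<dots> \<le> 14 * (a\<^sup>2 * (d (Suc j))\<^sup>2 + a\<^sup>2 * (d j)\<^sup>2)"
        by (intro mult_right_mono) auto
      finally show ?thesis .
    qed
    finally show ?thesis using True H_mono(1)[OF True] w by (simp add: h_def a_def b_def)
  next
    case False
    show ?thesis
    proof (cases "e \<in> H (Suc j) (z (Suc j))")
      case True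
      have 1: "4 * \<rho> (Suc j) \<le> b" using True by (simp add: H_def b_def)
      have 2: "a < 4 * \<rho> j" using False e by (simp add: H_def a_def)
      have u: "3 * \<rho> (Suc j) \<le> u" "u < 40 * \<rho> (Suc j)" using 1 2 cl dj unfolding r(1) by linarith+
      have "b \<le> 4 / 3 * u" using cl dj u by linarith
      then have b2: "b\<^sup>2 \<le> (4 / 3 * u)\<^sup>2" using nn by (intro power_mono) auto
      have u2: "u\<^sup>2 \<le> (40 * \<rho> (Suc j))\<^sup>2" using u nn by (intro power_mono) auto
      have "(b\<^sup>2)\<^sup>2 \<le> ((4 / 3 * u)\<^sup>2)\<^sup>2" by (rule power_mono[OF b2]) simp
      also have "\<dots> = 256 / 81 * (u\<^sup>2 * u\<^sup>2)" by (simp add: power_mult_distrib power_divide power2_eq_square)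
      also have "\<dots> \<le> 4 * ((40 * \<rho> (Suc j))\<^sup>2 * u\<^sup>2)"
        using u2 by (intro mult_mono) auto
      finally have "(b\<^sup>2)\<^sup>2 \<le> 6400 * (\<rho> (Suc j))\<^sup>2 * u\<^sup>2" by (simp add: power_mult_distrib)
      then show ?thesis using True False u by (simp add: h_def b_def u_def win_def)
    next
      case nH: False
      then show ?thesis using False w by (simp add: h_def)
    qed
  qed
qed

definition V :: "nat \<Rightarrow> real" where
  "V j = (\<Sum>e\<in>E. (h (Suc j) (z (Suc j)) e - h j (z j) e)\<^sup>2)"

lemma V_nonneg: "0 \<le> V j" by (simp add: V_def sum_nonneg)

text \<open>The factor \<open>64 ^ j\<close> cancels the decay of the squared scale. The first term
  then adds up to a multiple of \<open>\<kappa>2^2\<close> over the \<open>J\<close> scales, and the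
  others are summable by \<open>W_sum\<close>. The constants are
  \<open>3598 = 14 * (1 + 256)\<close>, \<open>28 = 14 * 2\<close> and
  \<open>100 = 6400 / 64\<close>.\<close>

lemma V_le: "64 ^ j * V j \<le> 3600 * \<kappa>2\<^sup>2 / J + 28 * R * W j + 100 * R * W (Suc j)"
proof -
  define d where "d = (\<lambda>j e. N e (\<lambda>k. z j k - x k))"
  have "V j \<le> (\<Sum>e\<in>E. (if e \<in> H j (z j) then 14 * ((N e (z j))\<^sup>2 * (d (Suc j) e)\<^sup>2 + (N e (z j))\<^sup>2 * (d j e)\<^sup>2) else 0) + 6400 * (\<rho> (Suc j))\<^sup>2 * win (Suc j) e)"
    unfolding V_def d_def by (intro sum_mono incr_sq)
  also have "\<dots> = 14 * ((\<Sum>e\<in>H j (z j). (N e (z j))\<^sup>2 * (d (Suc j) e)\<^sup>2) + (\<Sum>e\<in>H j (z j). (N e (z j))\<^sup>2 * (d j e)\<^sup>2)) + 6400 * (\<rho> (Suc j))\<^sup>2 * W (Suc j)"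
  proof -
    have "E \<inter> H j (z j) = H j (z j)" using H_sub by auto
    then show ?thesis
      using finE by (simp add: sum.distrib W_def sum_distrib_left flip: sum.inter_restrict)
  qed
  also have "\<dots> \<le> 14 * ((\<kappa>2 * (8 * \<sigma> (Suc j)))\<^sup>2 + (256 * (\<kappa>2 * \<sigma> j)\<^sup>2 + 2 * (\<rho> j)\<^sup>2 * W j)) + 6400 * (\<rho> (Suc j))\<^sup>2 * W (Suc j)"
    using near[of j] heavy_old[of j] unfolding d_def cl_def close_def
    by (intro add_right_mono mult_left_mono add_mono) auto
  also have "\<dots> = 3598 * \<kappa>2\<^sup>2 * (\<sigma> j)\<^sup>2 + 28 * (\<rho> j)\<^sup>2 * W j + 100 * (\<rho> j)\<^sup>2 * W (Suc j)"
    by (simp add: \<sigma>_Suc \<rho>_Suc power_mult_distrib power_divide algebra_simps)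
  finally have "64 ^ j * V j \<le> 64 ^ j * (3598 * \<kappa>2\<^sup>2 * (\<sigma> j)\<^sup>2 + 28 * (\<rho> j)\<^sup>2 * W j + 100 * (\<rho> j)\<^sup>2 * W (Suc j))"
    by (intro mult_left_mono) auto
  also have "\<dots> = 3598 * \<kappa>2\<^sup>2 / J + 28 * R * W j + 100 * R * W (Suc j)"
    unfolding \<sigma>_sq \<rho>_sq by (simp add: field_simps)
  also have "\<dots> \<le> 3600 * \<kappa>2\<^sup>2 / J + 28 * R * W j + 100 * R * W (Suc j)"
    by (intro add_right_mono divide_right_mono mult_right_mono) auto
  finally show ?thesis .
qed

lemma \<tau>_le_ln: "\<tau> \<le> 2 * (\<tau> * ln D)"
proof -
  have "ln 2 \<le> ln D" using D by simp
  then have "1 \<le> 2 * ln D" using half_le_ln2 by linarith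
  then have "\<tau> * 1 \<le> \<tau> * (2 * ln D)" using \<tau> by (intro mult_left_mono) auto
  then show ?thesis by simp
qed

lemma V_sum: "(\<Sum>j<J. 64 ^ j * V j) \<le> 5000000 * (\<tau> * ln D)"
proof -
  have R0: "0 \<le> R" using R_ge \<tau> by linarith
  have "(\<Sum>j<J. 64 ^ j * V j) \<le> (\<Sum>j<J. 3600 * \<kappa>2\<^sup>2 / J + 28 * R * W j + 100 * R * W (Suc j))"
    by (intro sum_mono V_le)
  also have "\<dots> = 3600 * \<kappa>2\<^sup>2 + 28 * R * (\<Sum>j<J. W j) + 100 * R * (\<Sum>j<J. W (Suc j))"
    using J_pos by (simp add: sum.distrib sum_distrib_left)
  also have "\<dots> \<le> 3600 * \<kappa>2\<^sup>2 + 28 * R * 2 + 100 * R * 2"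
  proof (intro add_mono mult_left_mono W_sum order_refl)
    have "(\<Sum>j<J. W (Suc j)) \<le> (\<Sum>j<Suc J. W j)"
      by (subst sum.lessThan_Suc_shift) (simp add: W_nonneg)
    then show "(\<Sum>j<J. W (Suc j)) \<le> 2" using W_sum[of "Suc J"] by linarith
  qed (use R0 in auto)
  also have "\<dots> \<le> 3600 * \<kappa>2\<^sup>2 + 256 * (5120 * (2 * (\<tau> * ln D)))"
    using R_le \<tau>_le_ln by linarith
  also have "\<dots> \<le> 5000000 * (\<tau> * ln D)"
  proof -
    have "0 \<le> \<tau> * ln D" using \<tau> D by simp
    then show ?thesis by (simp add: \<kappa>_sq)
  qed
  finally show ?thesis .
qed

text \<open>Cauchy-Schwarz with the weights \<open>64 ^ j\<close>: the damped costs sum to order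
  \<open>J\<close>, the amplified variances to order \<open>\<tau> * ln D\<close>.\<close>

lemma chain_total:
  "(\<Sum>j<J. 4 * sqrt ((q (Suc j) + j + 3) * V j)) \<le> 260000 * sqrt (J * (\<tau> * ln D))"
proof -
  define c where "c = (\<lambda>j. q (Suc j) + real j + 3)"
  have c0: "0 \<le> c j" for j using q_nonneg[of "Suc j"] by (simp add: c_def)
  have "(\<Sum>j<J. sqrt (c j * V j)) = (\<Sum>j<J. sqrt (c j / 64 ^ j) * sqrt (64 ^ j * V j))"
    by (simp flip: real_sqrt_mult)
  also have "\<dots> \<le> sqrt ((\<Sum>j<J. (sqrt (c j / 64 ^ j))\<^sup>2) * (\<Sum>j<J. (sqrt (64 ^ j * V j))\<^sup>2))"
    by (intro real_le_rsqrt Cauchy_Schwarz_ineq_sum)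
  also have "\<dots> = sqrt ((\<Sum>j<J. c j / 64 ^ j) * (\<Sum>j<J. 64 ^ j * V j))"
    using c0 V_nonneg by simp
  also have "\<dots> \<le> sqrt ((835 * J) * (5000000 * (\<tau> * ln D)))"
    using cost_sum V_sum V_nonneg unfolding c_def
    by (intro real_sqrt_le_mono mult_mono) (auto intro!: sum_nonneg)
  also have "\<dots> \<le> sqrt (65000\<^sup>2 * (J * (\<tau> * ln D)))"
  proof (rule real_sqrt_le_mono)
    have "0 \<le> J * (\<tau> * ln D)" using \<tau> D by simp
    then show "(835 * J) * (5000000 * (\<tau> * ln D)) \<le> 65000\<^sup>2 * (J * (\<tau> * ln D))" by (simp add: mult_ac)
  qed
  also have "\<dots> = 65000 * sqrt (J * (\<tau> * ln D))" by (simp add: real_sqrt_mult)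
  finally show ?thesis by (simp add: c_def flip: sum_distrib_left)
qed

end

section \<open>From the last centre through a grid point to the point itself\<close>

context chain
begin

context
  fixes x' :: "nat \<Rightarrow> real"
  assumes x': "sq n (\<lambda>k. x k - x' k) \<le> n / (64 ^ n)\<^sup>2"
begin

definition dx :: "'b \<Rightarrow> real" where "dx e = N e (\<lambda>k. x k - x' k)"

lemma dx_sq: "e \<in> E \<Longrightarrow> (dx e)\<^sup>2 \<le> \<tau> * (n / (64 ^ n)\<^sup>2)"
  using N_le_norm[of e "\<lambda>k. x k - x' k"] mult_left_mono[OF x', of \<tau>] \<tau> by (simp add: dx_def)

lemma dx_nonneg: "e \<in> E \<Longrightarrow> 0 \<le> dx e" by (simp add: dx_def N_nonneg)

lemma n_le_pow: "real n \<le> 2 ^ n"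
  using of_nat_mono[OF less_imp_le[OF less_exp[of n]], where 'a = real] by simp

lemma dx_le_\<rho>: "e \<in> E \<Longrightarrow> dx e \<le> \<rho> J"
proof (rule power2_le_imp_le)
  assume e: "e \<in> E"
  have "real n \<le> 64 ^ n" using n_le_pow power_mono[of 2 "64::real" n] by simp
  then have "real n / (64 ^ n)\<^sup>2 \<le> 1 / 64 ^ n" by (simp add: power2_eq_square field_simps)
  also have "\<dots> \<le> 1 / 64 ^ J" using J_le_n by (intro divide_left_mono power_increasing) auto
  finally have "\<tau> * (n / (64 ^ n)\<^sup>2) \<le> R * (1 / 64 ^ J)"
    using R_ge \<tau> by (intro mult_mono) auto
  then show "(dx e)\<^sup>2 \<le> (\<rho> J)\<^sup>2" using dx_sq[OF e] by (simp add: \<rho>_sq)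
qed (use \<rho>_pos[of J] in auto)

text \<open>The mesh beats the number of hyperedges: \<open>2 ^ n * 2 ^ n\<close> against
  \<open>64 ^ n * 64 ^ n\<close>.\<close>

lemma dx_sum: "(\<Sum>e\<in>E. (dx e)\<^sup>2) \<le> \<tau>"
proof -
  have "(\<Sum>e\<in>E. (dx e)\<^sup>2) \<le> card E * (\<tau> * (n / (64 ^ n)\<^sup>2))"
    using sum_mono[of E "\<lambda>e. (dx e)\<^sup>2", OF dx_sq] by simp
  also have "\<dots> \<le> 2 ^ n * (\<tau> * (2 ^ n / (64 ^ n)\<^sup>2))"
    using of_nat_mono[OF cardE, where 'a = real] n_le_pow \<tau>
    by (intro mult_mono mult_left_mono divide_right_mono) auto
  also have "\<dots> = \<tau> * ((2 ^ n * 2 ^ n) / (64 ^ n * 64 ^ n))" by (simp add: power2_eq_square)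
  also have "\<dots> = \<tau> * (4 / 4096) ^ n"
    unfolding power_mult_distrib[symmetric] power_divide by simp
  also have "\<dots> \<le> \<tau> * 1" using \<tau> by (intro mult_left_mono power_le_one) auto
  finally show ?thesis by simp
qed

lemma N_x': "e \<in> E \<Longrightarrow> \<bar>N e x - N e x'\<bar> \<le> dx e"
  using N_triangle[of e x x'] N_triangle[of e x' x] N_minus_commute[of e x x'] by (simp add: dx_def abs_le_iff)

text \<open>\<open>x\<close> ranges over infinitely many points, so its distance to the grid is
  estimated deterministically, by Cauchy-Schwarz and without using the signs.\<close>

lemma remainder: "(\<Sum>e\<in>E. \<bar>(N e x)\<^sup>2 - (N e x')\<^sup>2\<bar>) \<le> 3 * sqrt \<tau>"
proof -
  have "\<bar>(N e x)\<^sup>2 - (N e x')\<^sup>2\<bar> \<le> 2 * (dx e * N e x) + (dx e)\<^sup>2" if e: "e \<in> E" for e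
  proof -
    have "(N e x)\<^sup>2 - (N e x')\<^sup>2 = (N e x - N e x') * (N e x + N e x')" by (simp add: power2_eq_square algebra_simps)
    then have "\<bar>(N e x)\<^sup>2 - (N e x')\<^sup>2\<bar> = \<bar>N e x - N e x'\<bar> * (N e x + N e x')"
      using N_nonneg[OF e] by (simp add: abs_mult add_nonneg_nonneg)
    also have "\<dots> \<le> dx e * (2 * N e x + dx e)"
    proof (rule mult_mono)
      show "N e x + N e x' \<le> 2 * N e x + dx e" using N_x'[OF e] by linarith
    qed (use N_x'[OF e] N_nonneg[OF e] dx_nonneg[OF e] in auto)
    finally show ?thesis by (simp add: power2_eq_square algebra_simps)
  qed
  then have "(\<Sum>e\<in>E. \<bar>(N e x)\<^sup>2 - (N e x')\<^sup>2\<bar>) \<le> (\<Sum>e\<in>E. 2 * (dx e * N e x) + (dx e)\<^sup>2)"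
    by (intro sum_mono)
  also have "\<dots> = 2 * (\<Sum>e\<in>E. dx e * N e x) + (\<Sum>e\<in>E. (dx e)\<^sup>2)"
    by (simp add: sum.distrib sum_distrib_left)
  also have "(\<Sum>e\<in>E. dx e * N e x) \<le> sqrt \<tau>"
  proof (rule real_le_rsqrt)
    have "(\<Sum>e\<in>E. dx e * N e x)\<^sup>2 \<le> (\<Sum>e\<in>E. (dx e)\<^sup>2) * (\<Sum>e\<in>E. (N e x)\<^sup>2)"
      by (rule Cauchy_Schwarz_ineq_sum)
    also have "\<dots> \<le> \<tau> * 1" using dx_sum xT by (intro mult_mono) (auto simp: T_def sum_nonneg \<tau> less_imp_le)
    finally show "(\<Sum>e\<in>E. dx e * N e x)\<^sup>2 \<le> \<tau>" by simp
  qed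
  also have "(\<Sum>e\<in>E. (dx e)\<^sup>2) \<le> sqrt \<tau>"
  proof -
    have "\<tau> * \<tau> \<le> \<tau> * 1" using \<tau> \<tau>1 by (intro mult_left_mono) auto
    then have "\<tau> \<le> sqrt \<tau>" using \<tau> by (intro real_le_rsqrt) (simp add: power2_eq_square)
    then show ?thesis using dx_sum by linarith
  qed
  finally show ?thesis by simp
qed

text \<open>On light hyperedges the whole energy of \<open>x'\<close> remains, but there
  \<open>N e x' \<le> 6 * \<rho> J\<close>. A grid point may lie outside \<open>T\<close>; its
  energy is still at most \<open>4\<close>, whence \<open>169 = 25 + 36 * 4\<close>.\<close>

lemma final_var: "(\<Sum>e\<in>E. ((N e x')\<^sup>2 - h J (z J) e)\<^sup>2) \<le> 169 * (\<rho> J)\<^sup>2"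
proof -
  have "((N e x')\<^sup>2 - h J (z J) e)\<^sup>2 \<le> (\<rho> J)\<^sup>2 * (25 * (N e (z J))\<^sup>2 + 36 * (N e x')\<^sup>2)" if e: "e \<in> E" for e
  proof -
    define a where "a = N e (z J)"
    define b where "b = N e x'"
    have nn: "0 \<le> a" "0 \<le> b" using N_nonneg[OF e] by (auto simp: a_def b_def)
    have ab: "\<bar>b - a\<bar> \<le> 2 * \<rho> J"
      using N_x'[OF e] dx_le_\<rho>[OF e] N_close[OF e, of J] near_N[OF e, of J] unfolding a_def b_def by linarith
    have \<rho>: "0 < \<rho> J" by (rule \<rho>_pos)
    show ?thesis
    proof (cases "e \<in> H J (z J)")
      case True
      then have a4: "4 * \<rho> J \<le> a" by (simp add: H_def a_def)
      have "b\<^sup>2 - a\<^sup>2 = (b - a) * (b + a)" by (simp add: power2_eq_square algebra_simps)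
      then have "\<bar>b\<^sup>2 - a\<^sup>2\<bar> = \<bar>b - a\<bar> * (b + a)" using nn by (simp add: abs_mult)
      also have "\<dots> \<le> (2 * \<rho> J) * (5 / 2 * a)"
      proof (rule mult_mono[OF ab])
        show "b + a \<le> 5 / 2 * a" using ab a4 by linarith
      qed (use nn \<rho> in auto)
      finally have "(b\<^sup>2 - a\<^sup>2)\<^sup>2 \<le> ((2 * \<rho> J) * (5 / 2 * a))\<^sup>2" by (metis abs_ge_zero power2_abs power_mono)
      also have "\<dots> = (\<rho> J)\<^sup>2 * (25 * a\<^sup>2)" by (simp add: power2_eq_square)
      also have "\<dots> \<le> (\<rho> J)\<^sup>2 * (25 * a\<^sup>2 + 36 * b\<^sup>2)" by (intro mult_left_mono) auto
      finally show ?thesis using True by (simp add: h_def a_def b_def)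
    next
      case False
      then have "a < 4 * \<rho> J" using e by (simp add: H_def a_def)
      then have "b \<le> 6 * \<rho> J" using ab by linarith
      then have "b\<^sup>2 \<le> (6 * \<rho> J)\<^sup>2" using nn by (intro power_mono) auto
      then have "b\<^sup>2 * b\<^sup>2 \<le> (6 * \<rho> J)\<^sup>2 * b\<^sup>2" by (intro mult_right_mono) auto
      also have "\<dots> \<le> (\<rho> J)\<^sup>2 * (25 * a\<^sup>2 + 36 * b\<^sup>2)" by (simp add: power_mult_distrib algebra_simps)
      finally show ?thesis using False by (simp add: h_def a_def b_def flip: power2_eq_square)
    qed
  qed
  then have "(\<Sum>e\<in>E. ((N e x')\<^sup>2 - h J (z J) e)\<^sup>2) \<le> (\<Sum>e\<in>E. (\<rho> J)\<^sup>2 * (25 * (N e (z J))\<^sup>2 + 36 * (N e x')\<^sup>2))"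
    by (intro sum_mono)
  also have "\<dots> = (\<rho> J)\<^sup>2 * (25 * (\<Sum>e\<in>E. (N e (z J))\<^sup>2) + 36 * (\<Sum>e\<in>E. (N e x')\<^sup>2))"
    by (simp add: sum.distrib sum_distrib_left algebra_simps)
  also have "\<dots> \<le> (\<rho> J)\<^sup>2 * (25 * 1 + 36 * 4)"
  proof (intro mult_left_mono add_mono)
    have "(N e x')\<^sup>2 \<le> 2 * (N e x)\<^sup>2 + 2 * (dx e)\<^sup>2" if e: "e \<in> E" for e
    proof -
      have "N e x' \<le> N e x + dx e" using N_x'[OF e] by linarith
      then have "(N e x')\<^sup>2 \<le> (N e x + dx e)\<^sup>2" using N_nonneg[OF e] by (intro power_mono) auto
      also have "\<dots> \<le> 2 * (N e x)\<^sup>2 + 2 * (dx e)\<^sup>2"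
      proof -
        have "0 \<le> (N e x - dx e)\<^sup>2" by simp
        then show ?thesis by (simp add: power2_eq_square algebra_simps)
      qed
      finally show ?thesis .
    qed
    then have "(\<Sum>e\<in>E. (N e x')\<^sup>2) \<le> (\<Sum>e\<in>E. 2 * (N e x)\<^sup>2 + 2 * (dx e)\<^sup>2)" by (intro sum_mono)
    also have "\<dots> = 2 * (\<Sum>e\<in>E. (N e x)\<^sup>2) + 2 * (\<Sum>e\<in>E. (dx e)\<^sup>2)"
      by (simp add: sum.distrib sum_distrib_left)
    also have "\<dots> \<le> 4" using dx_sum \<tau>1 xT by (simp add: T_def)
    finally show "(\<Sum>e\<in>E. (N e x')\<^sup>2) \<le> 4" .
  qed (use zT in \<open>auto simp: T_def\<close>)
  finally show ?thesis by simp
qed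

text \<open>After \<open>J\<close> scales the variance has dropped to order
  \<open>\<tau> / 64 ^ J\<close>, and this cancels the cost \<open>J * 64 ^ J\<close>, which covers
  both the last centre and the grid.\<close>

lemma final_step:
  "4 * sqrt ((q J + 10 * real n ^ 2 + 3) * (\<Sum>e\<in>E. ((N e x')\<^sup>2 - h J (z J) e)\<^sup>2)) \<le> 160000 * sqrt (J * (\<tau> * ln D))"
proof -
  have n64: "10 * real n ^ 2 + 3 \<le> J * 64 ^ J"
  proof -
    have "real n ^ 6 \<le> (2 ^ J) ^ 6" using n_le_J by (intro power_mono) auto
    also have "\<dots> = (2 ^ 6) ^ J" by (simp only: power_mult[symmetric] mult.commute)
    also have "\<dots> = 64 ^ J" by simp
    finally have a: "real n ^ 6 \<le> 64 ^ J" .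
    have "2 ^ 4 \<le> real n ^ 4" "2 ^ 2 \<le> real n ^ 2" using n2 by (intro power_mono; simp)+
    then have "16 * real n ^ 2 \<le> real n ^ 6" "4 \<le> real n ^ 2"
      using mult_right_mono[of "2 ^ 4" "real n ^ 4" "real n ^ 2"] by (simp_all flip: power_add)
    then have "10 * real n ^ 2 + 3 \<le> 64 ^ J" using a by linarith
    also have "\<dots> \<le> J * 64 ^ J" using J_ge_1 by simp
    finally show ?thesis .
  qed
  have "(q J + 10 * real n ^ 2 + 3) * (\<Sum>e\<in>E. ((N e x')\<^sup>2 - h J (z J) e)\<^sup>2) \<le> (820 * J * 64 ^ J) * (169 * (\<rho> J)\<^sup>2)"
    using final_var q_end n64 by (intro mult_mono) (auto intro: sum_nonneg)
  also have "\<dots> = 138580 * J * R" by (simp add: \<rho>_sq)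
  also have "\<dots> \<le> 138580 * J * (5120 * (2 * (\<tau> * ln D)))"
    using R_le \<tau>_le_ln by (intro mult_left_mono) auto
  also have "\<dots> \<le> 40000\<^sup>2 * (J * (\<tau> * ln D))"
  proof -
    have "0 \<le> J * (\<tau> * ln D)" using \<tau> D by simp
    then show ?thesis by (simp add: mult_ac)
  qed
  finally have "sqrt ((q J + 10 * real n ^ 2 + 3) * (\<Sum>e\<in>E. ((N e x')\<^sup>2 - h J (z J) e)\<^sup>2)) \<le> sqrt (40000\<^sup>2 * (J * (\<tau> * ln D)))"
    by (rule real_sqrt_le_mono)
  moreover have "sqrt (40000\<^sup>2 * (J * (\<tau> * ln D))) = 40000 * sqrt (J * (\<tau> * ln D))"
    using real_sqrt_mult[of "40000\<^sup>2" "J * (\<tau> * ln D)"] by simp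
  ultimately show ?thesis by linarith
qed

end

lemma sqrt_\<tau>_le: "3 * sqrt \<tau> \<le> 5 * sqrt (J * (\<tau> * ln D))"
proof -
  have 1: "\<tau> * ln D \<le> J * (\<tau> * ln D)" using mult_right_mono[of 1 "real J" "\<tau> * ln D"] J_ge_1 \<tau> D by simp
  have "sqrt (9 * \<tau>) \<le> sqrt (25 * (J * (\<tau> * ln D)))"
    using \<tau>_le_ln 1 \<tau> D by (intro real_sqrt_le_mono) linarith
  moreover have "sqrt (9 * \<tau>) = 3 * sqrt \<tau>" using real_sqrt_mult[of "3\<^sup>2" \<tau>] by simp
  moreover have "sqrt (25 * (J * (\<tau> * ln D))) = 5 * sqrt (J * (\<tau> * ln D))"
    using real_sqrt_mult[of "5\<^sup>2" "J * (\<tau> * ln D)"] by simp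
  ultimately show ?thesis by linarith
qed

end

section \<open>Signs that serve all chains at once\<close>

context chaining
begin

text \<open>The signs are fixed first, by a union bound over every edge of the tree and every pair
  of a last centre and a grid point. Only then is \<open>x\<close> given, and its energy vector is
  split along its own chain.\<close>

theorem signs_sup_bound:
  "\<exists>\<epsilon>\<in>signs E. \<forall>x\<in>T. \<bar>\<Sum>e\<in>E. (N e x)\<^sup>2 * \<epsilon> e\<bar> \<le> 430000 * sqrt (J * (\<tau> * ln D))"
proof -
  obtain G where G: "finite G" "real (card G) \<le> exp (10 * real n ^ 2)"
    "\<And>x. sq n x \<le> 1 \<Longrightarrow> \<exists>x'\<in>G. sq n (\<lambda>k. x k - x' k) \<le> n / (64 ^ n)\<^sup>2"
    using grid_exists by blast
  \<comment> \<open>The summand \<open>j + 3\<close> divides the failure probability among the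
    scales; together with the grid it stays below \<open>1 / 4 + 1 / 8\<close>.\<close>
  define f1 where "f1 = (\<lambda>j i. ((\<lambda>e. h (Suc j) (fst (nxt j i)) e - h j (fst (fst i)) e), snd (nxt j i) + real j + 3))"
  define f2 where "f2 = (\<lambda>i. ((\<lambda>e. (N e (snd i))\<^sup>2 - h J (fst (fst i)) e), snd (fst i) + 10 * real n ^ 2 + 3))"
  define F where "F = (\<lambda>j. if j < J then f1 j ` edges j else f2 ` (nodes J \<times> G))"
  have finF: "finite (F j)" for j using finite_edges finite_nodes G(1) by (simp add: F_def)
  have e3: "exp (- 3) \<le> (1 / 8 :: real)" "exp (- 2) \<le> (1 / 4 :: real)"
  proof -
    have "2 \<le> exp (1::real)" using exp_ge_add_one_self[of "1::real"] by simp
    then have "2 ^ 3 \<le> exp (1::real) ^ 3" "2 ^ 2 \<le> exp (1::real) ^ 2" by (intro power_mono; simp)+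
    then show "exp (- 3) \<le> (1 / 8 :: real)" "exp (- 2) \<le> (1 / 4 :: real)"
      using exp_of_nat_mult[of 3 "1::real"] exp_of_nat_mult[of 2 "1::real"]
      by (auto simp: exp_minus field_simps)
  qed
  have w1: "(\<Sum>p\<in>F j. exp (- snd p)) \<le> exp (- 2) * exp (- real (Suc j))" if j: "j < J" for j
  proof -
    have "(\<Sum>p\<in>F j. exp (- snd p)) \<le> (\<Sum>i\<in>edges j. exp (- snd (f1 j i)))"
      using j by (simp add: F_def) (rule sum_image_le[unfolded o_def], auto simp: finite_edges)
    also have "\<dots> = exp (- (real j + 3)) * (\<Sum>i\<in>edges j. exp (- snd (nxt j i)))"
      by (simp add: f1_def sum_distrib_left exp_add[symmetric] algebra_simps)
    also have "\<dots> \<le> exp (- (real j + 3)) * 1"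
      using edges_weight[of j] nodes_weight[of j] by (intro mult_left_mono) auto
    also have "\<dots> = exp (- 2) * exp (- real (Suc j))" by (simp flip: exp_add)
    finally show ?thesis .
  qed
  have w2: "(\<Sum>p\<in>F J. exp (- snd p)) \<le> exp (- 3)"
  proof -
    have "(\<Sum>p\<in>F J. exp (- snd p)) \<le> (\<Sum>i\<in>nodes J \<times> G. exp (- snd (f2 i)))"
      by (simp add: F_def) (rule sum_image_le[unfolded o_def], auto simp: finite_nodes G)
    also have "\<dots> = (\<Sum>p\<in>nodes J. \<Sum>y\<in>G. exp (- snd p) * (exp (- 3) * exp (- (10 * real n ^ 2))))"
      by (subst sum.cartesian_product) (auto simp: f2_def exp_add[symmetric] algebra_simps intro!: sum.cong)
    also have "\<dots> = (\<Sum>p\<in>nodes J. exp (- snd p)) * (exp (- 3) * (real (card G) * exp (- (10 * real n ^ 2))))"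
      unfolding sum_distrib_right by (intro sum.cong) auto
    also have "\<dots> \<le> 1 * (exp (- 3) * 1)"
    proof (intro mult_mono nodes_weight order_refl)
      have "real (card G) * exp (- (10 * real n ^ 2)) \<le> exp (10 * real n ^ 2) * exp (- (10 * real n ^ 2))"
        using G(2) by (intro mult_right_mono) auto
      then show "real (card G) * exp (- (10 * real n ^ 2)) \<le> 1" by (simp flip: exp_add)
    qed auto
    finally show ?thesis by simp
  qed
  have c0: "0 \<le> snd p" if p: "p \<in> F j" for p j
  proof (cases "j < J")
    case True
    then obtain i where i: "i \<in> edges j" "p = f1 j i" using p by (auto simp: F_def)
    then have "0 \<le> snd (fst i)" using nodes_T by (auto simp: edges_def)
    then show ?thesis by (simp add: i f1_def nxt_def case_prod_unfold)
  next
    case False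
    then show ?thesis using p nodes_T by (force simp: F_def f2_def)
  qed
  have "(\<Sum>p\<in>(\<Union>j\<in>{..J}. F j). exp (- snd p)) \<le> (\<Sum>j\<in>{..J}. \<Sum>p\<in>F j. exp (- snd p))"
    by (intro sum_UN_le finF) auto
  also have "\<dots> = (\<Sum>j<J. \<Sum>p\<in>F j. exp (- snd p)) + (\<Sum>p\<in>F J. exp (- snd p))"
    by (simp flip: lessThan_Suc_atMost)
  also have "\<dots> \<le> (\<Sum>j<J. exp (- 2) * exp (- real (Suc j))) + exp (- 3)"
    by (intro add_mono sum_mono w1 w2) auto
  also have "(\<Sum>j<J. exp (- 2) * exp (- real (Suc j))) = exp (- 2) * (\<Sum>l=1..J. exp (- real l))"
    unfolding sum_distrib_left by (rule sum.reindex_bij_witness[of _ "\<lambda>l. l - 1" Suc]) auto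
  also have "exp (- 2) * (\<Sum>l=1..J. exp (- real l)) + exp (- 3) \<le> 1 / 4 * 1 + 1 / 8"
    using e3 sum_exp_neg_le[of J] by (intro add_mono mult_mono) (auto intro: sum_nonneg)
  also have "\<dots> < 1 / 2" by simp
  finally obtain \<epsilon> where \<epsilon>: "\<epsilon> \<in> signs E"
    "\<And>\<Delta> c j. j \<le> J \<Longrightarrow> (\<Delta>, c) \<in> F j \<Longrightarrow> \<bar>\<Sum>e\<in>E. \<Delta> e * \<epsilon> e\<bar> \<le> 4 * sqrt (c * (\<Sum>e\<in>E. (\<Delta> e)\<^sup>2))"
    using signs_exist[OF finE, of "\<Union>j\<in>{..J}. F j"] finF c0 by fastforce
  have "\<bar>\<Sum>e\<in>E. (N e x)\<^sup>2 * \<epsilon> e\<bar> \<le> 430000 * sqrt (J * (\<tau> * ln D))" if x: "x \<in> T" for x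
  proof -
    define good where "good = (\<lambda>j z l \<xi>. l \<in> {1..4 * J} \<and> \<xi> \<in> net j z l \<and>
      cl j z (8 * \<sigma> (Suc j)) (\<lambda>k. step j z \<xi> k - x k) \<and>
      sq n (\<lambda>k. x k - step j z \<xi> k) + sq n (\<lambda>k. step j z \<xi> k - z k) \<le> sq n (\<lambda>k. x k - z k) \<and>
      (\<forall>y. cl j z (2 * \<sigma> (Suc j)) (\<lambda>k. y k - x k) \<longrightarrow> real l \<le> J * sq n (\<lambda>k. y k - z k) + 1))"
    \<comment> \<open>The implication makes the choice function total, so the centres can be defined
      by recursion before they are known to lie in \<open>T\<close>.\<close>
    have "\<exists>p. z \<in> T \<longrightarrow> good j z (fst p) (snd p)" for j z
      using chain_step[OF x, of z j] unfolding good_def by auto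
    note ex = this
    define s where "s = (\<lambda>j z. SOME p. z \<in> T \<longrightarrow> good j z (fst p) (snd p))"
    have s: "good j z (fst (s j z)) (snd (s j z))" if "z \<in> T" for j z
      using someI_ex[OF ex[of z j]] that unfolding s_def by blast
    define z where "z = rec_nat (\<lambda>_. 0) (\<lambda>j zj. step j zj (snd (s j zj)))"
    define l where "l = (\<lambda>j. fst (s j (z j)))"
    define q where "q = rec_nat 0 (\<lambda>j qj. qj + 2 * real (l j) * 64 ^ Suc j + 2)"
    have z_simps: "z 0 = (\<lambda>_. 0)" "z (Suc j) = step j (z j) (snd (s j (z j)))" for j by (simp_all add: z_def)
    have q_simps: "q 0 = 0" "q (Suc j) = q j + 2 * real (l j) * 64 ^ Suc j + 2" for j by (simp_all add: q_def)
    have zT: "z j \<in> T" for j by (induction j) (auto simp: z_simps T_zero step_T)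
    have "good j (z j) (l j) (snd (s j (z j)))" for j unfolding l_def by (rule s[OF zT])
    note gd = this[unfolded good_def, folded z_simps(2)]
    interpret chain n P g E S c \<tau> D x z l q
      using x zT gd by unfold_locales (auto simp: z_simps(1) q_simps)
    have edge: "((z j, q j), l j, snd (s j (z j))) \<in> edges j" if "(z j, q j) \<in> nodes j" for j
      using that gd[of j] by (auto simp: edges_def)
    have nxt_eq: "nxt j ((z j, q j), l j, snd (s j (z j))) = (z (Suc j), q (Suc j))" for j
      by (simp add: nxt_def z_simps(2) q_simps)
    have node: "(z j, q j) \<in> nodes j" for j
    proof (induction j)
      case (Suc j)
      then show ?case using imageI[OF edge[OF Suc], of "nxt j"] unfolding nxt_eq by (simp add: edges_def)
    qed (simp add: z_simps q_simps)
    obtain x' where x': "x' \<in> G" "sq n (\<lambda>k. x k - x' k) \<le> n / (64 ^ n)\<^sup>2"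
      using G(3) x by (auto simp: T_def)
    have b1: "\<bar>\<Sum>e\<in>E. (h (Suc j) (z (Suc j)) e - h j (z j) e) * \<epsilon> e\<bar> \<le> 4 * sqrt ((q (Suc j) + j + 3) * V j)" if j: "j < J" for j
    proof -
      have "f1 j ((z j, q j), l j, snd (s j (z j))) \<in> F j" using j edge[OF node] by (simp add: F_def)
      then have "((\<lambda>e. h (Suc j) (z (Suc j)) e - h j (z j) e), q (Suc j) + real j + 3) \<in> F j"
        by (simp add: f1_def nxt_eq)
      from \<epsilon>(2)[OF _ this] j show ?thesis by (simp add: V_def)
    qed
    have b2: "\<bar>\<Sum>e\<in>E. ((N e x')\<^sup>2 - h J (z J) e) * \<epsilon> e\<bar> \<le> 160000 * sqrt (J * (\<tau> * ln D))"
    proof -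
      have "f2 ((z J, q J), x') \<in> F J" using node x'(1) by (simp add: F_def)
      then have "((\<lambda>e. (N e x')\<^sup>2 - h J (z J) e), q J + 10 * real n ^ 2 + 3) \<in> F J" by (simp add: f2_def)
      from \<epsilon>(2)[OF _ this] final_step[OF x'(2)] show ?thesis by simp
    qed
    have b3: "\<bar>\<Sum>e\<in>E. ((N e x)\<^sup>2 - (N e x')\<^sup>2) * \<epsilon> e\<bar> \<le> 5 * sqrt (J * (\<tau> * ln D))"
    proof -
      have "\<bar>\<Sum>e\<in>E. ((N e x)\<^sup>2 - (N e x')\<^sup>2) * \<epsilon> e\<bar> \<le> (\<Sum>e\<in>E. \<bar>((N e x)\<^sup>2 - (N e x')\<^sup>2) * \<epsilon> e\<bar>)"
        by (rule sum_abs)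
      also have "\<dots> = (\<Sum>e\<in>E. \<bar>(N e x)\<^sup>2 - (N e x')\<^sup>2\<bar>)"
      proof (rule sum.cong[OF refl])
        fix e assume "e \<in> E"
        from signs_cases[OF \<epsilon>(1) this]
        show "\<bar>((N e x)\<^sup>2 - (N e x')\<^sup>2) * \<epsilon> e\<bar> = \<bar>(N e x)\<^sup>2 - (N e x')\<^sup>2\<bar>"
          by (auto simp: abs_mult)
      qed
      finally show ?thesis using remainder[OF x'(2)] sqrt_\<tau>_le by linarith
    qed
    \<comment> \<open>The telescope starts at zero: no hyperedge is heavy at the centre
      \<open>0\<close>.\<close>
    have "(\<Sum>j<J. h (Suc j) (z (Suc j)) e - h j (z j) e) = h J (z J) e" if "e \<in> E" for e
      using that \<rho>_pos[of 0] by (subst sum_lessThan_telescope) (simp add: h_def H_def z_simps(1) N_zero)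
    then have "(\<Sum>e\<in>E. (N e x)\<^sup>2 * \<epsilon> e) = (\<Sum>e\<in>E. (((N e x)\<^sup>2 - (N e x')\<^sup>2) + ((N e x')\<^sup>2 - h J (z J) e)
       + (\<Sum>j<J. h (Suc j) (z (Suc j)) e - h j (z j) e)) * \<epsilon> e)"
      by (intro sum.cong) auto
    also have "\<dots> = (\<Sum>e\<in>E. ((N e x)\<^sup>2 - (N e x')\<^sup>2) * \<epsilon> e) + (\<Sum>e\<in>E. ((N e x')\<^sup>2 - h J (z J) e) * \<epsilon> e)
       + (\<Sum>j<J. \<Sum>e\<in>E. (h (Suc j) (z (Suc j)) e - h j (z j) e) * \<epsilon> e)"
      unfolding sum.swap[of _ E "{..<J}"] by (simp only: distrib_right sum.distrib sum_distrib_right)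
    also have "\<bar>\<dots>\<bar> \<le> 5 * sqrt (J * (\<tau> * ln D)) + 160000 * sqrt (J * (\<tau> * ln D)) + 260000 * sqrt (J * (\<tau> * ln D))"
    proof -
      have "\<bar>\<Sum>j<J. \<Sum>e\<in>E. (h (Suc j) (z (Suc j)) e - h j (z j) e) * \<epsilon> e\<bar>
        \<le> (\<Sum>j<J. \<bar>\<Sum>e\<in>E. (h (Suc j) (z (Suc j)) e - h j (z j) e) * \<epsilon> e\<bar>)" by (rule sum_abs)
      also have "\<dots> \<le> (\<Sum>j<J. 4 * sqrt ((q (Suc j) + j + 3) * V j))" by (intro sum_mono b1) auto
      also have "\<dots> \<le> 260000 * sqrt (J * (\<tau> * ln D))" by (rule chain_total)
      finally show ?thesis using b2 b3 by linarith
    qed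
    also have "\<dots> \<le> 430000 * sqrt (J * (\<tau> * ln D))" using \<tau> D by simp
    finally show ?thesis .
  qed
  then show ?thesis using \<epsilon>(1) by blast
qed

end

section \<open>Halving\<close>

definition pairs :: "'a set \<Rightarrow> ('a \<times> 'a) set" where
  "pairs e = {(u, v). u \<in> e \<and> v \<in> e \<and> u \<noteq> v}"

lemma edge_energy_pairs: "edge_energy e x = Max ((\<lambda>p. (x (fst p) - x (snd p))\<^sup>2) ` pairs e)"
proof -
  have "{(x u - x v)\<^sup>2 | u v. u \<in> e \<and> v \<in> e \<and> u \<noteq> v} = (\<lambda>p. (x (fst p) - x (snd p))\<^sup>2) ` pairs e"
    by (force simp: pairs_def image_iff)
  then show ?thesis by (simp add: edge_energy_def)
qed

lemma finite_pairs: "finite e \<Longrightarrow> finite (pairs e)"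
  by (rule finite_subset[of _ "e \<times> e"]) (auto simp: pairs_def)

lemma card_pairs_le: "finite e \<Longrightarrow> card (pairs e) \<le> (card e)\<^sup>2"
  using card_mono[of "e \<times> e" "pairs e"] by (auto simp: pairs_def card_cartesian_product power2_eq_square)

lemma pairs_nonempty:
  assumes "2 \<le> card e"
  shows "pairs e \<noteq> {}"
proof -
  have "\<exists>u\<in>e. \<exists>v\<in>e. u \<noteq> v"
  proof (rule ccontr)
    assume "\<not> ?thesis"
    then have "card e \<le> Suc 0" by (intro card_le_Suc0_iff_eq[THEN iffD2]) (use assms card.infinite in \<open>auto intro: ccontr\<close>)
    then show False using assms by simp
  qed
  then show ?thesis by (auto simp: pairs_def)
qed

lemma edge_energy_nonneg:
  assumes "finite e" "2 \<le> card e"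
  shows "0 \<le> edge_energy e x"
  unfolding edge_energy_pairs
  using finite_pairs[OF assms(1)] pairs_nonempty[OF assms(2)] by (subst Max_ge_iff) auto

text \<open>\<open>D\<close> is merely an upper bound for the sizes, so that it stays the same for
  all sub-hypergraphs of the iteration.\<close>

locale hypergraph =
  fixes V :: "'a set" and E :: "'a set set" and w :: "'a set \<Rightarrow> real" and D :: real
  assumes finV: "finite V" and finE: "finite E"
    and E: "\<And>e. e \<in> E \<Longrightarrow> e \<subseteq> V" "\<And>e. e \<in> E \<Longrightarrow> 2 \<le> card e" "\<And>e. e \<in> E \<Longrightarrow> 0 \<le> w e"
    and D: "2 \<le> D" "\<And>e. e \<in> E \<Longrightarrow> card e \<le> D"
    and n2: "2 \<le> card V"
begin

definition n :: nat where "n = card V"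
definition A :: real where "A = n * ln n * ln D"

lemma fin_e: "e \<in> E \<Longrightarrow> finite e"
  using E(1) finV finite_subset by blast

lemma A_pos: "0 < A"
  using n2 D by (auto simp: A_def n_def)

lemma pairs_E: "e \<in> E \<Longrightarrow> finite (pairs e)" "e \<in> E \<Longrightarrow> pairs e \<noteq> {}"
  by (simp_all add: finite_pairs fin_e pairs_nonempty E(2))

lemma term_nonneg: "e \<in> E \<Longrightarrow> 0 \<le> w e * edge_energy e x"
  by (simp add: edge_energy_nonneg fin_e E)

lemma energy_nonneg: "0 \<le> energy E w x"
  unfolding energy_def by (intro sum_nonneg term_nonneg)

text \<open>The term with \<open>\<delta>\<close> makes the energy nondegenerate.\<close>

lemma signing:
  assumes m: "4 * n \<le> card E" and \<delta>: "0 < \<delta>"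
  shows "\<exists>E0 \<epsilon>. E0 \<subseteq> E \<and> 4 * card (E - E0) \<le> card E \<and> \<epsilon> \<in> signs E0 \<and>
    (\<forall>x. \<bar>\<Sum>e\<in>E0. w e * edge_energy e x * \<epsilon> e\<bar> \<le> 1720000 * sqrt (A / card E) * (energy E w x + \<delta> * ((\<Sum>u\<in>V. (x u)\<^sup>2) + 1)))"
proof -
  define m where "m = real (card E)"
  have m0: "0 < m" using m n2 by (simp add: m_def n_def)
  obtain f where f: "bij_betw f {..<n} V"
    using ex_bij_betw_nat_finite[OF finV] by (auto simp: n_def lessThan_atLeast0)
  define idx where "idx = inv_into {..<n} f"
  have idx: "idx u < n" "f (idx u) = u" if "u \<in> V" for u
    using that bij_betw_inv_into_right[OF f] bij_betwE[OF bij_betw_inv_into[OF f]] by (auto simp: idx_def)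
  define a where "a = (\<lambda>(u, v) k. (if k = idx u then 1 else 0) - (if k = idx v then 1 else 0 :: real))"
  interpret WF: weighted_functionals n E pairs w a \<delta>
    using n2 finE E(3) \<delta> pairs_E by unfold_locales (auto simp: n_def)
  have lin: "WF.lin (u, v) x = x (idx u) - x (idx v)" if "u \<in> V" "v \<in> V" for u v x
  proof -
    have "WF.lin (u, v) x = (\<Sum>k<n. (if k = idx u then x k else 0) - (if k = idx v then x k else 0))"
      unfolding WF.lin_def by (intro sum.cong) (auto simp: a_def)
    then show ?thesis using idx that by (simp add: sum_subtractf)
  qed
  obtain B where B: "(\<Sum>e\<in>E. w e * Max (WF.im_sq B ` pairs e)) \<le> n"
    "\<And>x. \<exists>y. (\<forall>i\<ge>n. y i = 0) \<and> (\<forall>k<n. WF.X B y k = x k) \<and> (\<Sum>i<n. (y i)\<^sup>2) \<le> WF.Q x"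
    using WF.adapted_basis by blast
  \<comment> \<open>The assumption \<open>4 * n \<le> card E\<close> gives
    \<open>\<tau> \<le> 1\<close>, as \<open>chaining\<close> requires.\<close>
  define \<tau> where "\<tau> = 4 * n / m"
  have \<tau>: "0 < \<tau>" "\<tau> \<le> 1" using m m0 n2 by (auto simp: \<tau>_def m_def n_def)
  define E0 where "E0 = {e\<in>E. w e * Max (WF.im_sq B ` pairs e) \<le> \<tau>}"
  have E0: "E0 \<subseteq> E" by (auto simp: E0_def)
  have heavy: "4 * card (E - E0) \<le> card E"
  proof -
    have nn: "0 \<le> w e * Max (WF.im_sq B ` pairs e)" if "e \<in> E" for e
      using E(3)[OF that] WF.Max_nonneg_image[OF that] WF.im_sq_nonneg by simp
    have "real (card (E - E0)) * \<tau> \<le> (\<Sum>e\<in>E - E0. w e * Max (WF.im_sq B ` pairs e))"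
      by (rule sum_bounded_below) (auto simp: E0_def)
    also have "\<dots> \<le> (\<Sum>e\<in>E. w e * Max (WF.im_sq B ` pairs e))"
      using finE nn by (intro sum_mono2) auto
    also have "\<dots> \<le> n" by (rule B(1))
    finally have "real (card (E - E0)) * (4 * n) \<le> m * n" using m0 by (simp add: \<tau>_def field_simps)
    then have "real (4 * card (E - E0)) * n \<le> real (card E) * n" by (simp add: m_def algebra_simps)
    then have "real (4 * card (E - E0)) \<le> real (card E)" using n2 by (simp add: n_def)
    then show ?thesis by linarith
  qed
  \<comment> \<open>If \<open>im_sq B p = 0\<close>, division by zero yields \<open>g p = 0\<close>,
    which is consistent because the functional then vanishes on all \<open>X B y\<close>.\<close>
  define g where "g = (\<lambda>p i. WF.lin p (\<lambda>k. B (i, k)) / sqrt (WF.im_sq B p))"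
  \<comment> \<open>The absolute value makes \<open>c\<close> nonnegative also outside
    \<open>E\<close>, where nothing is known about the sign of \<open>w\<close>.\<close>
  define c where "c = (\<lambda>e p. sqrt (\<bar>w e\<bar> * WF.im_sq B p))"
  have sq_g: "sq n (g p) \<le> 1" for p
  proof -
    have "sq n (g p) = WF.im_sq B p / WF.im_sq B p"
      using WF.im_sq_nonneg[of B p]
      by (simp add: sq_def g_def power_divide flip: sum_divide_distrib) (simp add: WF.im_sq_def)
    then show ?thesis by simp
  qed
  have ip_g: "sqrt (WF.im_sq B p) * ip n (g p) y = WF.lin p (WF.X B y)" for p y
  proof (cases "WF.im_sq B p = 0")
    case True
    then have "\<And>i. i < n \<Longrightarrow> WF.lin p (\<lambda>k. B (i, k)) = 0"
      by (simp add: WF.im_sq_def sum_nonneg_eq_0_iff)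
    then show ?thesis using True by (simp add: WF.lin_X)
  next
    case False
    then have "0 < sqrt (WF.im_sq B p)" using WF.im_sq_nonneg[of B p] by simp
    then show ?thesis unfolding WF.lin_X ip_def g_def sum_distrib_left
      by (intro sum.cong) (auto simp: mult.commute)
  qed
  interpret CH: chaining n "V \<times> V" g E0 pairs c \<tau> D
  proof
    show "2 \<le> n" using n2 by (simp add: n_def)
    show "finite (V \<times> V)" "card (V \<times> V) \<le> n\<^sup>2"
      using finV by (auto simp: n_def card_cartesian_product power2_eq_square)
    show "sq n (g p) \<le> 1" for p by (rule sq_g)
    show "finite E0" using finE E0 finite_subset by blast
    show "pairs e \<subseteq> V \<times> V" if "e \<in> E0" for e using that E0 E(1) by (fastforce simp: pairs_def)
    show "pairs e \<noteq> {}" if "e \<in> E0" for e using that E0 pairs_E(2) by blast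
    show "real (card (pairs e)) \<le> D\<^sup>2" if "e \<in> E0" for e
    proof -
      have e: "e \<in> E" using that E0 by auto
      have "real (card (pairs e)) \<le> (real (card e))\<^sup>2"
        using of_nat_mono[OF card_pairs_le[OF fin_e[OF e]], where 'a = real] by simp
      also have "\<dots> \<le> D\<^sup>2" using D(2)[OF e] by (intro power_mono) auto
      finally show ?thesis .
    qed
    show "2 \<le> D" by (rule D(1))
    show "0 \<le> c e p" for e p using WF.im_sq_nonneg[of B p] by (simp add: c_def)
    show "(c e p)\<^sup>2 \<le> \<tau>" if "e \<in> E0" "p \<in> pairs e" for e p
    proof -
      have e: "e \<in> E" using that E0 by auto
      have "WF.im_sq B p \<le> Max (WF.im_sq B ` pairs e)"
        using that pairs_E(1)[OF e] by (intro Max_ge) auto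
      then have "w e * WF.im_sq B p \<le> w e * Max (WF.im_sq B ` pairs e)"
        using E(3)[OF e] by (rule mult_left_mono)
      also have "\<dots> \<le> \<tau>" using that by (simp add: E0_def)
      finally show ?thesis using E(3)[OF e] WF.im_sq_nonneg[of B p] by (simp add: c_def)
    qed
    show "0 < \<tau>" "\<tau> \<le> 1" by (fact \<tau>)+
    have "card E0 \<le> card (Pow V)"
      using E0 E(1) finV by (intro card_mono) auto
    then show "card E0 \<le> 2 ^ n" using finV by (simp add: card_Pow n_def)
  qed
  have Nsq: "(CH.N e y)\<^sup>2 = w e * edge_energy e x" if e: "e \<in> E0" and x: "\<And>k. k < n \<Longrightarrow> WF.X B y k = x (f k)" for e y x
  proof -
    have eE: "e \<in> E" using e E0 by auto
    have fp: "finite (pairs e)" "pairs e \<noteq> {}" using pairs_E[OF eE] by auto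
    have "CH.N e y = Max ((\<lambda>p. sqrt (w e) * \<bar>x (fst p) - x (snd p)\<bar>) ` pairs e)"
      unfolding CH.N_def
    proof (intro arg_cong[where f = Max] image_cong refl)
      fix p assume p: "p \<in> pairs e"
      then obtain u v where uv: "p = (u, v)" "u \<in> V" "v \<in> V" using E(1)[OF eE] by (auto simp: pairs_def)
      have "c e p * \<bar>ip n (g p) y\<bar> = sqrt (w e) * \<bar>sqrt (WF.im_sq B p) * ip n (g p) y\<bar>"
        using E(3)[OF eE] WF.im_sq_nonneg[of B p] by (simp add: c_def real_sqrt_mult abs_mult)
      also have "\<dots> = sqrt (w e) * \<bar>x u - x v\<bar>"
        unfolding ip_g uv(1) using lin[OF uv(2,3)] x idx uv by simp
      finally show "c e p * \<bar>ip n (g p) y\<bar> = sqrt (w e) * \<bar>x (fst p) - x (snd p)\<bar>" using uv by simp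
    qed
    also have "\<dots> = sqrt (w e) * Max ((\<lambda>p. \<bar>x (fst p) - x (snd p)\<bar>) ` pairs e)"
      using fp E(3)[OF eE] by (intro Max_image_mult) auto
    also have "\<dots>\<^sup>2 = w e * (Max ((\<lambda>p. \<bar>x (fst p) - x (snd p)\<bar>) ` pairs e))\<^sup>2"
      using E(3)[OF eE] by (simp add: power_mult_distrib)
    also have "(Max ((\<lambda>p. \<bar>x (fst p) - x (snd p)\<bar>) ` pairs e))\<^sup>2 = edge_energy e x"
    proof -
      obtain p where p: "p \<in> pairs e" "Max ((\<lambda>p. \<bar>x (fst p) - x (snd p)\<bar>) ` pairs e) = \<bar>x (fst p) - x (snd p)\<bar>"
        using Max_in[OF finite_imageI[OF fp(1)], of "\<lambda>p. \<bar>x (fst p) - x (snd p)\<bar>"] fp(2) by fast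
      have "edge_energy e x = (x (fst p) - x (snd p))\<^sup>2"
        unfolding edge_energy_pairs
      proof (rule Max_eqI)
        fix r assume "r \<in> (\<lambda>p. (x (fst p) - x (snd p))\<^sup>2) ` pairs e"
        then obtain p' where p': "p' \<in> pairs e" "r = (x (fst p') - x (snd p'))\<^sup>2" by auto
        have "\<bar>x (fst p') - x (snd p')\<bar> \<le> \<bar>x (fst p) - x (snd p)\<bar>"
          unfolding p(2)[symmetric] using fp p' by (intro Max_ge) auto
        then show "r \<le> (x (fst p) - x (snd p))\<^sup>2" unfolding p' by (simp add: abs_le_square_iff)
      qed (use fp p in auto)
      then show ?thesis using p by simp
    qed
    finally show ?thesis .
  qed
  obtain \<epsilon> where \<epsilon>: "\<epsilon> \<in> signs E0"
    "\<And>y. y \<in> CH.T \<Longrightarrow> \<bar>\<Sum>e\<in>E0. (CH.N e y)\<^sup>2 * \<epsilon> e\<bar> \<le> 430000 * sqrt (CH.J * (\<tau> * ln D))"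
    using CH.signs_sup_bound by blast
  have bnd: "430000 * sqrt (CH.J * (\<tau> * ln D)) \<le> 1720000 * sqrt (A / card E)"
  proof -
    have "CH.J * (\<tau> * ln D) \<le> (4 * ln n) * (\<tau> * ln D)"
      using CH.J_le_ln \<tau> D(1) by (intro mult_right_mono) auto
    also have "\<dots> = 4\<^sup>2 * (A / card E)" by (simp add: \<tau>_def A_def m_def)
    finally have "sqrt (CH.J * (\<tau> * ln D)) \<le> sqrt (4\<^sup>2 * (A / card E))" by (rule real_sqrt_le_mono)
    also have "\<dots> = 4 * sqrt (A / card E)" using real_sqrt_mult[of "4\<^sup>2" "A / card E"] by simp
    finally show ?thesis by simp
  qed
  have "\<bar>\<Sum>e\<in>E0. w e * edge_energy e x * \<epsilon> e\<bar> \<le> 1720000 * sqrt (A / card E) * (energy E w x + \<delta> * ((\<Sum>u\<in>V. (x u)\<^sup>2) + 1))" for x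
  proof -
    have sumV: "(\<Sum>k<n. (x (f k))\<^sup>2) = (\<Sum>u\<in>V. (x u)\<^sup>2)"
      by (rule sum.reindex_bij_betw[OF f])
    have enE: "w e * Max ((\<lambda>p. (WF.lin p (\<lambda>k. x (f k)))\<^sup>2) ` pairs e) = w e * edge_energy e x" if e: "e \<in> E" for e
    proof -
      have "(\<lambda>p. (WF.lin p (\<lambda>k. x (f k)))\<^sup>2) ` pairs e = (\<lambda>p. (x (fst p) - x (snd p))\<^sup>2) ` pairs e"
      proof (rule image_cong[OF refl])
        fix p assume p: "p \<in> pairs e"
        then obtain u v where uv: "p = (u, v)" "u \<in> V" "v \<in> V" using E(1)[OF e] by (auto simp: pairs_def)
        then show "(WF.lin p (\<lambda>k. x (f k)))\<^sup>2 = (x (fst p) - x (snd p))\<^sup>2" using lin idx by simp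
      qed
      then show ?thesis by (simp add: edge_energy_pairs)
    qed
    have Q: "WF.Q (\<lambda>k. x (f k)) = energy E w x + \<delta> * (\<Sum>u\<in>V. (x u)\<^sup>2)"
      unfolding WF.Q_def sumV energy_def by (simp add: enE cong: sum.cong)
    \<comment> \<open>The summand \<open>1\<close> keeps \<open>q\<close> positive even for
      \<open>x = 0\<close>, so that \<open>y\<close> can be divided by
      \<open>sqrt q\<close>.\<close>
    define q where "q = energy E w x + \<delta> * ((\<Sum>u\<in>V. (x u)\<^sup>2) + 1)"
    have q: "WF.Q (\<lambda>k. x (f k)) \<le> q" "energy E w x \<le> q" "0 < q"
    proof -
      have "0 \<le> \<delta> * (\<Sum>u\<in>V. (x u)\<^sup>2)" using \<delta> by (simp add: sum_nonneg)
      then show "WF.Q (\<lambda>k. x (f k)) \<le> q" "energy E w x \<le> q" "0 < q"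
        using energy_nonneg[of x] \<delta> by (auto simp: Q q_def distrib_left)
    qed
    obtain y where y: "\<forall>i\<ge>n. y i = 0" "\<forall>k<n. WF.X B y k = x (f k)" "(\<Sum>i<n. (y i)\<^sup>2) \<le> WF.Q (\<lambda>k. x (f k))"
      using B(2)[of "\<lambda>k. x (f k)"] by blast
    define s where "s = 1 / sqrt q"
    have s: "s\<^sup>2 = 1 / q" using q by (simp add: s_def power_divide)
    define y' where "y' = (\<lambda>i. s * y i)"
    have N_y': "(CH.N e y')\<^sup>2 = 1 / q * (w e * edge_energy e x)" if e: "e \<in> E0" for e
    proof -
      have "CH.N e y' \<le> \<bar>s\<bar> * CH.N e y" "\<bar>s\<bar> * CH.N e y \<le> CH.N e y'"
      proof -
        show "CH.N e y' \<le> \<bar>s\<bar> * CH.N e y" using CH.N_combo[OF e, of s y 0 y] by (simp add: y'_def)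
        have "CH.N e y \<le> \<bar>sqrt q\<bar> * CH.N e y'"
          using CH.N_combo[OF e, of "sqrt q" y' 0 y] q(3) by (simp add: y'_def s_def)
        then show "\<bar>s\<bar> * CH.N e y \<le> CH.N e y'" using q(3) by (simp add: s_def field_simps)
      qed
      then have "CH.N e y' = \<bar>s\<bar> * CH.N e y" by linarith
      then show ?thesis using Nsq[OF e, of y x] y(2) by (simp add: power_mult_distrib s)
    qed
    have "y' \<in> CH.T"
    proof -
      have "sq n y' = 1 / q * (\<Sum>i<n. (y i)\<^sup>2)" by (simp add: sq_def y'_def power_mult_distrib s sum_divide_distrib)
      also have "\<dots> \<le> 1 / q * q" using y(3) q by (intro mult_left_mono) auto
      finally have 1: "sq n y' \<le> 1" using q by simp
      have "(\<Sum>e\<in>E0. (CH.N e y')\<^sup>2) = 1 / q * (\<Sum>e\<in>E0. w e * edge_energy e x)"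
        by (simp add: N_y' sum_distrib_left cong: sum.cong)
      also have "(\<Sum>e\<in>E0. w e * edge_energy e x) \<le> energy E w x"
        unfolding energy_def using finE E0 term_nonneg by (intro sum_mono2) auto
      also have "1 / q * energy E w x \<le> 1 / q * q" using q by (intro mult_left_mono) auto
      finally have "(\<Sum>e\<in>E0. (CH.N e y')\<^sup>2) \<le> 1" using q by (simp add: divide_right_mono)
      then show ?thesis using 1 y(1) by (simp add: CH.T_def y'_def)
    qed
    from \<epsilon>(2)[OF this] have "\<bar>\<Sum>e\<in>E0. (CH.N e y')\<^sup>2 * \<epsilon> e\<bar> \<le> 1720000 * sqrt (A / card E)" using bnd by linarith
    moreover have "(\<Sum>e\<in>E0. (CH.N e y')\<^sup>2 * \<epsilon> e) = 1 / q * (\<Sum>e\<in>E0. w e * edge_energy e x * \<epsilon> e)"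
      unfolding sum_distrib_left by (intro sum.cong) (auto simp: N_y')
    ultimately have "\<bar>\<Sum>e\<in>E0. w e * edge_energy e x * \<epsilon> e\<bar> / q \<le> 1720000 * sqrt (A / card E)"
      using q by (simp add: abs_mult)
    then show ?thesis using q unfolding q_def[symmetric] by (simp add: field_simps)
  qed
  then show ?thesis using E0 heavy \<epsilon>(1) by blast
qed

definition rew :: "'a set set \<Rightarrow> 'a set \<Rightarrow> real" where
  "rew E0 e = (if e \<in> E0 then 2 * w e else w e)"

text \<open>Keeping the sign \<open>s\<close> with doubled weight multiplies the term of
  \<open>e\<close> by \<open>1 + s * \<epsilon> e\<close>, so the error is exactly the signed
  sum.\<close>

lemma energy_rew_diff:
  assumes E0: "E0 \<subseteq> E" and \<epsilon>: "\<epsilon> \<in> signs E0" and s: "s = 1 \<or> s = -1"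
  shows "energy (E - E0 \<union> {e\<in>E0. \<epsilon> e = s}) (rew E0) x - energy E w x = s * (\<Sum>e\<in>E0. w e * edge_energy e x * \<epsilon> e)"
proof -
  define F where "F = (\<lambda>e. w e * edge_energy e x)"
  have fin0: "finite E0" using finE E0 finite_subset by blast
  have "energy (E - E0 \<union> {e\<in>E0. \<epsilon> e = s}) (rew E0) x = sum F (E - E0) + (\<Sum>e\<in>{e\<in>E0. \<epsilon> e = s}. 2 * F e)"
    unfolding energy_def
    by (subst sum.union_disjoint) (auto simp: finE fin0 rew_def F_def intro!: arg_cong2[where f = "(+)"] sum.cong)
  also have "(\<Sum>e\<in>{e\<in>E0. \<epsilon> e = s}. 2 * F e) = (\<Sum>e\<in>E0. F e + s * (F e * \<epsilon> e))"
    unfolding sum.inter_filter[OF fin0]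
  proof (rule sum.cong[OF refl])
    fix e assume "e \<in> E0"
    from signs_cases[OF \<epsilon> this] s
    show "(if \<epsilon> e = s then 2 * F e else 0) = F e + s * (F e * \<epsilon> e)" by auto
  qed
  also have "\<dots> = sum F E0 + s * (\<Sum>e\<in>E0. F e * \<epsilon> e)" by (simp add: sum.distrib sum_distrib_left)
  also have "sum F (E - E0) + (sum F E0 + s * (\<Sum>e\<in>E0. F e * \<epsilon> e)) = energy E w x + s * (\<Sum>e\<in>E0. F e * \<epsilon> e)"
    using sum.subset_diff[OF E0 finE, of F] by (simp add: energy_def F_def)
  finally show ?thesis by (simp add: F_def)
qed

text \<open>At most a quarter of the hyperedges is exempt from the signing, and at most half of the
  others survives: \<open>1 / 4 + 1 / 2 * (3 / 4) = 5 / 8\<close>.\<close>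

lemma halving_regularised:
  assumes m: "4 * n \<le> card E" and \<delta>: "0 < \<delta>"
  shows "\<exists>E0 E1. E1 \<subseteq> E0 \<and> E0 \<subseteq> E \<and> 8 * card (E - E0 \<union> E1) \<le> 5 * card E \<and>
    (\<forall>x. \<bar>energy E w x - energy (E - E0 \<union> E1) (rew E0) x\<bar>
      \<le> 1720000 * sqrt (A / card E) * (energy E w x + \<delta> * ((\<Sum>u\<in>V. (x u)\<^sup>2) + 1)))"
proof -
  obtain E0 \<epsilon> where E0: "E0 \<subseteq> E" "4 * card (E - E0) \<le> card E" and \<epsilon>: "\<epsilon> \<in> signs E0"
    and b: "\<And>x. \<bar>\<Sum>e\<in>E0. w e * edge_energy e x * \<epsilon> e\<bar> \<le> 1720000 * sqrt (A / card E) * (energy E w x + \<delta> * ((\<Sum>u\<in>V. (x u)\<^sup>2) + 1))"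
    using signing[OF m \<delta>] by blast
  have fin0: "finite E0" using finE E0 finite_subset by blast
  define P where "P = (\<lambda>s. {e\<in>E0. \<epsilon> e = s})"
  have "P 1 \<union> P (-1) = E0" "P 1 \<inter> P (-1) = {}" using signs_cases[OF \<epsilon>] by (auto simp: P_def)
  then have "card (P 1) + card (P (-1)) = card E0"
    using fin0 by (metis P_def card_Un_disjoint finite_Un)
  then obtain s :: real where s: "s = 1 \<or> s = -1" "2 * card (P s) \<le> card E0"
    by (metis add_le_mono mult_2 nat_le_linear linorder_not_le add_less_mono less_imp_le)
  have "card (E - E0 \<union> P s) \<le> card (E - E0) + card (P s)" by (rule card_Un_le)
  moreover have "card (E - E0) + card E0 = card E"
    using E0 fin0 finE by (metis card_Diff_subset card_mono le_add_diff_inverse2)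
  ultimately have "8 * card (E - E0 \<union> P s) \<le> 5 * card E" using s(2) E0(2) by linarith
  moreover have "\<bar>energy E w x - energy (E - E0 \<union> P s) (rew E0) x\<bar>
      \<le> 1720000 * sqrt (A / card E) * (energy E w x + \<delta> * ((\<Sum>u\<in>V. (x u)\<^sup>2) + 1))" for x
  proof -
    have "energy (E - E0 \<union> P s) (rew E0) x - energy E w x = s * (\<Sum>e\<in>E0. w e * edge_energy e x * \<epsilon> e)"
      unfolding P_def by (rule energy_rew_diff[OF E0(1) \<epsilon> s(1)])
    from arg_cong[OF this, of abs]
    have "\<bar>energy E w x - energy (E - E0 \<union> P s) (rew E0) x\<bar> = \<bar>s * (\<Sum>e\<in>E0. w e * edge_energy e x * \<epsilon> e)\<bar>"
      by (simp only: abs_minus_commute)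
    also have "\<dots> = \<bar>\<Sum>e\<in>E0. w e * edge_energy e x * \<epsilon> e\<bar>" using s(1) by auto
    finally show ?thesis using b[of x] by simp
  qed
  moreover have "P s \<subseteq> E0" by (auto simp: P_def)
  ultimately show ?thesis using E0(1) by blast
qed

text \<open>Only finitely many pairs \<open>(E0, E1)\<close> are possible, so one of them works for
  arbitrarily small \<open>\<delta>\<close>.\<close>

lemma halving:
  assumes m: "4 * n \<le> card E"
  shows "\<exists>E' w'. E' \<subseteq> E \<and> (\<forall>e\<in>E'. 0 \<le> w' e) \<and> 8 * card E' \<le> 5 * card E \<and>
    (\<forall>x. \<bar>energy E w x - energy E' w' x\<bar> \<le> 1720000 * sqrt (A / card E) * energy E w x)"
proof -
  define S where "S = 1720000 * sqrt (A / card E)"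
  have S0: "0 \<le> S" using A_pos by (simp add: S_def)
  define \<delta> where "\<delta> = (\<lambda>k. 1 / real (Suc k))"
  define good where "good = (\<lambda>k p. snd p \<subseteq> fst p \<and> fst p \<subseteq> E \<and> 8 * card (E - fst p \<union> snd p) \<le> 5 * card E \<and>
    (\<forall>x. \<bar>energy E w x - energy (E - fst p \<union> snd p) (rew (fst p)) x\<bar> \<le> S * (energy E w x + \<delta> k * ((\<Sum>u\<in>V. (x u)\<^sup>2) + 1))))"
  have ex: "\<exists>p. good k p" for k
    using halving_regularised[OF m, of "\<delta> k"] unfolding good_def S_def by (auto simp: \<delta>_def)
  define p where "p = (\<lambda>k. SOME q. good k q)"
  have p: "good k (p k)" for k unfolding p_def by (rule someI_ex[OF ex])
  have "p ` UNIV \<subseteq> Pow E \<times> Pow E"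
  proof
    fix q assume "q \<in> p ` UNIV"
    then obtain k where "q = p k" by auto
    then show "q \<in> Pow E \<times> Pow E" using p[of k] by (auto simp: good_def mem_Times_iff)
  qed
  then have "finite (p ` UNIV)" using finE by (meson finite_Pow_iff finite_SigmaI finite_subset)
  from pigeonhole_infinite[OF infinite_UNIV_nat this]
  obtain k0 where inf: "infinite {k. p k = p k0}" by auto
  define E' where "E' = E - fst (p k0) \<union> snd (p k0)"
  define w' where "w' = rew (fst (p k0))"
  have "\<bar>energy E w x - energy E' w' x\<bar> \<le> S * energy E w x" for x
  proof (rule field_le_epsilon)
    fix r :: real assume r: "0 < r"
    define c where "c = S * ((\<Sum>u\<in>V. (x u)\<^sup>2) + 1)"
    have c: "0 \<le> c" using S0 by (simp add: c_def sum_nonneg)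
    obtain k1 :: nat where k1: "c / r < k1" using reals_Archimedean2 by blast
    obtain k where k: "k1 \<le> k" "p k = p k0" using inf unfolding infinite_nat_iff_unbounded_le by blast
    have "\<bar>energy E w x - energy E' w' x\<bar> \<le> S * (energy E w x + \<delta> k * ((\<Sum>u\<in>V. (x u)\<^sup>2) + 1))"
      using p[of k] unfolding good_def k(2) E'_def w'_def by blast
    also have "\<dots> = S * energy E w x + c / real (Suc k)" by (simp add: \<delta>_def c_def distrib_left add_divide_distrib)
    also have "c / real (Suc k) \<le> r"
    proof -
      have "c / r \<le> real (Suc k)" using k1 k(1) by linarith
      then show ?thesis using r by (simp add: field_simps)
    qed
    finally show "\<bar>energy E w x - energy E' w' x\<bar> \<le> S * energy E w x + r" by simp
  qed
  moreover have "E' \<subseteq> E" "8 * card E' \<le> 5 * card E" using p[of k0] by (auto simp: good_def E'_def)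
  moreover have "\<forall>e\<in>E'. 0 \<le> w' e" using E(3) \<open>E' \<subseteq> E\<close> by (auto simp: w'_def rew_def)
  ultimately show ?thesis unfolding S_def by blast
qed

end

text \<open>Each halving of \<open>m\<close> hyperedges has error \<open>O(sqrt (A / m))\<close>, and these errors grow
  geometrically as \<open>m\<close> decreases to \<open>M\<close>, so that they telescope.\<close>

lemma iterated_halving:
  fixes V :: "'a set" and M :: real
  assumes "finite V" "2 \<le> card V" "2 \<le> D"
  defines A: "A \<equiv> card V * ln (card V) * ln D"
  assumes M: "4 * card V \<le> M" "27520000\<^sup>2 * A \<le> M"
    and "hypergraph V E w D"
  shows "\<exists>E' w'. E' \<subseteq> E \<and> (\<forall>e\<in>E'. 0 \<le> w' e) \<and> card E' \<le> M \<and>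
    (\<forall>x. \<bar>energy E w x - energy E' w' x\<bar> \<le> (if card E \<le> M then 0 else 13760000 * (2 * sqrt (A / M) - sqrt (A / card E))) * energy E w x)"
  using \<open>hypergraph V E w D\<close>
proof (induction "card E" arbitrary: E w rule: less_induct)
  case less
  interpret hypergraph V E w D by (rule less.prems)
  have A_eq: "hypergraph.A V D = A" by (simp add: A hypergraph.A_def[OF less.prems] n_def)
  have A0: "0 < A" using A_pos unfolding A_eq .
  have M0: "0 < M" using M(1) n2 by linarith
  show ?case
  proof (cases "card E \<le> M")
    case True
    then show ?thesis using E(3) by (intro exI[of _ E] exI[of _ w]) auto
  next
    case False
    then have mM: "M < card E" by simp
    define m where "m = real (card E)"
    have m: "0 < m" "M < m" using mM M0 by (auto simp: m_def)
    have "4 * card V \<le> card E" using M(1) mM by linarith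
    then obtain E1 w1 where E1: "E1 \<subseteq> E" "\<forall>e\<in>E1. 0 \<le> w1 e" "8 * card E1 \<le> 5 * card E"
      and h: "\<And>x. \<bar>energy E w x - energy E1 w1 x\<bar> \<le> 1720000 * sqrt (A / m) * energy E w x"
      using halving unfolding A_eq n_def m_def by blast
    have H1: "hypergraph V E1 w1 D"
    proof
      show "finite E1" using E1(1) finE by (rule finite_subset)
    qed (use finV E D n2 E1 in blast)+
    have "card E1 < card E" using E1(3) m by (simp add: m_def)
    from less.hyps[OF this H1] obtain E' w' where E': "E' \<subseteq> E1" "\<forall>e\<in>E'. 0 \<le> w' e" "card E' \<le> M"
      and g: "\<And>x. \<bar>energy E1 w1 x - energy E' w' x\<bar> \<le> (if card E1 \<le> M then 0 else 13760000 * (2 * sqrt (A / M) - sqrt (A / card E1))) * energy E1 w1 x"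
      by blast
    define s where "s = sqrt (A / m)"
    define t where "t = sqrt (A / M)"
    have st: "0 \<le> s" "s \<le> t" using A0 m M0 by (auto simp: s_def t_def intro!: divide_left_mono)
    have t1: "27520000 * t \<le> 1"
    proof -
      have "27520000 * t = sqrt (27520000\<^sup>2 * A / M)"
        using real_sqrt_mult[of "27520000\<^sup>2" "A / M"] by (simp add: t_def)
      also have "\<dots> \<le> sqrt 1" using M(2) M0 by (intro real_sqrt_le_mono) simp
      finally show ?thesis by simp
    qed
    have "\<bar>energy E w x - energy E' w' x\<bar> \<le> 13760000 * (2 * t - s) * energy E w x" for x
    proof -
      define e0 where "e0 = energy E w x"
      define e1 where "e1 = energy E1 w1 x"
      define e2 where "e2 = energy E' w' x"
      have e0: "0 \<le> e0" using energy_nonneg by (simp add: e0_def)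
      have e1: "0 \<le> e1" using hypergraph.energy_nonneg[OF H1] by (simp add: e1_def)
      have h': "\<bar>e0 - e1\<bar> \<le> 1720000 * s * e0" using h[of x] by (simp add: e0_def e1_def s_def)
      show ?thesis
      proof (cases "card E1 \<le> M")
        case True
        then have "e1 = e2" using g[of x] by (simp add: e1_def e2_def)
        then have "\<bar>e0 - e2\<bar> \<le> 1720000 * s * e0" using h' by simp
        also have "\<dots> \<le> 13760000 * (2 * t - s) * e0" using st e0 by (intro mult_right_mono) auto
        finally show ?thesis by (simp add: e0_def e2_def)
      next
        case False
        define s1 where "s1 = sqrt (A / card E1)"
        have c1: "M < card E1" using False by simp
        have s1: "s1 \<le> t" "5 / 4 * s \<le> s1"
        proof -
          show "s1 \<le> t" using A0 M0 c1 by (auto simp: s1_def t_def intro!: divide_left_mono)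
          have "8 * real (card E1) \<le> 5 * m" using E1(3) by (simp add: m_def)
          \<comment> \<open>The growth of the errors: the number of hyperedges shrinks by a factor
            of at least \<open>8 / 5\<close>, and \<open>(5 / 4)^2 \<le> 8 / 5\<close>.\<close>
          then have "(5 / 4)\<^sup>2 * (A / m) \<le> A / card E1"
            using A0 m M0 c1 by (simp add: field_simps power2_eq_square)
          then have "sqrt ((5 / 4)\<^sup>2 * (A / m)) \<le> s1" unfolding s1_def by (rule real_sqrt_le_mono)
          then show "5 / 4 * s \<le> s1" using real_sqrt_mult[of "(5 / 4)\<^sup>2" "A / m"] by (simp add: s_def)
        qed
        \<comment> \<open>The error bound of the remaining halvings. As
          \<open>13760000 = 8 * 1720000\<close> and \<open>s1 - s \<ge> s / 4\<close>, passing from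
          \<open>s1\<close> to \<open>s\<close> releases \<open>2 * 1720000 * s\<close>: once for
          the present halving, once for its effect on the later errors, where
          \<open>G \<le> 1\<close> enters.\<close>
        define G where "G = 13760000 * (2 * t - s1)"
        have G: "0 \<le> G" "G \<le> 1" using s1 st t1 by (auto simp: G_def)
        have g': "\<bar>e1 - e2\<bar> \<le> G * e1" using g[of x] False by (simp add: e1_def e2_def G_def s1_def t_def)
        have "G * e1 \<le> G * e0 + 1720000 * s * e0"
        proof -
          have "G * (e1 - e0) \<le> G * \<bar>e0 - e1\<bar>" using G by (intro mult_left_mono) auto
          also have "\<dots> \<le> 1 * (1720000 * s * e0)"
            using h' G by (intro mult_mono) auto
          finally have "G * (e1 - e0) \<le> 1 * (1720000 * s * e0)" .
          then show ?thesis by (simp add: algebra_simps)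
        qed
        then have "\<bar>e0 - e2\<bar> \<le> (G + 3440000 * s) * e0" using h' g' by (simp add: algebra_simps)
        also have "\<dots> \<le> 13760000 * (2 * t - s) * e0"
          using s1 e0 by (intro mult_right_mono) (auto simp: G_def)
        finally show ?thesis by (simp add: e0_def e2_def)
      qed
    qed
    then show ?thesis
      using False E1(1) E' by (intro exI[of _ E'] exI[of _ w']) (auto simp: s_def t_def m_def)
  qed
qed

theorem theorem1p1:
  shows "\<exists>C::real. C > 0 \<and>
    (\<forall>(V :: 'a set) (E :: 'a set set) (w :: 'a set \<Rightarrow> real) (\<epsilon> :: real).
      weighted_hypergraph V E w \<and> \<epsilon> > 0 \<longrightarrow>
      (\<exists>(E' :: 'a set set) (w' :: 'a set \<Rightarrow> real).
        spectral_sparsifier \<epsilon> V E w E' w' \<and>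
        real (card E') \<le> C * (ln (real (max_edge_size E)) / \<epsilon>\<^sup>2) *
          real (card V) * ln (real (card V))))"
proof (intro exI[of _ "27520000\<^sup>2"] conjI allI impI)
  show "0 < (27520000\<^sup>2 :: real)" by simp
  fix V :: "'a set" and E :: "'a set set" and w :: "'a set \<Rightarrow> real" and \<epsilon> :: real
  assume "weighted_hypergraph V E w \<and> \<epsilon> > 0"
  then have wh: "finite V" "finite E" "\<And>e. e \<in> E \<Longrightarrow> e \<subseteq> V \<and> 2 \<le> card e \<and> 0 \<le> w e" "E \<noteq> {}" and \<epsilon>: "0 < \<epsilon>"
    by (auto simp: weighted_hypergraph_def weighted_hypergraph0_def)
  define D where "D = real (max_edge_size E)"
  have De: "real (card e) \<le> D" if "e \<in> E" for e
    unfolding D_def max_edge_size_def using that wh(2) by (intro of_nat_mono Max_ge) auto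
  obtain e0 where e0: "e0 \<in> E" using wh(4) by auto
  have D2: "2 \<le> D" using De[OF e0] wh(3)[OF e0] by linarith
  have "card e0 \<le> card V" using wh(3)[OF e0] wh(1) by (intro card_mono) auto
  then have n2: "2 \<le> card V" using wh(3)[OF e0] by linarith
  interpret hypergraph V E w D
    using wh De D2 n2 by unfold_locales auto
  define A where "A = card V * ln (card V) * ln D"
  \<comment> \<open>Chosen so that \<open>2 * 13760000 * sqrt (A / M) = \<epsilon>\<close>, the
    total error of \<open>iterated_halving\<close> up to a negative term.\<close>
  define M where "M = 27520000\<^sup>2 * A / \<epsilon>\<^sup>2"
  have M_eq: "M = 27520000\<^sup>2 * (ln (real (max_edge_size E)) / \<epsilon>\<^sup>2) * real (card V) * ln (real (card V))"
    by (simp add: M_def A_def D_def)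
  have A0: "0 < A" using n2 D2 by (auto simp: A_def)
  show "\<exists>E' w'. spectral_sparsifier \<epsilon> V E w E' w' \<and> real (card E') \<le> 27520000\<^sup>2 * (ln (real (max_edge_size E)) / \<epsilon>\<^sup>2) *
          real (card V) * ln (real (card V))"
  \<comment> \<open>For large \<open>\<epsilon>\<close> this \<open>M\<close> falls below the size
    at which halving is controlled, but then removing all hyperedges is allowed.\<close>
  proof (cases "1 \<le> \<epsilon>")
    case True
    have "energy E w x \<le> \<epsilon> * energy E w x" for x
      using mult_right_mono[OF True energy_nonneg[of x]] by simp
    then have "spectral_sparsifier \<epsilon> V E w {} w"
      using wh(1) energy_nonneg by (simp add: spectral_sparsifier_def weighted_hypergraph0_def energy_def[of "{}"])
    moreover have "0 \<le> M" using A0 by (simp add: M_def)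
    ultimately show ?thesis unfolding M_eq[symmetric] by (intro exI[of _ "{}"] exI[of _ w]) simp
  next
    case False
    then have e1: "\<epsilon>\<^sup>2 \<le> 1" using \<epsilon> by (simp add: power_le_one)
    have MA: "27520000\<^sup>2 * A \<le> M"
      using A0 e1 \<epsilon> by (simp add: M_def field_simps)
    have M4: "4 * card V \<le> M"
    proof -
      have "1 / 2 \<le> ln (real (card V))" "1 / 2 \<le> ln D"
        using half_le_ln2 n2 D2 ln_le_cancel_iff[of 2 "real (card V)"] ln_le_cancel_iff[of 2 D] by linarith+
      then have "1 / 2 * (1 / 2) \<le> ln (card V) * ln D" by (intro mult_mono) auto
      then have "card V * (1 / 4) \<le> A" unfolding A_def mult.assoc by (intro mult_left_mono) auto
      then show ?thesis using MA by simp
    qed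
    obtain E' w' where E': "E' \<subseteq> E" "\<forall>e\<in>E'. 0 \<le> w' e" "card E' \<le> M"
      and b: "\<And>x. \<bar>energy E w x - energy E' w' x\<bar> \<le> (if card E \<le> M then 0 else 13760000 * (2 * sqrt (A / M) - sqrt (A / card E))) * energy E w x"
      using iterated_halving[OF wh(1) n2 D2 M4 MA[unfolded A_def] hypergraph_axioms, folded A_def] by blast
    have sM: "27520000 * sqrt (A / M) = \<epsilon>"
    proof -
      have "A / M = (\<epsilon> / 27520000)\<^sup>2" using A0 \<epsilon> by (simp add: M_def power_divide)
      then show ?thesis using \<epsilon> by simp
    qed
    have "\<bar>energy E w x - energy E' w' x\<bar> \<le> \<epsilon> * energy E w x" for x
    proof -
      have "(if card E \<le> M then 0 else 13760000 * (2 * sqrt (A / M) - sqrt (A / card E))) \<le> \<epsilon>"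
        using sM \<epsilon> A0 by (simp add: algebra_simps)
      from mult_right_mono[OF this energy_nonneg[of x]] b[of x] show ?thesis by linarith
    qed
    moreover have "\<forall>e\<in>E'. e \<subseteq> V \<and> 2 \<le> card e \<and> 0 \<le> w' e" using E' wh(3) by blast
    ultimately have "spectral_sparsifier \<epsilon> V E w E' w'"
      using E'(1) wh(1,2) finite_subset[OF E'(1)] by (simp add: spectral_sparsifier_def weighted_hypergraph0_def)
    then show ?thesis unfolding M_eq[symmetric] using E'(3) by blast
  qed
qed

end
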